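(* If $\mathfrak{a}$ is a finite-dimensional Lie algebra over a field of prime characteristic, then the injective hull of every artinian $\mathfrak{a}$-module is artinian.
   Context: An $\mathfrak{a}$-module is the same as a unital $U(\mathfrak{a})$-module, where $U(\mathfrak{a})$ is the universal enveloping algebra; injective hulls are taken in the category of all $U(\mathfrak{a})$-modules. *)

theory Defs
  imports
    "HOL-Algebra.Algebraic_Closure_Type"
    "HOL-Algebra.Module"
    "HOL-Library.Poly_Mapping"
begin

section \<open>Lie algebras\<close>

locale lie_algebra = vector_space scale
  for scale :: "'k::field \<Rightarrow> 'a::ab_group_add \<Rightarrow> 'a" +
  fixes bracket :: "'a \<Rightarrow> 'a \<Rightarrow> 'a"
  assumes bracket_add_left: "bracket (x + y) z = bracket x z + bracket y z"
    and bracket_add_right: "bracket x (y + z) = bracket x y + bracket x z"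
    and bracket_scale_left: "bracket (scale c x) y = scale c (bracket x y)"
    and bracket_scale_right: "bracket x (scale c y) = scale c (bracket x y)"
    and bracket_self: "bracket x x = 0"
    and jacobi: "bracket x (bracket y z) + bracket y (bracket z x) + bracket z (bracket x y) = 0"


section \<open>The universal enveloping algebra\<close>

text \<open>
  Finitely supported functions on the free monoid over a set, with the convolution product of
  \<^theory>\<open>HOL-Library.Poly_Mapping\<close>, form the free unital associative algebra on that set.
  The monoid operation is written additively because \<^theory>\<open>HOL-Library.Poly_Mapping\<close> asks
  for \<^class>\<open>monoid_add\<close>.
\<close>

datatype 'a free_word = Free_Word (letters: "'a list")

instantiation free_word :: (type) monoid_add
begin

definition zero_free_word :: "'a free_word"
  where "0 = Free_Word []"

definition plus_free_word :: "'a free_word \<Rightarrow> 'a free_word \<Rightarrow> 'a free_word"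
  where "v + w = Free_Word (letters v @ letters w)"

instance
  by standard (simp_all add: zero_free_word_def plus_free_word_def)

end

type_synonym ('a, 'k) free_algebra = "'a free_word \<Rightarrow>\<^sub>0 'k"

definition free_gen :: "'a \<Rightarrow> ('a, 'k::field) free_algebra"
  where "free_gen x = Poly_Mapping.single (Free_Word [x]) 1"

definition free_const :: "'k::field \<Rightarrow> ('a, 'k) free_algebra"
  where "free_const c = Poly_Mapping.single 0 c"

text \<open>
  The first two families of relations make the canonical map from the Lie algebra linear (so that
  the free algebra on the underlying set becomes the tensor algebra); the third one turns the
  bracket into the commutator.
\<close>

definition uea_relations ::
    "('k::field \<Rightarrow> 'a::ab_group_add \<Rightarrow> 'a) \<Rightarrow> ('a \<Rightarrow> 'a \<Rightarrow> 'a) \<Rightarrow> ('a, 'k) free_algebra set"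
  where "uea_relations scale bracket =
      {free_gen (x + y) - (free_gen x + free_gen y) | x y. True}
    \<union> {free_gen (scale c x) - free_const c * free_gen x | c x. True}
    \<union> {free_gen x * free_gen y - free_gen y * free_gen x - free_gen (bracket x y) | x y. True}"

definition universal_enveloping_algebra ::
    "('k::field \<Rightarrow> 'a::ab_group_add \<Rightarrow> 'a) \<Rightarrow> ('a \<Rightarrow> 'a \<Rightarrow> 'a) \<Rightarrow> ('a, 'k) free_algebra set ring"
  where "universal_enveloping_algebra scale bracket =
    ring_of_type_algebra Quot (genideal ring_of_type_algebra (uea_relations scale bracket))"

lemma ring_ring_of_type_algebra: "ring (ring_of_type_algebra :: 'r::ring_1 ring)"
proof (rule ringI)
  have "\<exists>y. y + x = 0" for x :: 'r
    by (rule exI[of _ "- x"]) simp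
  then show "abelian_group (ring_of_type_algebra :: 'r ring)"
    by (intro abelian_groupI) (auto simp: ring_of_type_algebra_def ac_simps)
  show "monoid (ring_of_type_algebra :: 'r ring)"
    by (intro monoidI) (auto simp: ring_of_type_algebra_def ac_simps)
qed (auto simp: ring_of_type_algebra_def algebra_simps)

lemma ring_universal_enveloping_algebra: "ring (universal_enveloping_algebra scale bracket)"
  unfolding universal_enveloping_algebra_def
  by (intro ideal.quotient_is_ring ring.genideal_ideal ring_ring_of_type_algebra)
     (simp add: ring_of_type_algebra_def)


section \<open>Modules over a ring that need not be commutative\<close>

text \<open>
  The library locale \<open>module\<close> requires a commutative ring of scalars. As there, the fields
  \<open>mult\<close> and \<open>one\<close> of the module record are ignored.
\<close>

locale left_module = R?: ring R + M?: abelian_group M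
  for R :: "('r, 'd) ring_scheme" (structure) and M :: "('r, 'm, 'c) module_scheme" (structure) +
  assumes smult_closed [simp, intro]:
      "\<lbrakk>a \<in> carrier R; x \<in> carrier M\<rbrakk> \<Longrightarrow> a \<odot>\<^bsub>M\<^esub> x \<in> carrier M"
    and smult_l_distr:
      "\<lbrakk>a \<in> carrier R; b \<in> carrier R; x \<in> carrier M\<rbrakk> \<Longrightarrow>
        (a \<oplus>\<^bsub>R\<^esub> b) \<odot>\<^bsub>M\<^esub> x = a \<odot>\<^bsub>M\<^esub> x \<oplus>\<^bsub>M\<^esub> b \<odot>\<^bsub>M\<^esub> x"
    and smult_r_distr:
      "\<lbrakk>a \<in> carrier R; x \<in> carrier M; y \<in> carrier M\<rbrakk> \<Longrightarrow>
        a \<odot>\<^bsub>M\<^esub> (x \<oplus>\<^bsub>M\<^esub> y) = a \<odot>\<^bsub>M\<^esub> x \<oplus>\<^bsub>M\<^esub> a \<odot>\<^bsub>M\<^esub> y"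
    and smult_assoc:
      "\<lbrakk>a \<in> carrier R; b \<in> carrier R; x \<in> carrier M\<rbrakk> \<Longrightarrow>
        (a \<otimes>\<^bsub>R\<^esub> b) \<odot>\<^bsub>M\<^esub> x = a \<odot>\<^bsub>M\<^esub> (b \<odot>\<^bsub>M\<^esub> x)"
    and smult_one [simp]: "x \<in> carrier M \<Longrightarrow> \<one>\<^bsub>R\<^esub> \<odot>\<^bsub>M\<^esub> x = x"

definition left_module_hom ::
    "('r, 'd) ring_scheme \<Rightarrow> ('r, 'm, 'b) module_scheme \<Rightarrow> ('r, 'n, 'c) module_scheme \<Rightarrow> ('m \<Rightarrow> 'n) set"
  where "left_module_hom R M N =
    {f \<in> carrier M \<rightarrow> carrier N.
      (\<forall>x\<in>carrier M. \<forall>y\<in>carrier M. f (x \<oplus>\<^bsub>M\<^esub> y) = f x \<oplus>\<^bsub>N\<^esub> f y) \<and>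
      (\<forall>a\<in>carrier R. \<forall>x\<in>carrier M. f (a \<odot>\<^bsub>M\<^esub> x) = a \<odot>\<^bsub>N\<^esub> f x)}"

definition artinian_module ::
    "('r, 'd) ring_scheme \<Rightarrow> ('r, 'm, 'c) module_scheme \<Rightarrow> bool"
  where "artinian_module R M \<longleftrightarrow> left_module R M \<and>
    (\<forall>N :: nat \<Rightarrow> 'm set. (\<forall>i. submodule (N i) R M) \<and> (\<forall>i. N (Suc i) \<subseteq> N i) \<longrightarrow>
      (\<exists>n. \<forall>m\<ge>n. N m = N n))"

text \<open>
  A definition cannot quantify over types, so the extension property is required for monomorphisms
  \<open>j : A \<rightarrow> B\<close> between modules whose elements have the type of the ring elements. This is no
  restriction: \<open>injective_module_extends\<close> below derives the property for modules over
  arbitrary types.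
\<close>

definition injective_module ::
    "('r, 'd) ring_scheme \<Rightarrow> ('r, 'm, 'c) module_scheme \<Rightarrow> bool"
  where "injective_module R E \<longleftrightarrow> left_module R E \<and>
    (\<forall>(A :: ('r, 'r) module) (B :: ('r, 'r) module) j f.
      left_module R A \<and> left_module R B \<and>
      j \<in> left_module_hom R A B \<and> inj_on j (carrier A) \<and> f \<in> left_module_hom R A E \<longrightarrow>
      (\<exists>g\<in>left_module_hom R B E. \<forall>x\<in>carrier A. g (j x) = f x))"

definition essential_mono ::
    "('r, 'd) ring_scheme \<Rightarrow> ('r, 'm, 'b) module_scheme \<Rightarrow> ('m \<Rightarrow> 'n) \<Rightarrow> ('r, 'n, 'c) module_scheme \<Rightarrow> bool"
  where "essential_mono R M j E \<longleftrightarrow>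
    left_module R M \<and> left_module R E \<and> j \<in> left_module_hom R M E \<and> inj_on j (carrier M) \<and>
    (\<forall>N. submodule N R E \<and> N \<noteq> {\<zero>\<^bsub>E\<^esub>} \<longrightarrow> N \<inter> j ` carrier M \<noteq> {\<zero>\<^bsub>E\<^esub>})"

definition injective_hull ::
    "('r, 'd) ring_scheme \<Rightarrow> ('r, 'm, 'b) module_scheme \<Rightarrow> ('m \<Rightarrow> 'n) \<Rightarrow> ('r, 'n, 'c) module_scheme \<Rightarrow> bool"
  where "injective_hull R M j E \<longleftrightarrow> injective_module R E \<and> essential_mono R M j E"


section \<open>Injectivity does not depend on the types of the test modules\<close>

lemma left_module_homD:
  assumes "f \<in> left_module_hom R M N"
  shows "x \<in> carrier M \<Longrightarrow> f x \<in> carrier N"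
    and "x \<in> carrier M \<Longrightarrow> y \<in> carrier M \<Longrightarrow> f (x \<oplus>\<^bsub>M\<^esub> y) = f x \<oplus>\<^bsub>N\<^esub> f y"
    and "a \<in> carrier R \<Longrightarrow> x \<in> carrier M \<Longrightarrow> f (a \<odot>\<^bsub>M\<^esub> x) = a \<odot>\<^bsub>N\<^esub> f x"
  using assms by (auto simp: left_module_hom_def)

context left_module
begin

lemma smult_l_null [simp]: "x \<in> carrier M \<Longrightarrow> \<zero>\<^bsub>R\<^esub> \<odot>\<^bsub>M\<^esub> x = \<zero>\<^bsub>M\<^esub>"
  using smult_l_distr[of "\<zero>\<^bsub>R\<^esub>" "\<zero>\<^bsub>R\<^esub>" x] M.add.r_cancel_one'[of "\<zero>\<^bsub>R\<^esub> \<odot>\<^bsub>M\<^esub> x" "\<zero>\<^bsub>R\<^esub> \<odot>\<^bsub>M\<^esub> x"]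
  by simp

lemma smult_minus_one:
  assumes "x \<in> carrier M"
  shows "(\<ominus>\<^bsub>R\<^esub> \<one>\<^bsub>R\<^esub>) \<odot>\<^bsub>M\<^esub> x = \<ominus>\<^bsub>M\<^esub> x"
proof -
  have "(\<ominus>\<^bsub>R\<^esub> \<one>\<^bsub>R\<^esub>) \<odot>\<^bsub>M\<^esub> x \<oplus>\<^bsub>M\<^esub> x = (\<ominus>\<^bsub>R\<^esub> \<one>\<^bsub>R\<^esub> \<oplus>\<^bsub>R\<^esub> \<one>\<^bsub>R\<^esub>) \<odot>\<^bsub>M\<^esub> x"
    using assms smult_l_distr[of "\<ominus>\<^bsub>R\<^esub> \<one>\<^bsub>R\<^esub>" "\<one>\<^bsub>R\<^esub>" x] by simp
  also have "\<dots> = \<zero>\<^bsub>M\<^esub>"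
    using assms by (simp add: R.l_neg)
  finally show ?thesis
    using assms M.minus_equality by simp
qed

end

lemma left_module_hom_zero:
  assumes "left_module R M" "left_module R N" "f \<in> left_module_hom R M N"
  shows "f \<zero>\<^bsub>M\<^esub> = \<zero>\<^bsub>N\<^esub>"
proof -
  interpret M: left_module R M by fact
  interpret N: left_module R N by fact
  have "f \<zero>\<^bsub>M\<^esub> = f (\<zero>\<^bsub>R\<^esub> \<odot>\<^bsub>M\<^esub> \<zero>\<^bsub>M\<^esub>)" by simp
  also have "\<dots> = \<zero>\<^bsub>R\<^esub> \<odot>\<^bsub>N\<^esub> f \<zero>\<^bsub>M\<^esub>"
    by (rule left_module_homD(3)[OF assms(3)]) auto
  also have "\<dots> = \<zero>\<^bsub>N\<^esub>"
    using left_module_homD(1)[OF assms(3)] by simp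
  finally show ?thesis .
qed

text \<open>Graphs of homomorphisms from a submodule of \<open>B\<close> to \<open>E\<close>.\<close>

definition partial_hom_graph ::
    "('r, 'd) ring_scheme \<Rightarrow> ('r, 'm, 'b) module_scheme \<Rightarrow> ('r, 'n, 'c) module_scheme \<Rightarrow> ('m \<times> 'n) set \<Rightarrow> bool"
  where "partial_hom_graph R B E G \<longleftrightarrow>
    G \<subseteq> carrier B \<times> carrier E \<and>
    (\<forall>x e y d. (x, e) \<in> G \<longrightarrow> (y, d) \<in> G \<longrightarrow> (x \<oplus>\<^bsub>B\<^esub> y, e \<oplus>\<^bsub>E\<^esub> d) \<in> G) \<and>
    (\<forall>a x e. a \<in> carrier R \<longrightarrow> (x, e) \<in> G \<longrightarrow> (a \<odot>\<^bsub>B\<^esub> x, a \<odot>\<^bsub>E\<^esub> e) \<in> G) \<and>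
    (\<forall>e. (\<zero>\<^bsub>B\<^esub>, e) \<in> G \<longrightarrow> e = \<zero>\<^bsub>E\<^esub>)"

lemma partial_hom_graphD:
  assumes "partial_hom_graph R B E G"
  shows "(x, e) \<in> G \<Longrightarrow> x \<in> carrier B" "(x, e) \<in> G \<Longrightarrow> e \<in> carrier E"
    and "(x, e) \<in> G \<Longrightarrow> (y, d) \<in> G \<Longrightarrow> (x \<oplus>\<^bsub>B\<^esub> y, e \<oplus>\<^bsub>E\<^esub> d) \<in> G"
    and "a \<in> carrier R \<Longrightarrow> (x, e) \<in> G \<Longrightarrow> (a \<odot>\<^bsub>B\<^esub> x, a \<odot>\<^bsub>E\<^esub> e) \<in> G"
    and "(\<zero>\<^bsub>B\<^esub>, e) \<in> G \<Longrightarrow> e = \<zero>\<^bsub>E\<^esub>"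
  using assms unfolding partial_hom_graph_def by blast+

lemma partial_hom_graph_minus:
  assumes "left_module R B" "left_module R E" "partial_hom_graph R B E G"
    "(x, e) \<in> G" "(y, d) \<in> G"
  shows "(x \<ominus>\<^bsub>B\<^esub> y, e \<ominus>\<^bsub>E\<^esub> d) \<in> G"
proof -
  interpret B: left_module R B by fact
  interpret E: left_module R E by fact
  note G = partial_hom_graphD[OF assms(3)]
  have "((\<ominus>\<^bsub>R\<^esub> \<one>\<^bsub>R\<^esub>) \<odot>\<^bsub>B\<^esub> y, (\<ominus>\<^bsub>R\<^esub> \<one>\<^bsub>R\<^esub>) \<odot>\<^bsub>E\<^esub> d) \<in> G"
    using assms(5) by (intro G) auto
  then have "(\<ominus>\<^bsub>B\<^esub> y, \<ominus>\<^bsub>E\<^esub> d) \<in> G"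
    using assms(5) G(1,2) by (metis B.smult_minus_one E.smult_minus_one)
  from G(3)[OF assms(4) this] show ?thesis
    by (simp add: a_minus_def)
qed

lemma partial_hom_graph_unique:
  assumes "left_module R B" "left_module R E" "partial_hom_graph R B E G"
    "(x, e) \<in> G" "(x, d) \<in> G"
  shows "e = d"
proof -
  interpret B: left_module R B by fact
  interpret E: left_module R E by fact
  note G = partial_hom_graphD[OF assms(3)]
  have "x \<ominus>\<^bsub>B\<^esub> x = \<zero>\<^bsub>B\<^esub>"
    using G(1)[OF assms(4)] by (simp add: a_minus_def B.M.r_neg)
  then have "e \<ominus>\<^bsub>E\<^esub> d = \<zero>\<^bsub>E\<^esub>"
    using G(5) partial_hom_graph_minus[OF assms] by simp
  then show ?thesis
    using G(2)[OF assms(4)] G(2)[OF assms(5)]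
    by (metis E.M.a_inv_closed a_minus_def E.M.minus_equality E.M.minus_minus)
qed

lemma injective_module_graph_step:
  fixes B :: "('r, 'm, 'b) module_scheme" and E :: "('r, 'n, 'c) module_scheme"
  assumes inj: "injective_module R E" and B: "left_module R B"
    and G: "partial_hom_graph R B E G" and G0: "(\<zero>\<^bsub>B\<^esub>, \<zero>\<^bsub>E\<^esub>) \<in> G"
    and b: "b \<in> carrier B"
  shows "\<exists>G' e. partial_hom_graph R B E G' \<and> G \<subseteq> G' \<and> (b, e) \<in> G'"
proof -
  have E: "left_module R E"
    using inj by (simp add: injective_module_def)
  interpret B: left_module R B by fact
  interpret E: left_module R E by fact
  note GD = partial_hom_graphD[OF G]
  note Gu = partial_hom_graph_unique[OF B E G]
  define I where "I = {r \<in> carrier R. \<exists>e. (r \<odot>\<^bsub>B\<^esub> b, e) \<in> G}"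
  define val where "val r = (THE e. (r \<odot>\<^bsub>B\<^esub> b, e) \<in> G)" for r
  have valI: "val r = e" if "(r \<odot>\<^bsub>B\<^esub> b, e) \<in> G" for r e
    unfolding val_def using that Gu[OF _ that] by (rule the_equality)
  have val: "(r \<odot>\<^bsub>B\<^esub> b, val r) \<in> G" if "r \<in> I" for r
  proof -
    obtain e where "(r \<odot>\<^bsub>B\<^esub> b, e) \<in> G"
      using \<open>r \<in> I\<close> by (auto simp: I_def)
    with valI show ?thesis by simp
  qed
  define reg :: "('r, 'r) module" where
    "reg = \<lparr>carrier = carrier R, monoid.mult = monoid.mult R, one = one R, ring.zero = ring.zero R, add = add R, module.smult = monoid.mult R\<rparr>"
  define idl :: "('r, 'r) module" where "idl = reg\<lparr>carrier := I\<rparr>"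
  have reg: "left_module R reg"
  proof (intro left_module.intro left_module_axioms.intro)
    show "ring R" ..
    show "abelian_group reg"
      by (rule abelian_groupI)
         (auto simp: reg_def B.R.a_ac intro: B.R.add.l_inv_ex)
  qed (auto simp: reg_def B.R.l_distr B.R.r_distr B.R.m_assoc)
  have I_sub: "r \<in> carrier R" if "r \<in> I" for r
    using that by (simp add: I_def)
  have I_add: "r \<oplus>\<^bsub>R\<^esub> s \<in> I" "val (r \<oplus>\<^bsub>R\<^esub> s) = val r \<oplus>\<^bsub>E\<^esub> val s" if "r \<in> I" "s \<in> I" for r s
  proof -
    have "((r \<oplus>\<^bsub>R\<^esub> s) \<odot>\<^bsub>B\<^esub> b, val r \<oplus>\<^bsub>E\<^esub> val s) \<in> G"
      using GD(3)[OF val val, OF that] that b by (simp add: B.smult_l_distr I_sub)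
    then show "r \<oplus>\<^bsub>R\<^esub> s \<in> I" "val (r \<oplus>\<^bsub>R\<^esub> s) = val r \<oplus>\<^bsub>E\<^esub> val s"
      using that valI by (auto simp: I_def)
  qed
  have I_mult: "a \<otimes>\<^bsub>R\<^esub> r \<in> I" "val (a \<otimes>\<^bsub>R\<^esub> r) = a \<odot>\<^bsub>E\<^esub> val r" if "a \<in> carrier R" "r \<in> I" for a r
  proof -
    have "((a \<otimes>\<^bsub>R\<^esub> r) \<odot>\<^bsub>B\<^esub> b, a \<odot>\<^bsub>E\<^esub> val r) \<in> G"
      using GD(4)[OF that(1) val, OF that(2)] that b by (simp add: B.smult_assoc I_sub)
    then show "a \<otimes>\<^bsub>R\<^esub> r \<in> I" "val (a \<otimes>\<^bsub>R\<^esub> r) = a \<odot>\<^bsub>E\<^esub> val r"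
      using that valI by (auto simp: I_def)
  qed
  have I_zero: "\<zero>\<^bsub>R\<^esub> \<in> I"
    using G0 b by (auto simp: I_def)
  have I_neg: "\<exists>s\<in>I. r \<oplus>\<^bsub>R\<^esub> s = \<zero>\<^bsub>R\<^esub>" if "r \<in> I" for r
  proof
    show "(\<ominus>\<^bsub>R\<^esub> \<one>\<^bsub>R\<^esub>) \<otimes>\<^bsub>R\<^esub> r \<in> I"
      using that by (intro I_mult) auto
    show "r \<oplus>\<^bsub>R\<^esub> (\<ominus>\<^bsub>R\<^esub> \<one>\<^bsub>R\<^esub>) \<otimes>\<^bsub>R\<^esub> r = \<zero>\<^bsub>R\<^esub>"
      using I_sub[OF that] by (simp add: B.R.l_minus B.R.r_neg)
  qed
  have idl: "left_module R idl"
  proof (intro left_module.intro left_module_axioms.intro)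
    show "ring R" ..
    show "abelian_group idl"
      by (rule abelian_groupI)
         (auto simp: idl_def reg_def I_add I_zero I_sub B.R.a_ac intro: I_neg)
  qed (auto simp: idl_def reg_def I_sub I_mult B.R.l_distr B.R.r_distr B.R.m_assoc)
  have "id \<in> left_module_hom R idl reg"
    by (auto simp: left_module_hom_def idl_def reg_def I_sub)
  moreover have "inj_on id (carrier idl)"
    by simp
  moreover have "val \<in> left_module_hom R idl E"
    by (auto simp: left_module_hom_def idl_def reg_def I_add I_mult GD(2)[OF val])
  ultimately obtain h where h: "h \<in> left_module_hom R reg E"
    and h_val: "\<forall>r\<in>carrier idl. h (id r) = val r"
    using inj idl reg unfolding injective_module_def by blast
  define e0 where "e0 = h \<one>\<^bsub>R\<^esub>"
  have e0: "e0 \<in> carrier E"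
    using left_module_homD(1)[OF h] by (simp add: e0_def reg_def)
  have h_eq: "h r = r \<odot>\<^bsub>E\<^esub> e0" if "r \<in> carrier R" for r
    using left_module_homD(3)[OF h, of r "\<one>\<^bsub>R\<^esub>"] that by (simp add: e0_def reg_def)
  have key: "e = r \<odot>\<^bsub>E\<^esub> e0" if "r \<in> carrier R" "(r \<odot>\<^bsub>B\<^esub> b, e) \<in> G" for r e
    using that h_val h_eq valI by (auto simp: I_def idl_def)
  define G' where
    "G' = {(x \<oplus>\<^bsub>B\<^esub> r \<odot>\<^bsub>B\<^esub> b, e \<oplus>\<^bsub>E\<^esub> r \<odot>\<^bsub>E\<^esub> e0) | x e r. (x, e) \<in> G \<and> r \<in> carrier R}"
  have "partial_hom_graph R B E G'"
    unfolding partial_hom_graph_def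
  proof (intro conjI allI impI)
    show "G' \<subseteq> carrier B \<times> carrier E"
      using GD(1,2) b e0 by (auto simp: G'_def)
  next
    fix x e y d assume "(x, e) \<in> G'" "(y, d) \<in> G'"
    then obtain x' e' r y' d' s where
      eq: "(x', e') \<in> G" "r \<in> carrier R" "x = x' \<oplus>\<^bsub>B\<^esub> r \<odot>\<^bsub>B\<^esub> b" "e = e' \<oplus>\<^bsub>E\<^esub> r \<odot>\<^bsub>E\<^esub> e0"
      "(y', d') \<in> G" "s \<in> carrier R" "y = y' \<oplus>\<^bsub>B\<^esub> s \<odot>\<^bsub>B\<^esub> b" "d = d' \<oplus>\<^bsub>E\<^esub> s \<odot>\<^bsub>E\<^esub> e0"
      unfolding G'_def by blast
    note cl = GD(1)[OF eq(1)] GD(2)[OF eq(1)] GD(1)[OF eq(5)] GD(2)[OF eq(5)]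
    have "x \<oplus>\<^bsub>B\<^esub> y = (x' \<oplus>\<^bsub>B\<^esub> y') \<oplus>\<^bsub>B\<^esub> (r \<oplus>\<^bsub>R\<^esub> s) \<odot>\<^bsub>B\<^esub> b"
      using eq cl b by (simp add: B.smult_l_distr B.M.a_ac)
    moreover have "e \<oplus>\<^bsub>E\<^esub> d = (e' \<oplus>\<^bsub>E\<^esub> d') \<oplus>\<^bsub>E\<^esub> (r \<oplus>\<^bsub>R\<^esub> s) \<odot>\<^bsub>E\<^esub> e0"
      using eq cl e0 by (simp add: E.smult_l_distr E.M.a_ac)
    moreover have "(x' \<oplus>\<^bsub>B\<^esub> y', e' \<oplus>\<^bsub>E\<^esub> d') \<in> G" "r \<oplus>\<^bsub>R\<^esub> s \<in> carrier R"
      using eq GD(3) by auto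
    ultimately show "(x \<oplus>\<^bsub>B\<^esub> y, e \<oplus>\<^bsub>E\<^esub> d) \<in> G'"
      unfolding G'_def by blast
  next
    fix a x e assume a: "a \<in> carrier R" and "(x, e) \<in> G'"
    then obtain x' e' r where
      eq: "(x', e') \<in> G" "r \<in> carrier R" "x = x' \<oplus>\<^bsub>B\<^esub> r \<odot>\<^bsub>B\<^esub> b" "e = e' \<oplus>\<^bsub>E\<^esub> r \<odot>\<^bsub>E\<^esub> e0"
      unfolding G'_def by blast
    note cl = GD(1)[OF eq(1)] GD(2)[OF eq(1)]
    have "a \<odot>\<^bsub>B\<^esub> x = a \<odot>\<^bsub>B\<^esub> x' \<oplus>\<^bsub>B\<^esub> (a \<otimes>\<^bsub>R\<^esub> r) \<odot>\<^bsub>B\<^esub> b"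
      using eq cl b a by (simp add: B.smult_r_distr B.smult_assoc)
    moreover have "a \<odot>\<^bsub>E\<^esub> e = a \<odot>\<^bsub>E\<^esub> e' \<oplus>\<^bsub>E\<^esub> (a \<otimes>\<^bsub>R\<^esub> r) \<odot>\<^bsub>E\<^esub> e0"
      using eq cl e0 a by (simp add: E.smult_r_distr E.smult_assoc)
    moreover have "(a \<odot>\<^bsub>B\<^esub> x', a \<odot>\<^bsub>E\<^esub> e') \<in> G" "a \<otimes>\<^bsub>R\<^esub> r \<in> carrier R"
      using eq a GD(4) by auto
    ultimately show "(a \<odot>\<^bsub>B\<^esub> x, a \<odot>\<^bsub>E\<^esub> e) \<in> G'"
      unfolding G'_def by blast
  next
    fix e assume "(\<zero>\<^bsub>B\<^esub>, e) \<in> G'"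
    then obtain x' e' r where
      eq: "(x', e') \<in> G" "r \<in> carrier R" "\<zero>\<^bsub>B\<^esub> = x' \<oplus>\<^bsub>B\<^esub> r \<odot>\<^bsub>B\<^esub> b" "e = e' \<oplus>\<^bsub>E\<^esub> r \<odot>\<^bsub>E\<^esub> e0"
      unfolding G'_def by blast
    note cl = GD(1)[OF eq(1)] GD(2)[OF eq(1)]
    have rb: "r \<odot>\<^bsub>B\<^esub> b \<in> carrier B"
      using eq(2) b by simp
    then have "r \<odot>\<^bsub>B\<^esub> b \<oplus>\<^bsub>B\<^esub> x' = \<zero>\<^bsub>B\<^esub>"
      using eq(3) cl B.M.a_comm by metis
    then have "\<ominus>\<^bsub>B\<^esub> x' = r \<odot>\<^bsub>B\<^esub> b"
      using cl rb B.M.minus_equality by blast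
    then have "\<zero>\<^bsub>B\<^esub> \<ominus>\<^bsub>B\<^esub> x' = r \<odot>\<^bsub>B\<^esub> b"
      using rb by (simp add: a_minus_def)
    then have "(r \<odot>\<^bsub>B\<^esub> b, \<zero>\<^bsub>E\<^esub> \<ominus>\<^bsub>E\<^esub> e') \<in> G"
      using partial_hom_graph_minus[OF B E G G0 eq(1)] by simp
    then have "\<zero>\<^bsub>E\<^esub> \<ominus>\<^bsub>E\<^esub> e' = r \<odot>\<^bsub>E\<^esub> e0"
      using key eq(2) by blast
    then show "e = \<zero>\<^bsub>E\<^esub>"
      using eq(4) cl by (metis a_minus_def E.M.l_zero E.M.r_neg E.M.a_inv_closed)
  qed
  moreover have "G \<subseteq> G'"
  proof (rule subrelI)
    fix x e assume xe: "(x, e) \<in> G"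
    then have "x = x \<oplus>\<^bsub>B\<^esub> \<zero>\<^bsub>R\<^esub> \<odot>\<^bsub>B\<^esub> b" "e = e \<oplus>\<^bsub>E\<^esub> \<zero>\<^bsub>R\<^esub> \<odot>\<^bsub>E\<^esub> e0"
      using GD(1,2) b e0 by auto
    then show "(x, e) \<in> G'"
      using xe B.R.zero_closed unfolding G'_def by blast
  qed
  moreover have "(b, e0) \<in> G'"
  proof -
    have "b = \<zero>\<^bsub>B\<^esub> \<oplus>\<^bsub>B\<^esub> \<one>\<^bsub>R\<^esub> \<odot>\<^bsub>B\<^esub> b" "e0 = \<zero>\<^bsub>E\<^esub> \<oplus>\<^bsub>E\<^esub> \<one>\<^bsub>R\<^esub> \<odot>\<^bsub>E\<^esub> e0"
      using b e0 by auto
    then show ?thesis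
      using G0 B.R.one_closed unfolding G'_def by blast
  qed
  ultimately show ?thesis by blast
qed

theorem injective_module_extends:
  fixes A :: "('r, 'l, 'a) module_scheme" and B :: "('r, 'm, 'b) module_scheme"
    and E :: "('r, 'n, 'c) module_scheme"
  assumes inj: "injective_module R E" and A: "left_module R A" and B: "left_module R B"
    and j: "j \<in> left_module_hom R A B" "inj_on j (carrier A)" and f: "f \<in> left_module_hom R A E"
  shows "\<exists>g\<in>left_module_hom R B E. \<forall>x\<in>carrier A. g (j x) = f x"
proof -
  have E: "left_module R E"
    using inj by (simp add: injective_module_def)
  interpret A: left_module R A by fact
  interpret B: left_module R B by fact
  interpret E: left_module R E by fact
  note jD = left_module_homD[OF j(1)] and fD = left_module_homD[OF f]
  define G0 where "G0 = (\<lambda>x. (j x, f x)) ` carrier A"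
  have j0: "j \<zero>\<^bsub>A\<^esub> = \<zero>\<^bsub>B\<^esub>" and f0: "f \<zero>\<^bsub>A\<^esub> = \<zero>\<^bsub>E\<^esub>"
    using left_module_hom_zero A B E j(1) f by blast+
  have G0_zero: "(\<zero>\<^bsub>B\<^esub>, \<zero>\<^bsub>E\<^esub>) \<in> G0"
    unfolding G0_def using j0 f0 by (intro image_eqI[of _ _ "\<zero>\<^bsub>A\<^esub>"]) auto
  have G0: "partial_hom_graph R B E G0"
    unfolding partial_hom_graph_def
  proof (intro conjI allI impI)
    show "G0 \<subseteq> carrier B \<times> carrier E"
      using jD fD by (auto simp: G0_def)
    fix x e y d assume "(x, e) \<in> G0" "(y, d) \<in> G0"
    then obtain u v where "u \<in> carrier A" "v \<in> carrier A" "x = j u" "e = f u" "y = j v" "d = f v"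
      by (auto simp: G0_def)
    then show "(x \<oplus>\<^bsub>B\<^esub> y, e \<oplus>\<^bsub>E\<^esub> d) \<in> G0"
      unfolding G0_def using jD fD by (intro image_eqI[of _ _ "u \<oplus>\<^bsub>A\<^esub> v"]) auto
  next
    fix a x e assume "a \<in> carrier R" "(x, e) \<in> G0"
    then obtain u where "u \<in> carrier A" "x = j u" "e = f u"
      by (auto simp: G0_def)
    then show "(a \<odot>\<^bsub>B\<^esub> x, a \<odot>\<^bsub>E\<^esub> e) \<in> G0"
      unfolding G0_def using jD fD \<open>a \<in> carrier R\<close> by (intro image_eqI[of _ _ "a \<odot>\<^bsub>A\<^esub> u"]) auto
  next
    fix e assume "(\<zero>\<^bsub>B\<^esub>, e) \<in> G0"
    then obtain u where u: "u \<in> carrier A" "j u = \<zero>\<^bsub>B\<^esub>" "e = f u"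
      by (auto simp: G0_def)
    then have "u = \<zero>\<^bsub>A\<^esub>"
      using j(2) j0 by (metis A.M.zero_closed inj_onD)
    then show "e = \<zero>\<^bsub>E\<^esub>"
      using u f0 by simp
  qed
  define F where "F = {G. partial_hom_graph R B E G \<and> G0 \<subseteq> G}"
  have "\<exists>G\<in>F. \<forall>H\<in>F. G \<subseteq> H \<longrightarrow> H = G"
  proof (rule subset_Zorn_nonempty)
    show "F \<noteq> {}"
      using G0 by (auto simp: F_def)
    fix C assume C: "C \<noteq> {}" "subset.chain F C"
    have CF: "partial_hom_graph R B E G" "G0 \<subseteq> G" if "G \<in> C" for G
      using C(2) that by (auto simp: subset.chain_def F_def)
    have both: "\<exists>G\<in>C. p \<in> G \<and> q \<in> G" if "p \<in> \<Union>C" "q \<in> \<Union>C" for p q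
    proof -
      obtain G H where GH: "G \<in> C" "H \<in> C" "p \<in> G" "q \<in> H"
        using \<open>p \<in> \<Union>C\<close> \<open>q \<in> \<Union>C\<close> by blast
      with C(2) have "G \<subseteq> H \<or> H \<subseteq> G"
        by (meson subset_chain_def)
      with GH show ?thesis by blast
    qed
    have "partial_hom_graph R B E (\<Union>C)"
      unfolding partial_hom_graph_def
    proof (intro conjI allI impI)
      show "\<Union>C \<subseteq> carrier B \<times> carrier E"
        using CF(1) unfolding partial_hom_graph_def by blast
    next
      fix x e y d assume "(x, e) \<in> \<Union>C" "(y, d) \<in> \<Union>C"
      then obtain G where "G \<in> C" "(x, e) \<in> G" "(y, d) \<in> G"
        using both by blast
      then show "(x \<oplus>\<^bsub>B\<^esub> y, e \<oplus>\<^bsub>E\<^esub> d) \<in> \<Union>C"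
        using CF(1) partial_hom_graphD(3) by fast
    next
      fix a x e assume "a \<in> carrier R" "(x, e) \<in> \<Union>C"
      then show "(a \<odot>\<^bsub>B\<^esub> x, a \<odot>\<^bsub>E\<^esub> e) \<in> \<Union>C"
        using CF(1) partial_hom_graphD(4) by fast
    next
      fix e assume "(\<zero>\<^bsub>B\<^esub>, e) \<in> \<Union>C"
      then show "e = \<zero>\<^bsub>E\<^esub>"
        using CF(1) partial_hom_graphD(5) by fast
    qed
    then show "\<Union>C \<in> F"
      using C(1) CF(2) by (auto simp: F_def)
  qed
  then obtain G where "G \<in> F" and max: "\<And>H. H \<in> F \<Longrightarrow> G \<subseteq> H \<Longrightarrow> H = G"
    by blast
  then have G: "partial_hom_graph R B E G" "G0 \<subseteq> G"
    by (auto simp: F_def)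
  note GD = partial_hom_graphD[OF G(1)] and Gu = partial_hom_graph_unique[OF B E G(1)]
  have "\<exists>e. (b, e) \<in> G" if b: "b \<in> carrier B" for b
  proof -
    obtain G' e where G': "partial_hom_graph R B E G'" "G \<subseteq> G'" "(b, e) \<in> G'"
      using injective_module_graph_step[OF inj B G(1) _ b] G0_zero G(2) by blast
    then have "G' = G"
      using G(2) by (intro max) (auto simp: F_def)
    with G'(3) show ?thesis by blast
  qed
  then obtain g where g: "\<And>b. b \<in> carrier B \<Longrightarrow> (b, g b) \<in> G"
    by metis
  have "g \<in> left_module_hom R B E"
    unfolding left_module_hom_def
  proof (intro CollectI conjI ballI)
    show "g \<in> carrier B \<rightarrow> carrier E"
      using g GD(2) by blast
    show "g (x \<oplus>\<^bsub>B\<^esub> y) = g x \<oplus>\<^bsub>E\<^esub> g y" if "x \<in> carrier B" "y \<in> carrier B" for x y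
      using Gu[OF g GD(3)[OF g g]] that by simp
    show "g (a \<odot>\<^bsub>B\<^esub> x) = a \<odot>\<^bsub>E\<^esub> g x" if "a \<in> carrier R" "x \<in> carrier B" for a x
      using Gu[OF g GD(4)[OF _ g]] that by simp
  qed
  moreover have "g (j x) = f x" if "x \<in> carrier A" for x
  proof (rule Gu[OF g])
    show "j x \<in> carrier B"
      using jD that by simp
    show "(j x, f x) \<in> G"
      using G(2) that by (auto simp: G0_def)
  qed
  ultimately show ?thesis by blast
qed

end

theory Submission
  imports Defs
begin

text \<open>
  Let \<open>R\<close> be the enveloping algebra, \<open>Z\<close> its centre and \<open>p\<close> the characteristic. The proof has two
  independent halves: \<open>R\<close> is a noetherian module over \<open>Z\<close>, and over every ring with this property
  an essential extension of an artinian module is artinian. The injective hull is such an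
  extension.

  The first half is Jacobson's observation. As the iterates \<open>ad x\<close>, \<open>(ad x)^p\<close>, \<open>(ad x)^(p^2)\<close> and so on are
  linearly dependent, and as \<open>ad (x^q) = (ad x)^q\<close> in \<open>R\<close> for every power \<open>q\<close> of \<open>p\<close>, some monic linear
  combination of \<open>p\<close>-power powers of \<open>x\<close> is central. Take one such element for every \<open>x\<close> in a
  finite basis. Words in the basis may be reordered modulo shorter words, so a long word, in which
  some letter must be frequent, can be shortened by splitting off one of these central elements.
  Hence \<open>R\<close> is finitely generated over a polynomial ring that acts through the centre
  (\<open>p_polynomials_generate\<close>), and Hilbert's basis theorem (\<open>acc_below_Union_poly_span\<close>) gives the
  chain condition.

  For the second half let \<open>s\<close> be an element of an \<open>R\<close>-module \<open>E\<close> and let \<open>C\<close> be a submodule that is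
  maximal among those that avoid \<open>s\<close>. The key is that \<open>E / C\<close> is artinian
  (\<open>dcc_between_maximal_avoiding\<close>). Every nonzero submodule of \<open>E / C\<close> contains the class of \<open>s\<close>. The
  elements of \<open>Z\<close> that kill this class form a maximal ideal \<open>m\<close> of \<open>Z\<close> (\<open>central_inverse\<close>), and by
  Fitting's argument they act locally nilpotently on \<open>E / C\<close> (\<open>central_torsion\<close>). The part of \<open>E / C\<close>
  that \<open>m\<close> kills is a vector space over the field \<open>Z / m\<close>; for a hyperplane of it that avoids \<open>s\<close>,
  finitely many preimages under elements of \<open>R\<close> intersect in zero, so this part has finite
  dimension (\<open>dcc_between_annihilated\<close>). A dual form of Hilbert's basis theorem
  (\<open>dcc_between_locally_nilpotent\<close>) extends the descending chain condition from this part to all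
  of \<open>E / C\<close>.

  Finally let \<open>E\<close> be an essential extension of an artinian module \<open>M\<close>. Among the submodules of \<open>E\<close> with
  artinian quotient choose one whose intersection with \<open>M\<close> is minimal. Were this intersection
  nonzero, it would contain some \<open>s \<noteq> 0\<close>, and intersecting with a submodule maximal among those that
  avoid \<open>s\<close> would make it smaller. So it is zero, the chosen submodule is zero because \<open>M\<close> is
  essential, and \<open>E\<close> is artinian.
\<close>

section \<open>Chain conditions\<close>

lemma chain_condition_minimal:
  fixes le :: "'x \<Rightarrow> 'x \<Rightarrow> bool"
  assumes le: "reflp le" "transp le" "antisymp le"
    and chain: "\<And>W. (\<And>i. P (W i)) \<Longrightarrow> (\<And>i. le (W (Suc i)) (W i)) \<Longrightarrow> \<exists>n. \<forall>m\<ge>n. W m = W n"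
    and "P x"
  shows "\<exists>x. P x \<and> (\<forall>y. P y \<and> le y x \<longrightarrow> y = x)"
proof (rule ccontr)
  assume "\<not> ?thesis"
  then have step: "\<exists>y. P y \<and> (le y x \<and> y \<noteq> x)" if "P x" for x
    using that by blast
  obtain W where W: "\<And>n. P (W n)" "\<And>n. le (W (Suc n)) (W n) \<and> W (Suc n) \<noteq> W n"
    using dependent_nat_choice[of "\<lambda>_ x. P x" "\<lambda>_ x y. le y x \<and> y \<noteq> x"] \<open>P x\<close> step by metis
  obtain n where "\<forall>m\<ge>n. W m = W n"
    using chain[of W] W by blast
  then have "W (Suc n) = W n" by (meson le_SucI order_refl)
  with W show False by blast
qed

lemma chain_le:
  fixes le :: "'x \<Rightarrow> 'x \<Rightarrow> bool" and W :: "nat \<Rightarrow> 'x"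
  assumes le: "reflp le" "transp le" and W: "\<And>i. le (W (Suc i)) (W i)" and "i \<le> j"
  shows "le (W j) (W i)"
  using \<open>i \<le> j\<close>
proof (induction rule: dec_induct)
  case base
  show ?case using le(1) by (rule reflpD)
next
  case (step n)
  then show ?case using W[of n] le(2) by (meson transpD)
qed

text \<open>
  The diagonal stabilises from some \<open>t\<close> on, which fixes all entries beyond \<open>(t, t)\<close>; each of the
  finitely many columns to the left of \<open>t\<close> stabilises by itself. The order is a parameter because
  ascending chains occur in Hilbert's basis theorem and descending ones in its dual.
\<close>

lemma double_chain_stabilises:
  fixes le :: "'x \<Rightarrow> 'x \<Rightarrow> bool" and W :: "nat \<Rightarrow> nat \<Rightarrow> 'x"
  assumes le: "reflp le" "transp le" "antisymp le"
    and P: "\<And>j i. P (W j i)"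
    and step1: "\<And>j i. le (W (Suc j) i) (W j i)" and step2: "\<And>j i. le (W j (Suc i)) (W j i)"
    and chain: "\<And>Y. (\<And>i. P (Y i)) \<Longrightarrow> (\<And>i. le (Y (Suc i)) (Y i)) \<Longrightarrow> \<exists>n. \<forall>m\<ge>n. Y m = Y n"
  shows "\<exists>s. \<forall>j\<ge>s. \<forall>i. W j i = W s i"
proof -
  note mono1 = chain_le[OF le(1,2), of "\<lambda>j. W j i" for i, OF step1]
  note mono2 = chain_le[OF le(1,2), of "W j" for j, OF step2]
  have "\<exists>n. \<forall>m\<ge>n. W m m = W n n"
    using P transpD[OF le(2) step1 step2] by (rule chain[of "\<lambda>j. W j j"])
  then obtain t where t: "\<And>m. m \<ge> t \<Longrightarrow> W m m = W t t" by blast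
  have corner: "W j i = W t t" if "j \<ge> t" "i \<ge> t" for j i
  proof (rule antisympD[OF le(3)])
    show "le (W j i) (W t t)"
      using mono1[OF that(1), of i] mono2[OF that(2), of t] transpD[OF le(2)] by blast
    have "le (W (max j i) (max j i)) (W j (max j i))" "le (W j (max j i)) (W j i)"
      using mono1[of j "max j i" "max j i"] mono2[of i "max j i" j] by simp_all
    then have "le (W (max j i) (max j i)) (W j i)"
      by (rule transpD[OF le(2)])
    then show "le (W t t) (W j i)"
      using t[of "max j i"] that by simp
  qed
  have "\<exists>n. \<forall>m\<ge>n. W m i = W n i" for i
    using step1 P by (intro chain[of "\<lambda>j. W j i"]) auto
  then obtain u where u: "\<And>i m. m \<ge> u i \<Longrightarrow> W m i = W (u i) i" by metis
  define s where "s = Max (insert t (u ` {..<t}))"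
  have s: "t \<le> s" "i < t \<Longrightarrow> u i \<le> s" for i
    unfolding s_def by auto
  have "W j i = W s i" if "j \<ge> s" for j i
  proof (cases "i < t")
    case True
    then show ?thesis using u[of i j] u[of i s] s(2)[OF True] that by simp
  next
    case False
    then show ?thesis using corner[of j i] corner[of s i] s that by simp
  qed
  then show ?thesis by blast
qed


section \<open>Submodules\<close>

lemma submoduleD:
  assumes "submodule N R M"
  shows "N \<subseteq> carrier M" "x \<in> N \<Longrightarrow> x \<in> carrier M" "\<zero>\<^bsub>M\<^esub> \<in> N" "x \<in> N \<Longrightarrow> y \<in> N \<Longrightarrow> x \<oplus>\<^bsub>M\<^esub> y \<in> N"
    "a \<in> carrier R \<Longrightarrow> x \<in> N \<Longrightarrow> a \<odot>\<^bsub>M\<^esub> x \<in> N"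
    "x \<in> N \<Longrightarrow> \<ominus>\<^bsub>M\<^esub> x \<in> N" "x \<in> N \<Longrightarrow> y \<in> N \<Longrightarrow> x \<ominus>\<^bsub>M\<^esub> y \<in> N"
proof -
  interpret submodule N R M by fact
  show "N \<subseteq> carrier M" using subset by simp
  then show "x \<in> N \<Longrightarrow> x \<in> carrier M" by blast
  show "\<zero>\<^bsub>M\<^esub> \<in> N" using one_closed by simp
  show "x \<in> N \<Longrightarrow> y \<in> N \<Longrightarrow> x \<oplus>\<^bsub>M\<^esub> y \<in> N" for x y using m_closed by simp
  show "a \<in> carrier R \<Longrightarrow> x \<in> N \<Longrightarrow> a \<odot>\<^bsub>M\<^esub> x \<in> N" by simp
  show inv: "x \<in> N \<Longrightarrow> \<ominus>\<^bsub>M\<^esub> x \<in> N" for x using m_inv_closed by (simp add: a_inv_def)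
  show "x \<in> N \<Longrightarrow> y \<in> N \<Longrightarrow> x \<ominus>\<^bsub>M\<^esub> y \<in> N"
    using m_closed inv by (simp add: a_minus_def)
qed

definition dcc_between ::
    "('r, 'd) ring_scheme \<Rightarrow> ('r, 'm, 'c) module_scheme \<Rightarrow> 'm set \<Rightarrow> 'm set \<Rightarrow> bool"
  where "dcc_between R M C D \<longleftrightarrow>
    (\<forall>N :: nat \<Rightarrow> 'm set.
      (\<forall>i. submodule (N i) R M \<and> C \<subseteq> N i \<and> N i \<subseteq> D) \<and> (\<forall>i. N (Suc i) \<subseteq> N i) \<longrightarrow>
      (\<exists>n. \<forall>m\<ge>n. N m = N n))"

lemma dcc_betweenD:
  assumes "dcc_between R M C D"
    and "\<And>i. submodule (N i) R M" "\<And>i. C \<subseteq> N i" "\<And>i. N i \<subseteq> D" "\<And>i. N (Suc i) \<subseteq> N i"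
  shows "\<exists>n. \<forall>m\<ge>n. N m = N n"
  using assms unfolding dcc_between_def by meson

lemma superset_order: "reflp (\<lambda>A B. B \<subseteq> A)" "transp (\<lambda>A B. B \<subseteq> A)" "antisymp (\<lambda>A B. B \<subseteq> A)"
  by (auto intro: reflpI transpI antisympI)

lemma subset_order: "reflp (\<subseteq>)" "transp (\<subseteq>)" "antisymp (\<subseteq>)"
  by (auto intro: reflpI transpI antisympI)

context left_module
begin

lemma submoduleI:
  assumes "N \<subseteq> carrier M" "\<zero>\<^bsub>M\<^esub> \<in> N" "\<And>x y. x \<in> N \<Longrightarrow> y \<in> N \<Longrightarrow> x \<oplus>\<^bsub>M\<^esub> y \<in> N"
    and smult: "\<And>a x. a \<in> carrier R \<Longrightarrow> x \<in> N \<Longrightarrow> a \<odot>\<^bsub>M\<^esub> x \<in> N"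
  shows "submodule N R M"
proof (intro submodule.intro subgroup.intro submodule_axioms.intro)
  show "inv\<^bsub>add_monoid M\<^esub> x \<in> N" if "x \<in> N" for x
    using smult[of "\<ominus>\<^bsub>R\<^esub> \<one>\<^bsub>R\<^esub>" x] smult_minus_one[of x] that assms(1) by (auto simp: a_inv_def)
qed (use assms in auto)

lemma submodule_carrier: "submodule (carrier M) R M"
  by (rule submoduleI) auto

lemma smult_r_null [simp]:
  assumes "a \<in> carrier R"
  shows "a \<odot>\<^bsub>M\<^esub> \<zero>\<^bsub>M\<^esub> = \<zero>\<^bsub>M\<^esub>"
  using smult_assoc[of a "\<zero>\<^bsub>R\<^esub>" "\<zero>\<^bsub>M\<^esub>"] assms by simp

lemma smult_r_minus:
  assumes "a \<in> carrier R" "x \<in> carrier M" "y \<in> carrier M"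
  shows "a \<odot>\<^bsub>M\<^esub> (x \<ominus>\<^bsub>M\<^esub> y) = a \<odot>\<^bsub>M\<^esub> x \<ominus>\<^bsub>M\<^esub> a \<odot>\<^bsub>M\<^esub> y"
proof -
  have "a \<odot>\<^bsub>M\<^esub> (\<ominus>\<^bsub>M\<^esub> y) = \<ominus>\<^bsub>M\<^esub> (a \<odot>\<^bsub>M\<^esub> y)"
    using smult_assoc[of a "\<ominus>\<^bsub>R\<^esub> \<one>\<^bsub>R\<^esub>" y] smult_assoc[of "\<ominus>\<^bsub>R\<^esub> \<one>\<^bsub>R\<^esub>" a y] assms
    by (simp add: smult_minus_one R.r_minus R.l_minus)
  with assms show ?thesis by (simp add: a_minus_def smult_r_distr)
qed

lemma eq_add_iff_diff_eq:
  assumes "x \<in> carrier M" "y \<in> carrier M" "z \<in> carrier M"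
  shows "x = y \<oplus>\<^bsub>M\<^esub> z \<longleftrightarrow> x \<ominus>\<^bsub>M\<^esub> y = z"
proof
  show "x \<ominus>\<^bsub>M\<^esub> y = z" if "x = y \<oplus>\<^bsub>M\<^esub> z"
    using that assms by (simp add: a_minus_def M.a_assoc M.a_comm[of z] M.r_neg2 M.r_neg1)
  show "x = y \<oplus>\<^bsub>M\<^esub> z" if "x \<ominus>\<^bsub>M\<^esub> y = z"
    using that[symmetric] assms M.r_neg2[of y x] M.a_comm[of x "\<ominus>\<^bsub>M\<^esub> y"] by (simp add: a_minus_def)
qed

lemma submodule_Int: "submodule N R M \<Longrightarrow> submodule N' R M \<Longrightarrow> submodule (N \<inter> N') R M"
  by (rule submoduleI) (auto dest: submoduleD)

lemma mem_set_add:
  "x \<in> N <+>\<^bsub>M\<^esub> N' \<longleftrightarrow> (\<exists>u\<in>N. \<exists>v\<in>N'. x = u \<oplus>\<^bsub>M\<^esub> v)"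
  by (auto simp: set_add_def set_mult_def)

lemma submodule_set_add:
  assumes N: "submodule N R M" and N': "submodule N' R M"
  shows "submodule (N <+>\<^bsub>M\<^esub> N') R M"
proof (rule submoduleI)
  note ND = submoduleD[OF N] and ND' = submoduleD[OF N']
  show "N <+>\<^bsub>M\<^esub> N' \<subseteq> carrier M"
    using ND(2) ND'(2) by (auto simp: mem_set_add)
  show "\<zero>\<^bsub>M\<^esub> \<in> N <+>\<^bsub>M\<^esub> N'"
    using ND(3) ND'(3) by (auto simp: mem_set_add intro!: bexI[of _ "\<zero>\<^bsub>M\<^esub>"])
  show "x \<oplus>\<^bsub>M\<^esub> y \<in> N <+>\<^bsub>M\<^esub> N'" if xy: "x \<in> N <+>\<^bsub>M\<^esub> N'" "y \<in> N <+>\<^bsub>M\<^esub> N'" for x y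
  proof -
    obtain u v u' v' where *: "u \<in> N" "u' \<in> N" "v \<in> N'" "v' \<in> N'"
      "x = u \<oplus>\<^bsub>M\<^esub> v" "y = u' \<oplus>\<^bsub>M\<^esub> v'"
      using xy by (auto simp: mem_set_add)
    then have "x \<oplus>\<^bsub>M\<^esub> y = (u \<oplus>\<^bsub>M\<^esub> u') \<oplus>\<^bsub>M\<^esub> (v \<oplus>\<^bsub>M\<^esub> v')"
      using ND(2) ND'(2) by (simp add: M.a_ac)
    then show ?thesis
      unfolding mem_set_add using ND(4) ND'(4) * by blast
  qed
  show "a \<odot>\<^bsub>M\<^esub> x \<in> N <+>\<^bsub>M\<^esub> N'" if a: "a \<in> carrier R" and x: "x \<in> N <+>\<^bsub>M\<^esub> N'" for a x
  proof -
    obtain u v where *: "u \<in> N" "v \<in> N'" "x = u \<oplus>\<^bsub>M\<^esub> v"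
      using x by (auto simp: mem_set_add)
    then have "a \<odot>\<^bsub>M\<^esub> x = a \<odot>\<^bsub>M\<^esub> u \<oplus>\<^bsub>M\<^esub> a \<odot>\<^bsub>M\<^esub> v"
      using ND(2) ND'(2) a by (simp add: smult_r_distr)
    then show ?thesis
      unfolding mem_set_add using ND(5)[OF a] ND'(5)[OF a] * by blast
  qed
qed

lemma set_add_upper:
  assumes "submodule N R M" "submodule N' R M"
  shows "N \<subseteq> N <+>\<^bsub>M\<^esub> N'" "N' \<subseteq> N <+>\<^bsub>M\<^esub> N'"
proof -
  note ND = submoduleD[OF assms(1)] and ND' = submoduleD[OF assms(2)]
  show "N \<subseteq> N <+>\<^bsub>M\<^esub> N'"
  proof
    fix x assume "x \<in> N"
    moreover from this have "x = x \<oplus>\<^bsub>M\<^esub> \<zero>\<^bsub>M\<^esub>" using ND(2) by simp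
    ultimately show "x \<in> N <+>\<^bsub>M\<^esub> N'" unfolding mem_set_add using ND'(3) by blast
  qed
  show "N' \<subseteq> N <+>\<^bsub>M\<^esub> N'"
  proof
    fix x assume "x \<in> N'"
    moreover from this have "x = \<zero>\<^bsub>M\<^esub> \<oplus>\<^bsub>M\<^esub> x" using ND'(2) by simp
    ultimately show "x \<in> N <+>\<^bsub>M\<^esub> N'" unfolding mem_set_add using ND(3) by blast
  qed
qed

lemma set_add_least:
  assumes "submodule D R M" "N \<subseteq> D" "N' \<subseteq> D"
  shows "N <+>\<^bsub>M\<^esub> N' \<subseteq> D"
  using submoduleD(4)[OF assms(1)] assms(2,3) unfolding mem_set_add subset_iff by blast

lemma submodule_orbit:
  assumes "e \<in> carrier M"
  shows "submodule ((\<lambda>r. r \<odot>\<^bsub>M\<^esub> e) ` carrier R) R M"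
proof (rule submoduleI)
  fix x y assume "x \<in> (\<lambda>r. r \<odot>\<^bsub>M\<^esub> e) ` carrier R" "y \<in> (\<lambda>r. r \<odot>\<^bsub>M\<^esub> e) ` carrier R"
  then show "x \<oplus>\<^bsub>M\<^esub> y \<in> (\<lambda>r. r \<odot>\<^bsub>M\<^esub> e) ` carrier R"
    using assms by (auto simp: smult_l_distr[symmetric])
next
  fix a x assume "a \<in> carrier R" "x \<in> (\<lambda>r. r \<odot>\<^bsub>M\<^esub> e) ` carrier R"
  then show "a \<odot>\<^bsub>M\<^esub> x \<in> (\<lambda>r. r \<odot>\<^bsub>M\<^esub> e) ` carrier R"
    using assms by (auto simp: smult_assoc[symmetric])
qed (use assms in \<open>auto intro: image_eqI[of _ _ "\<zero>\<^bsub>R\<^esub>"]\<close>)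

lemma exists_maximal_avoiding:
  assumes C: "submodule C R M" "C \<subseteq> D" "s \<notin> C"
  shows "\<exists>Q. submodule Q R M \<and> C \<subseteq> Q \<and> Q \<subseteq> D \<and> s \<notin> Q \<and>
    (\<forall>N. submodule N R M \<and> Q \<subseteq> N \<and> N \<subseteq> D \<and> s \<notin> N \<longrightarrow> N = Q)"
proof -
  define F where "F = {N. submodule N R M \<and> C \<subseteq> N \<and> N \<subseteq> D \<and> s \<notin> N}"
  have "\<exists>Q\<in>F. \<forall>N\<in>F. Q \<subseteq> N \<longrightarrow> N = Q"
  proof (rule subset_Zorn_nonempty)
    show "F \<noteq> {}" using C by (auto simp: F_def)
    fix K assume K: "K \<noteq> {}" "subset.chain F K"
    have KF: "submodule N R M" "C \<subseteq> N" "N \<subseteq> D" "s \<notin> N" if "N \<in> K" for N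
      using K(2) that by (auto simp: subset.chain_def F_def)
    have both: "\<exists>N\<in>K. x \<in> N \<and> y \<in> N" if xy: "x \<in> \<Union>K" "y \<in> \<Union>K" for x y
    proof -
      obtain N N' where NN: "N \<in> K" "N' \<in> K" "x \<in> N" "y \<in> N'"
        using xy by blast
      with K(2) have "N \<subseteq> N' \<or> N' \<subseteq> N" by (meson subset_chain_def)
      with NN show ?thesis by blast
    qed
    have "submodule (\<Union>K) R M"
    proof (rule submoduleI)
      show "\<Union>K \<subseteq> carrier M" using KF(1) submoduleD(1) by blast
      show "\<zero>\<^bsub>M\<^esub> \<in> \<Union>K" using KF(1) submoduleD(3) K(1) by blast
      show "x \<oplus>\<^bsub>M\<^esub> y \<in> \<Union>K" if "x \<in> \<Union>K" "y \<in> \<Union>K" for x y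
        using both[OF that] KF(1) submoduleD(4) by (metis UnionI)
      show "a \<odot>\<^bsub>M\<^esub> x \<in> \<Union>K" if "a \<in> carrier R" "x \<in> \<Union>K" for a x
        using that KF(1) submoduleD(5) by (metis UnionE UnionI)
    qed
    then show "\<Union>K \<in> F"
      using K(1) KF by (fastforce simp: F_def)
  qed
  then obtain Q where "Q \<in> F" "\<And>N. N \<in> F \<Longrightarrow> Q \<subseteq> N \<Longrightarrow> N = Q" by auto
  then show ?thesis unfolding F_def by (intro exI[of _ Q]) auto
qed

text \<open>
  By the modular law the interval from \<open>C \<inter> C'\<close> to \<open>C\<close> is a copy of the one from \<open>C'\<close> to \<open>C + C'\<close>.
  So a submodule \<open>N\<close> above \<open>C \<inter> C'\<close> is determined, within a chain, by \<open>N + C\<close> and \<open>(N \<inter> C) + C'\<close>.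
\<close>

lemma dcc_between_Int:
  assumes sub: "submodule C R M" "submodule C' R M" "submodule D R M"
    and CD: "C \<subseteq> D" "C' \<subseteq> D"
    and dcc: "dcc_between R M C D" "dcc_between R M C' D"
  shows "dcc_between R M (C \<inter> C') D"
  unfolding dcc_between_def
proof (intro allI impI)
  fix N :: "nat \<Rightarrow> 'm set"
  assume "(\<forall>i. submodule (N i) R M \<and> C \<inter> C' \<subseteq> N i \<and> N i \<subseteq> D) \<and> (\<forall>i. N (Suc i) \<subseteq> N i)"
  then have N: "\<And>i. submodule (N i) R M" "\<And>i. C \<inter> C' \<subseteq> N i" "\<And>i. N i \<subseteq> D" "\<And>i. N (Suc i) \<subseteq> N i"
    by auto
  have "\<exists>n. \<forall>m\<ge>n. N m <+>\<^bsub>M\<^esub> C = N n <+>\<^bsub>M\<^esub> C"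
  proof (rule dcc_betweenD[OF dcc(1)])
    fix i
    show "submodule (N i <+>\<^bsub>M\<^esub> C) R M" "C \<subseteq> N i <+>\<^bsub>M\<^esub> C" "N i <+>\<^bsub>M\<^esub> C \<subseteq> D"
      using N sub CD by (simp_all add: submodule_set_add set_add_upper set_add_least)
    show "N (Suc i) <+>\<^bsub>M\<^esub> C \<subseteq> N i <+>\<^bsub>M\<^esub> C"
      using N(4)[of i] unfolding mem_set_add subset_iff by blast
  qed
  then obtain n1 where n1: "\<And>m. m \<ge> n1 \<Longrightarrow> N m <+>\<^bsub>M\<^esub> C = N n1 <+>\<^bsub>M\<^esub> C" by blast
  have "\<exists>n. \<forall>m\<ge>n. (N m \<inter> C) <+>\<^bsub>M\<^esub> C' = (N n \<inter> C) <+>\<^bsub>M\<^esub> C'"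
  proof (rule dcc_betweenD[OF dcc(2)])
    fix i
    show "submodule ((N i \<inter> C) <+>\<^bsub>M\<^esub> C') R M" "C' \<subseteq> (N i \<inter> C) <+>\<^bsub>M\<^esub> C'"
      using N sub by (simp_all add: submodule_set_add submodule_Int set_add_upper)
    show "(N i \<inter> C) <+>\<^bsub>M\<^esub> C' \<subseteq> D"
      using N sub CD by (intro set_add_least) auto
    show "(N (Suc i) \<inter> C) <+>\<^bsub>M\<^esub> C' \<subseteq> (N i \<inter> C) <+>\<^bsub>M\<^esub> C'"
      using N(4)[of i] unfolding mem_set_add subset_iff by blast
  qed
  then obtain n2 where n2: "\<And>m. m \<ge> n2 \<Longrightarrow> (N m \<inter> C) <+>\<^bsub>M\<^esub> C' = (N n2 \<inter> C) <+>\<^bsub>M\<^esub> C'" by blast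
  define n where "n = max n1 n2"
  have "N m = N n" if "m \<ge> n" for m
  proof
    show "N m \<subseteq> N n" using N(4) that by (rule lift_Suc_antimono_le)
    show "N n \<subseteq> N m"
    proof
      fix x assume x: "x \<in> N n"
      note nD = submoduleD[OF N(1)[of n]] and mD = submoduleD[OF N(1)[of m]]
      have "x \<in> N n <+>\<^bsub>M\<^esub> C" using x set_add_upper[OF N(1) sub(1)] by blast
      then have "x \<in> N m <+>\<^bsub>M\<^esub> C" using n1[of n] n1[of m] that by (auto simp: n_def)
      then obtain y c where y: "y \<in> N m" "c \<in> C" "x = y \<oplus>\<^bsub>M\<^esub> c" by (auto simp: mem_set_add)
      have c: "c = x \<ominus>\<^bsub>M\<^esub> y"
        using eq_add_iff_diff_eq[of x y c] y x nD mD submoduleD(2)[OF sub(1)] by simp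
      have "c \<in> N n"
        unfolding c using x y(1) \<open>N m \<subseteq> N n\<close> nD(7) by blast
      then have "c \<in> (N n \<inter> C) <+>\<^bsub>M\<^esub> C'"
        using set_add_upper[OF submodule_Int[OF N(1) sub(1)] sub(2)] y(2) by blast
      then have "c \<in> (N m \<inter> C) <+>\<^bsub>M\<^esub> C'"
        using n2[of n] n2[of m] that by (auto simp: n_def)
      then obtain u v where uv: "u \<in> N m" "u \<in> C" "v \<in> C'" "c = u \<oplus>\<^bsub>M\<^esub> v" by (auto simp: mem_set_add)
      have v: "v = c \<ominus>\<^bsub>M\<^esub> u"
        using eq_add_iff_diff_eq[of c u v] uv y(2) submoduleD(2)[OF sub(1)] submoduleD(2)[OF sub(2)] by simp
      have "v \<in> C" unfolding v using uv y(2) submoduleD(7)[OF sub(1)] by blast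
      then have "v \<in> N m" using uv(3) N(2) by blast
      then have "c \<in> N m" using uv mD(4) by blast
      then show "x \<in> N m" using y mD(4) by blast
    qed
  qed
  then show "\<exists>n. \<forall>m\<ge>n. N m = N n" by blast
qed

end


section \<open>Restriction of scalars to the centre\<close>

definition center :: "('r, 'd) ring_scheme \<Rightarrow> 'r set"
  where "center R = {z \<in> carrier R. \<forall>r\<in>carrier R. r \<otimes>\<^bsub>R\<^esub> z = z \<otimes>\<^bsub>R\<^esub> r}"

text \<open>
  Shrinking only the carrier keeps all operations, so that a module over \<open>R\<close> is at once a module
  over the centre and lemmas about left modules serve both kinds of submodules.
\<close>

abbreviation center_ring :: "('r, 'd) ring_scheme \<Rightarrow> ('r, 'd) ring_scheme"
  where "center_ring R \<equiv> R\<lparr>carrier := center R\<rparr>"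

definition regular_module :: "('r, 'd) ring_scheme \<Rightarrow> ('r, 'r) module"
  where "regular_module R = \<lparr>carrier = carrier R, monoid.mult = monoid.mult R, one = one R,
    ring.zero = ring.zero R, add = add R, module.smult = monoid.mult R\<rparr>"

definition noetherian_over_center :: "('r, 'd) ring_scheme \<Rightarrow> bool"
  where "noetherian_over_center R \<longleftrightarrow> ring R \<and>
    (\<forall>N :: nat \<Rightarrow> 'r set.
      (\<forall>i. submodule (N i) (center_ring R) (regular_module R)) \<and> (\<forall>i. N i \<subseteq> N (Suc i)) \<longrightarrow>
      (\<exists>n. \<forall>m\<ge>n. N m = N n))"

lemma centerD:
  assumes "z \<in> center R"
  shows "z \<in> carrier R" "r \<in> carrier R \<Longrightarrow> r \<otimes>\<^bsub>R\<^esub> z = z \<otimes>\<^bsub>R\<^esub> r"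
  using assms by (auto simp: center_def)

context ring
begin

lemma subring_center: "subring (center R) R"
proof (rule subringI)
  show "center R \<subseteq> carrier R" by (auto simp: center_def)
  show "\<one> \<in> center R" by (auto simp: center_def)
  show "\<ominus> h \<in> center R" if "h \<in> center R" for h
    using that by (auto simp: center_def l_minus r_minus)
  fix h k assume "h \<in> center R" "k \<in> center R"
  note hk = centerD[OF \<open>h \<in> center R\<close>] centerD[OF \<open>k \<in> center R\<close>]
  show "h \<oplus> k \<in> center R"
    unfolding center_def
  proof (intro CollectI conjI ballI)
    show "h \<oplus> k \<in> carrier R" using hk(1,3) by simp
    fix r assume r: "r \<in> carrier R"
    show "r \<otimes> (h \<oplus> k) = (h \<oplus> k) \<otimes> r"
      using r hk(1,3) hk(2)[OF r] hk(4)[OF r] by (simp add: l_distr r_distr)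
  qed
  show "h \<otimes> k \<in> center R"
    unfolding center_def
  proof (intro CollectI conjI ballI)
    show "h \<otimes> k \<in> carrier R" using hk(1,3) by simp
    fix r assume r: "r \<in> carrier R"
    have "r \<otimes> (h \<otimes> k) = (r \<otimes> h) \<otimes> k" using r hk(1,3) by (simp add: m_assoc)
    also have "\<dots> = h \<otimes> (r \<otimes> k)" using r hk(1,3) hk(2)[OF r] by (simp add: m_assoc)
    also have "\<dots> = h \<otimes> k \<otimes> r" using r hk(1,3) hk(4)[OF r] by (simp add: m_assoc)
    finally show "r \<otimes> (h \<otimes> k) = h \<otimes> k \<otimes> r" .
  qed
qed

lemma center_pow: "z \<in> center R \<Longrightarrow> z [^] (n :: nat) \<in> center R"
proof (induction n)
  case (Suc n)
  then show ?case using subringE(6)[OF subring_center] by simp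
qed (use subringE(3)[OF subring_center] in simp)

lemma left_module_regular: "left_module R (regular_module R)"
proof (intro left_module.intro left_module_axioms.intro)
  show "ring R" ..
  show "abelian_group (regular_module R)"
    by (rule abelian_groupI) (auto simp: regular_module_def a_ac intro: add.l_inv_ex)
qed (auto simp: regular_module_def l_distr r_distr m_assoc)

end

context left_module
begin

lemma left_module_restrict_scalars:
  assumes "subring K R"
  shows "left_module (R\<lparr>carrier := K\<rparr>) M"
proof (intro left_module.intro left_module_axioms.intro)
  show "ring (R\<lparr>carrier := K\<rparr>)" using assms by (rule R.subring_is_ring)
  show "abelian_group M" ..
qed (use subringE(1)[OF assms, THEN subsetD] in \<open>auto simp: smult_l_distr smult_r_distr smult_assoc\<close>)

lemma left_module_center: "left_module (center_ring R) M"
  by (rule left_module_restrict_scalars[OF R.subring_center])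

lemma smult_center_commute:
  assumes "z \<in> center R" "r \<in> carrier R" "x \<in> carrier M"
  shows "z \<odot>\<^bsub>M\<^esub> (r \<odot>\<^bsub>M\<^esub> x) = r \<odot>\<^bsub>M\<^esub> (z \<odot>\<^bsub>M\<^esub> x)"
  using assms centerD[OF assms(1)] by (simp add: smult_assoc[symmetric])

lemma smult_pow_mult:
  assumes "a \<in> carrier R" "x \<in> carrier M"
  shows "(a [^]\<^bsub>R\<^esub> (n :: nat) \<otimes>\<^bsub>R\<^esub> a) \<odot>\<^bsub>M\<^esub> x = a \<odot>\<^bsub>M\<^esub> ((a [^]\<^bsub>R\<^esub> n) \<odot>\<^bsub>M\<^esub> x)"
  using assms R.nat_pow_Suc2[of a n] by (simp add: smult_assoc[symmetric])

lemma smult_pow_Suc: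
  assumes "a \<in> carrier R" "x \<in> carrier M"
  shows "(a [^]\<^bsub>R\<^esub> Suc n) \<odot>\<^bsub>M\<^esub> x = a \<odot>\<^bsub>M\<^esub> ((a [^]\<^bsub>R\<^esub> n) \<odot>\<^bsub>M\<^esub> x)"
    "(a [^]\<^bsub>R\<^esub> Suc n) \<odot>\<^bsub>M\<^esub> x = (a [^]\<^bsub>R\<^esub> n) \<odot>\<^bsub>M\<^esub> (a \<odot>\<^bsub>M\<^esub> x)"
  using assms smult_pow_mult[of a x n] by (simp_all add: smult_assoc)

lemma submodule_center:
  assumes "submodule N R M"
  shows "submodule N (center_ring R) M"
proof -
  interpret Z: left_module "center_ring R" M by (rule left_module_center)
  show ?thesis
    by (rule Z.submoduleI) (use submoduleD[OF assms] centerD(1)[of _ R] in auto)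
qed

lemma submodule_add_cancel:
  assumes "submodule N R M" "x \<oplus>\<^bsub>M\<^esub> y \<in> N" "y \<in> N" "x \<in> carrier M"
  shows "x \<in> N"
proof -
  have "x = (x \<oplus>\<^bsub>M\<^esub> y) \<ominus>\<^bsub>M\<^esub> y"
    using assms(4) submoduleD(2)[OF assms(1,3)] by (simp add: a_minus_def M.a_assoc M.r_neg)
  then show ?thesis using submoduleD(7)[OF assms(1-3)] by simp
qed

text \<open>
  There are two uses: central \<open>a\<close> with \<open>K\<close> the whole ring, and arbitrary \<open>a\<close> with \<open>K\<close> the centre.
\<close>

lemma submodule_image_of_commuting:
  assumes a: "a \<in> carrier R" and K: "subring K R" "\<And>k. k \<in> K \<Longrightarrow> k \<otimes>\<^bsub>R\<^esub> a = a \<otimes>\<^bsub>R\<^esub> k"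
    and N: "submodule N (R\<lparr>carrier := K\<rparr>) M"
  shows "submodule ((\<lambda>x. a \<odot>\<^bsub>M\<^esub> x) ` N) (R\<lparr>carrier := K\<rparr>) M"
proof -
  interpret K: left_module "R\<lparr>carrier := K\<rparr>" M by (rule left_module_restrict_scalars[OF K(1)])
  note ND = submoduleD[OF N, simplified]
  show ?thesis
  proof (rule K.submoduleI)
    show "(\<lambda>x. a \<odot>\<^bsub>M\<^esub> x) ` N \<subseteq> carrier M" using ND(2) a by auto
    show "\<zero>\<^bsub>M\<^esub> \<in> (\<lambda>x. a \<odot>\<^bsub>M\<^esub> x) ` N"
      using ND(3) a by (intro image_eqI[of _ _ "\<zero>\<^bsub>M\<^esub>"]) auto
    show "x \<oplus>\<^bsub>M\<^esub> y \<in> (\<lambda>x. a \<odot>\<^bsub>M\<^esub> x) ` N"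
      if xy: "x \<in> (\<lambda>x. a \<odot>\<^bsub>M\<^esub> x) ` N" "y \<in> (\<lambda>x. a \<odot>\<^bsub>M\<^esub> x) ` N" for x y
    proof -
      obtain u v where "u \<in> N" "v \<in> N" "x = a \<odot>\<^bsub>M\<^esub> u" "y = a \<odot>\<^bsub>M\<^esub> v" using xy by auto
      then show ?thesis
        using ND(2,4) a by (intro image_eqI[of _ _ "u \<oplus>\<^bsub>M\<^esub> v"]) (auto simp: smult_r_distr)
    qed
    show "k \<odot>\<^bsub>M\<^esub> x \<in> (\<lambda>x. a \<odot>\<^bsub>M\<^esub> x) ` N"
      if kx: "k \<in> carrier (R\<lparr>carrier := K\<rparr>)" "x \<in> (\<lambda>x. a \<odot>\<^bsub>M\<^esub> x) ` N" for k x
    proof -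
      have k: "k \<in> K" "k \<in> carrier R" using kx(1) subringE(1)[OF K(1)] by auto
      obtain u where "u \<in> N" "x = a \<odot>\<^bsub>M\<^esub> u" using kx by auto
      then show ?thesis
        using ND(2) ND(5)[OF k(1)] K(2)[OF k(1)] k a
        by (intro image_eqI[of _ _ "k \<odot>\<^bsub>M\<^esub> u"]) (auto simp: smult_assoc[symmetric])
    qed
  qed
qed

lemma submodule_central_image:
  assumes "a \<in> center R" "submodule N R M"
  shows "submodule ((\<lambda>x. a \<odot>\<^bsub>M\<^esub> x) ` N) R M"
  using submodule_image_of_commuting[of a "carrier R" N] assms centerD[OF assms(1)] R.carrier_is_subring
  by simp

lemma submodule_vimages:
  assumes A: "A \<subseteq> carrier R" and K: "subring K R" "\<And>k a. k \<in> K \<Longrightarrow> a \<in> A \<Longrightarrow> k \<otimes>\<^bsub>R\<^esub> a = a \<otimes>\<^bsub>R\<^esub> k"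
    and N: "submodule N (R\<lparr>carrier := K\<rparr>) M" and D: "submodule D (R\<lparr>carrier := K\<rparr>) M"
  shows "submodule {x \<in> D. \<forall>a\<in>A. a \<odot>\<^bsub>M\<^esub> x \<in> N} (R\<lparr>carrier := K\<rparr>) M"
proof -
  interpret K: left_module "R\<lparr>carrier := K\<rparr>" M by (rule left_module_restrict_scalars[OF K(1)])
  note ND = submoduleD[OF N, simplified] and DD = submoduleD[OF D, simplified]
  have aR: "a \<in> carrier R" if "a \<in> A" for a using A that by blast
  show ?thesis
  proof (rule K.submoduleI)
    fix k x assume "k \<in> carrier (R\<lparr>carrier := K\<rparr>)" and x: "x \<in> {x \<in> D. \<forall>a\<in>A. a \<odot>\<^bsub>M\<^esub> x \<in> N}"
    then have k: "k \<in> K" "k \<in> carrier R" using subringE(1)[OF K(1)] by auto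
    have "a \<odot>\<^bsub>M\<^esub> (k \<odot>\<^bsub>M\<^esub> x) = k \<odot>\<^bsub>M\<^esub> (a \<odot>\<^bsub>M\<^esub> x)" if "a \<in> A" for a
      using K(2)[OF k(1) that] k(2) x DD(2) aR[OF that] by (simp add: smult_assoc[symmetric])
    then show "k \<odot>\<^bsub>M\<^esub> x \<in> {x \<in> D. \<forall>a\<in>A. a \<odot>\<^bsub>M\<^esub> x \<in> N}"
      using x ND(5)[OF k(1)] DD(5)[OF k(1)] by simp
  qed (use DD(1-4) ND(3,4) aR in \<open>auto simp: smult_r_distr\<close>)
qed

lemma submodule_central_vimages:
  assumes "A \<subseteq> center R" "submodule N R M" "submodule D R M"
  shows "submodule {x \<in> D. \<forall>a\<in>A. a \<odot>\<^bsub>M\<^esub> x \<in> N} R M"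
proof -
  have A: "a \<in> carrier R" "r \<in> carrier R \<Longrightarrow> r \<otimes>\<^bsub>R\<^esub> a = a \<otimes>\<^bsub>R\<^esub> r" if "a \<in> A" for a r
    using centerD[of a R] assms(1) that by auto
  then show ?thesis
    using submodule_vimages[of A "carrier R" N D] assms(2,3) R.carrier_is_subring by auto
qed

end

lemma noetherian_over_centerD:
  assumes "noetherian_over_center R"
    and "\<And>i. N i \<subseteq> carrier R" "\<And>i. \<zero>\<^bsub>R\<^esub> \<in> N i"
    and "\<And>i x y. x \<in> N i \<Longrightarrow> y \<in> N i \<Longrightarrow> x \<oplus>\<^bsub>R\<^esub> y \<in> N i"
    and "\<And>i z x. z \<in> center R \<Longrightarrow> x \<in> N i \<Longrightarrow> z \<otimes>\<^bsub>R\<^esub> x \<in> N i"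
    and "\<And>i. N i \<subseteq> N (Suc i)"
  shows "\<exists>n. \<forall>m\<ge>n. N m = N n"
proof -
  interpret R: ring R using assms(1) by (simp add: noetherian_over_center_def)
  interpret L: left_module R "regular_module R" by (rule R.left_module_regular)
  interpret Z: left_module "center_ring R" "regular_module R" by (rule L.left_module_center)
  have "submodule (N i) (center_ring R) (regular_module R)" for i
    by (rule Z.submoduleI) (use assms(2-5) in \<open>auto simp: regular_module_def\<close>)
  then show ?thesis
    using assms(1,6) unfolding noetherian_over_center_def by blast
qed

context left_module
begin

text \<open>
  A compactness property: finitely many of the conditions \<open>y e \<in> Q\<close> imply all others. The elements
  of \<open>R\<close> that take into \<open>Q\<close> everything that passes the test \<open>F\<close> form a submodule over the centre; it
  grows with \<open>F\<close>, so it cannot grow forever.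
\<close>

lemma finite_test:
  assumes noeth: "noetherian_over_center R" and Q: "submodule Q (center_ring R) M"
    and D: "D \<subseteq> carrier M" and Y: "Y \<subseteq> carrier R"
  shows "\<exists>F\<subseteq>Y. finite F \<and> (\<forall>e\<in>D. (\<forall>x\<in>F. x \<odot>\<^bsub>M\<^esub> e \<in> Q) \<longrightarrow> (\<forall>y\<in>Y. y \<odot>\<^bsub>M\<^esub> e \<in> Q))"
proof (rule ccontr)
  assume no: "\<not> ?thesis"
  note QD = submoduleD[OF Q, simplified]
  define J where "J F = {r \<in> carrier R. \<forall>e\<in>D. (\<forall>x\<in>F. x \<odot>\<^bsub>M\<^esub> e \<in> Q) \<longrightarrow> r \<odot>\<^bsub>M\<^esub> e \<in> Q}" for F
  have step: "\<exists>F'. (finite F' \<and> F' \<subseteq> Y) \<and> (F \<subseteq> F' \<and> J F' \<noteq> J F)" if F: "finite F \<and> F \<subseteq> Y" for F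
  proof -
    obtain e y where "e \<in> D" "\<forall>x\<in>F. x \<odot>\<^bsub>M\<^esub> e \<in> Q" "y \<in> Y" "y \<odot>\<^bsub>M\<^esub> e \<notin> Q"
      using no F by blast
    then have "y \<in> J (insert y F)" "y \<notin> J F" using Y by (auto simp: J_def)
    then show ?thesis using F \<open>y \<in> Y\<close> by (intro exI[of _ "insert y F"]) auto
  qed
  obtain W where W: "\<And>n. finite (W n) \<and> W n \<subseteq> Y" "\<And>n. W n \<subseteq> W (Suc n) \<and> J (W (Suc n)) \<noteq> J (W n)"
    using dependent_nat_choice[of "\<lambda>_ F. finite F \<and> F \<subseteq> Y" "\<lambda>_ F F'. F \<subseteq> F' \<and> J F' \<noteq> J F"] step
    by (metis empty_subsetI finite.emptyI)
  have "\<exists>n. \<forall>m\<ge>n. J (W m) = J (W n)"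
  proof (rule noetherian_over_centerD[OF noeth])
    fix i z x assume z: "z \<in> center R" and x: "x \<in> J (W i)"
    have "(z \<otimes>\<^bsub>R\<^esub> x) \<odot>\<^bsub>M\<^esub> e \<in> Q" if "e \<in> D" "\<forall>x\<in>W i. x \<odot>\<^bsub>M\<^esub> e \<in> Q" for e
    proof -
      have "x \<in> carrier R" "x \<odot>\<^bsub>M\<^esub> e \<in> Q" using x that by (auto simp: J_def)
      then show ?thesis
        using QD(5)[OF z] centerD(1)[OF z] D that(1) by (auto simp: smult_assoc)
    qed
    then show "z \<otimes>\<^bsub>R\<^esub> x \<in> J (W i)"
      using x centerD(1)[OF z] by (auto simp: J_def)
  next
    show "J (W i) \<subseteq> J (W (Suc i))" for i using conjunct1[OF W(2)[of i]] by (auto simp: J_def)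
  qed (use D QD(3,4) in \<open>auto simp: J_def smult_l_distr subset_iff\<close>)
  with W(2) show False by (meson le_SucI order_refl)
qed

text \<open>
  The dual of Hilbert's basis theorem. In \<open>D / C\<close> a submodule \<open>N\<close> is replaced by the submodules
  \<open>ker z \<inter> z\<^sup>i N\<close> of \<open>ker z\<close>, which take the place of the ideals of leading coefficients: they decrease
  in \<open>N\<close> and in \<open>i\<close>, and they determine \<open>N\<close> among comparable submodules because every element is killed by a
  power of \<open>z\<close>.
\<close>

lemma dcc_between_locally_nilpotent:
  assumes C: "submodule C R M" and D: "submodule D R M" and CD: "C \<subseteq> D" and z: "z \<in> center R"
    and nil: "\<And>e. e \<in> D \<Longrightarrow> \<exists>n :: nat. (z [^]\<^bsub>R\<^esub> n) \<odot>\<^bsub>M\<^esub> e \<in> C"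
    and dcc: "dcc_between R M C {e \<in> D. z \<odot>\<^bsub>M\<^esub> e \<in> C}"
  shows "dcc_between R M C D"
  unfolding dcc_between_def
proof (intro allI impI)
  fix N :: "nat \<Rightarrow> 'm set"
  assume "(\<forall>i. submodule (N i) R M \<and> C \<subseteq> N i \<and> N i \<subseteq> D) \<and> (\<forall>i. N (Suc i) \<subseteq> N i)"
  then have N: "\<And>i. submodule (N i) R M" "\<And>i. C \<subseteq> N i" "\<And>i. N i \<subseteq> D" "\<And>i. N (Suc i) \<subseteq> N i"
    by auto
  note CDs = submoduleD[OF C] and DD = submoduleD[OF D]
  have zR: "z \<in> carrier R" and zi: "z [^]\<^bsub>R\<^esub> i \<in> center R" "z [^]\<^bsub>R\<^esub> i \<in> carrier R" for i :: nat
    using centerD(1)[OF z] R.center_pow[OF z] by auto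
  define K where "K = {e \<in> D. z \<odot>\<^bsub>M\<^esub> e \<in> C}"
  have K: "submodule K R M"
    using submodule_central_vimages[of "{z}" C D] z C D by (simp add: K_def)
  define T where "T j i = K \<inter> ((\<lambda>y. (z [^]\<^bsub>R\<^esub> i) \<odot>\<^bsub>M\<^esub> y) ` N j <+>\<^bsub>M\<^esub> C)" for j i :: nat
  have CK: "C \<subseteq> K" using CD CDs(5)[OF zR] by (auto simp: K_def)
  have im: "submodule ((\<lambda>y. (z [^]\<^bsub>R\<^esub> i) \<odot>\<^bsub>M\<^esub> y) ` N j) R M" for i j :: nat
    by (rule submodule_central_image[OF zi(1) N(1)])
  have T: "submodule (T j i) R M \<and> C \<subseteq> T j i \<and> T j i \<subseteq> K" for j i
    unfolding T_def using K C CK im set_add_upper(2)[OF im C]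
    by (auto intro!: submodule_Int submodule_set_add)
  have "\<exists>s. \<forall>j\<ge>s. \<forall>i. T j i = T s i"
  proof (rule double_chain_stabilises[OF subset_order, where P = "\<lambda>N. submodule N R M \<and> C \<subseteq> N \<and> N \<subseteq> K"])
    show "submodule (T j i) R M \<and> C \<subseteq> T j i \<and> T j i \<subseteq> K" for j i by (rule T)
    show "T (Suc j) i \<subseteq> T j i" for j i
      using N(4)[of j] by (auto simp: T_def mem_set_add) blast
    show "T j (Suc i) \<subseteq> T j i" for j i
    proof
      fix x assume x: "x \<in> T j (Suc i)"
      then obtain y c where yc: "y \<in> N j" "c \<in> C" "x = (z [^]\<^bsub>R\<^esub> Suc i) \<odot>\<^bsub>M\<^esub> y \<oplus>\<^bsub>M\<^esub> c"
        by (auto simp: T_def mem_set_add)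
      have "(z [^]\<^bsub>R\<^esub> Suc i) \<odot>\<^bsub>M\<^esub> y = (z [^]\<^bsub>R\<^esub> i) \<odot>\<^bsub>M\<^esub> (z \<odot>\<^bsub>M\<^esub> y)"
        using smult_pow_Suc(2) zR submoduleD(2)[OF N(1) yc(1)] by blast
      moreover have "z \<odot>\<^bsub>M\<^esub> y \<in> N j" using submoduleD(5)[OF N(1) zR yc(1)] .
      ultimately show "x \<in> T j i"
        using x yc by (auto simp: T_def mem_set_add)
    qed
    show "\<exists>n. \<forall>m\<ge>n. Y m = Y n"
      if "\<And>i. submodule (Y i) R M \<and> C \<subseteq> Y i \<and> Y i \<subseteq> K" "\<And>i. Y (Suc i) \<subseteq> Y i" for Y :: "nat \<Rightarrow> 'm set"
      using dcc that unfolding dcc_between_def K_def by blast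
  qed
  then obtain s where s: "\<And>j i. j \<ge> s \<Longrightarrow> T j i = T s i" by blast
  have "N j = N s" if "j \<ge> s" for j
  proof
    show sub: "N j \<subseteq> N s" using N(4) that by (rule lift_Suc_antimono_le)
    note sD = submoduleD[OF N(1)[of s]] and jD = submoduleD[OF N(1)[of j]]
    have "y \<in> N j" if "y \<in> N s" "(z [^]\<^bsub>R\<^esub> n) \<odot>\<^bsub>M\<^esub> y \<in> C" for y and n :: nat
      using that
    proof (induction n arbitrary: y)
      case 0
      then show ?case using sD(2) N(2)[of j] by auto
    next
      case (Suc n)
      define x where "x = (z [^]\<^bsub>R\<^esub> n) \<odot>\<^bsub>M\<^esub> y"
      have y: "y \<in> carrier M" using Suc.prems(1) sD(2) by blast
      have x: "x \<in> N s" "x \<in> carrier M" "z \<odot>\<^bsub>M\<^esub> x \<in> C"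
        using Suc.prems sD(5)[OF zi(2)] y zi(2) zR smult_pow_Suc(1)[OF zR y, of n] by (auto simp: x_def)
      have "x \<in> (\<lambda>y. (z [^]\<^bsub>R\<^esub> n) \<odot>\<^bsub>M\<^esub> y) ` N s" using Suc.prems(1) by (simp add: x_def)
      then have "x \<in> (\<lambda>y. (z [^]\<^bsub>R\<^esub> n) \<odot>\<^bsub>M\<^esub> y) ` N s <+>\<^bsub>M\<^esub> C"
        using set_add_upper(1)[OF im C] by (rule subsetD[rotated])
      then have "x \<in> T s n"
        unfolding T_def using x(1,3) N(3) by (auto simp: K_def)
      then have "x \<in> T j n" using s[OF \<open>j \<ge> s\<close>] by blast
      then obtain y' c where y': "y' \<in> N j" and c: "c \<in> C" "x = (z [^]\<^bsub>R\<^esub> n) \<odot>\<^bsub>M\<^esub> y' \<oplus>\<^bsub>M\<^esub> c"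
        by (auto simp: T_def mem_set_add)
      have y'M: "y' \<in> carrier M" using jD(2) y' .
      have "(z [^]\<^bsub>R\<^esub> n) \<odot>\<^bsub>M\<^esub> (y \<ominus>\<^bsub>M\<^esub> y') = x \<ominus>\<^bsub>M\<^esub> (z [^]\<^bsub>R\<^esub> n) \<odot>\<^bsub>M\<^esub> y'"
        using y y'M zi(2) by (simp add: smult_r_minus x_def)
      also have "\<dots> = c"
        using eq_add_iff_diff_eq[of x "(z [^]\<^bsub>R\<^esub> n) \<odot>\<^bsub>M\<^esub> y'" c] c y'M x(2) zi(2) CDs(2) by simp
      finally have "(z [^]\<^bsub>R\<^esub> n) \<odot>\<^bsub>M\<^esub> (y \<ominus>\<^bsub>M\<^esub> y') \<in> C" using c(1) by simp
      moreover have "y \<ominus>\<^bsub>M\<^esub> y' \<in> N s" using Suc.prems(1) y' sub sD(7) by blast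
      ultimately have "y \<ominus>\<^bsub>M\<^esub> y' \<in> N j" by (intro Suc.IH)
      moreover have "y = y' \<oplus>\<^bsub>M\<^esub> (y \<ominus>\<^bsub>M\<^esub> y')"
        using eq_add_iff_diff_eq[of y y'] y y'M by simp
      ultimately show ?case using y' jD(4) by metis
    qed
    then show "N s \<subseteq> N j" using nil N(3) by blast
  qed
  then show "\<exists>n. \<forall>m\<ge>n. N m = N n" by blast
qed

lemma dcc_between_torsion:
  assumes "finite F" "F \<subseteq> center R" and C: "submodule C R M"
    and nil: "\<And>a e. a \<in> F \<Longrightarrow> e \<in> carrier M \<Longrightarrow> \<exists>n :: nat. (a [^]\<^bsub>R\<^esub> n) \<odot>\<^bsub>M\<^esub> e \<in> C"
    and dcc: "dcc_between R M C {e \<in> carrier M. \<forall>a\<in>F. a \<odot>\<^bsub>M\<^esub> e \<in> C}"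
  shows "dcc_between R M C (carrier M)"
  using assms(1,2) nil dcc
proof (induction F rule: finite_induct)
  case empty
  then show ?case by simp
next
  case (insert a F)
  define D where "D = {e \<in> carrier M. \<forall>a\<in>F. a \<odot>\<^bsub>M\<^esub> e \<in> C}"
  have "submodule D R M"
    unfolding D_def using insert.prems by (intro submodule_central_vimages C submodule_carrier) auto
  moreover have "C \<subseteq> D"
    using insert.prems(1) submoduleD(2,5)[OF C] centerD(1)[of _ R] by (auto simp: D_def)
  moreover have "{e \<in> carrier M. \<forall>a\<in>insert a F. a \<odot>\<^bsub>M\<^esub> e \<in> C} = {e \<in> D. a \<odot>\<^bsub>M\<^esub> e \<in> C}"
    by (auto simp: D_def)
  ultimately have "dcc_between R M C D"
    using insert.prems C by (intro dcc_between_locally_nilpotent[of C D a]) (auto simp: D_def)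
  then show ?case
    using insert.prems insert.IH by (simp add: D_def)
qed

lemma dcc_between_center:
  assumes "dcc_between (center_ring R) M C D"
  shows "dcc_between R M C D"
  using assms submodule_center unfolding dcc_between_def by meson

lemma dcc_between_no_intermediate:
  assumes "\<And>N. submodule N R M \<Longrightarrow> C \<subseteq> N \<Longrightarrow> N \<subseteq> D \<Longrightarrow> N = C \<or> N = D"
  shows "dcc_between R M C D"
  unfolding dcc_between_def
proof (intro allI impI)
  fix N :: "nat \<Rightarrow> 'm set"
  assume "(\<forall>i. submodule (N i) R M \<and> C \<subseteq> N i \<and> N i \<subseteq> D) \<and> (\<forall>i. N (Suc i) \<subseteq> N i)"
  then have N: "\<And>i. submodule (N i) R M" "\<And>i. C \<subseteq> N i" "\<And>i. N i \<subseteq> D" "\<And>i. N (Suc i) \<subseteq> N i"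
    by auto
  show "\<exists>n. \<forall>m\<ge>n. N m = N n"
  proof (cases "\<exists>n. N n = C")
    case True
    then obtain n where "N n = C" by blast
    moreover have "N m \<subseteq> N n" if "m \<ge> n" for m using N(4) that by (rule lift_Suc_antimono_le)
    ultimately show ?thesis using N(2) by blast
  next
    case False
    then have "N n = D" for n using assms[OF N(1-3)] by blast
    then show ?thesis by simp
  qed
qed

end


section \<open>Modules with a least nonzero submodule\<close>

text \<open>
  In \<open>M / C\<close> the class of \<open>s\<close> lies in every nonzero submodule. The statements below are about this
  quotient, but they are phrased with submodules of \<open>M\<close> above \<open>C\<close>.
\<close>

locale maximal_avoiding = left_module R M
  for R :: "('r, 'd) ring_scheme" (structure) and M :: "('r, 'm, 'c) module_scheme" (structure) +
  fixes C :: "'m set" and s :: 'm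
  assumes noetherian: "noetherian_over_center R"
    and C_submodule: "submodule C R M"
    and s_mem: "s \<in> carrier M"
    and s_notin: "s \<notin> C"
    and maximal: "submodule N R M \<Longrightarrow> C \<subseteq> N \<Longrightarrow> s \<notin> N \<Longrightarrow> N = C"
begin

lemmas CD = submoduleD[OF C_submodule]

text \<open>
  Fitting's argument. For large \<open>n\<close> the kernels of \<open>a\<^sup>n\<close> and of \<open>a\<^sup>n\<^sup>+\<^sup>1\<close> agree on the cyclic submodule
  \<open>R e\<close> of \<open>M / C\<close>, so \<open>a\<close> is injective on \<open>a\<^sup>n R e\<close>. This submodule must vanish, for otherwise it would
  contain \<open>s\<close>, which \<open>a\<close> kills.
\<close>

lemma central_torsion:
  assumes a: "a \<in> center R" and as: "a \<odot>\<^bsub>M\<^esub> s \<in> C" and e: "e \<in> carrier M"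
  shows "\<exists>n :: nat. (a [^]\<^bsub>R\<^esub> n) \<odot>\<^bsub>M\<^esub> e \<in> C"
proof -
  have aR: "a \<in> carrier R" and ai: "a [^]\<^bsub>R\<^esub> i \<in> center R" "a [^]\<^bsub>R\<^esub> i \<in> carrier R" for i :: nat
    using centerD(1)[OF a] R.center_pow[OF a] by auto
  define L where "L n = {r \<in> carrier R. (a [^]\<^bsub>R\<^esub> n) \<odot>\<^bsub>M\<^esub> (r \<odot>\<^bsub>M\<^esub> e) \<in> C}" for n :: nat
  have "\<exists>n. \<forall>m\<ge>n. L m = L n"
  proof (rule noetherian_over_centerD[OF noetherian])
    fix i z r assume z: "z \<in> center R" and r: "r \<in> L i"
    have "(a [^]\<^bsub>R\<^esub> i) \<odot>\<^bsub>M\<^esub> ((z \<otimes>\<^bsub>R\<^esub> r) \<odot>\<^bsub>M\<^esub> e) = z \<odot>\<^bsub>M\<^esub> ((a [^]\<^bsub>R\<^esub> i) \<odot>\<^bsub>M\<^esub> (r \<odot>\<^bsub>M\<^esub> e))"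
      using r e z centerD(1)[OF z] ai by (simp add: L_def smult_assoc smult_center_commute)
    then show "z \<otimes>\<^bsub>R\<^esub> r \<in> L i"
      using r CD(5) centerD(1)[OF z] by (simp add: L_def)
  next
    show "L i \<subseteq> L (Suc i)" for i
      using e CD(5)[OF aR] aR by (auto simp: L_def smult_pow_mult)
  qed (use e ai(2) CD(3,4) in \<open>auto simp: L_def smult_l_distr smult_r_distr\<close>)
  then obtain n where n: "L (Suc n) = L n" by (meson le_SucI order_refl)
  define N where "N = (\<lambda>y. (a [^]\<^bsub>R\<^esub> n) \<odot>\<^bsub>M\<^esub> y) ` ((\<lambda>r. r \<odot>\<^bsub>M\<^esub> e) ` carrier R)"
  have N: "submodule N R M"
    unfolding N_def by (intro submodule_central_image submodule_orbit ai e)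
  have "s \<notin> N <+>\<^bsub>M\<^esub> C"
  proof
    assume "s \<in> N <+>\<^bsub>M\<^esub> C"
    then obtain r c where r: "r \<in> carrier R" and c: "c \<in> C"
      and s: "s = (a [^]\<^bsub>R\<^esub> n) \<odot>\<^bsub>M\<^esub> (r \<odot>\<^bsub>M\<^esub> e) \<oplus>\<^bsub>M\<^esub> c"
      by (auto simp: N_def mem_set_add)
    have cl: "(a [^]\<^bsub>R\<^esub> n) \<odot>\<^bsub>M\<^esub> (r \<odot>\<^bsub>M\<^esub> e) \<in> carrier M" using ai(2) r e by simp
    have "a \<odot>\<^bsub>M\<^esub> ((a [^]\<^bsub>R\<^esub> n) \<odot>\<^bsub>M\<^esub> (r \<odot>\<^bsub>M\<^esub> e)) \<oplus>\<^bsub>M\<^esub> a \<odot>\<^bsub>M\<^esub> c \<in> C"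
      using as cl CD(2)[OF c] aR unfolding s by (simp add: smult_r_distr)
    then have "a \<odot>\<^bsub>M\<^esub> ((a [^]\<^bsub>R\<^esub> n) \<odot>\<^bsub>M\<^esub> (r \<odot>\<^bsub>M\<^esub> e)) \<in> C"
      using submodule_add_cancel[OF C_submodule] CD(5)[OF aR c] aR cl by blast
    then have "r \<in> L (Suc n)"
      using r e aR by (simp add: L_def smult_pow_mult)
    then have "r \<in> L n" unfolding n .
    then have "(a [^]\<^bsub>R\<^esub> n) \<odot>\<^bsub>M\<^esub> (r \<odot>\<^bsub>M\<^esub> e) \<in> C" by (simp add: L_def)
    then have "s \<in> C" unfolding s using c CD(4) by blast
    then show False using s_notin by blast
  qed
  then have "N <+>\<^bsub>M\<^esub> C = C"
    using N C_submodule by (intro maximal submodule_set_add set_add_upper)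
  moreover have "(a [^]\<^bsub>R\<^esub> n) \<odot>\<^bsub>M\<^esub> (\<one>\<^bsub>R\<^esub> \<odot>\<^bsub>M\<^esub> e) \<in> N" unfolding N_def by blast
  ultimately have "(a [^]\<^bsub>R\<^esub> n) \<odot>\<^bsub>M\<^esub> e \<in> C"
    using set_add_upper(1)[OF N C_submodule] e by auto
  then show ?thesis by blast
qed

text \<open>
  This makes the central elements that kill \<open>s\<close> modulo \<open>C\<close> a maximal ideal of the centre. The
  nonzero submodule generated by \<open>a s\<close> contains \<open>s\<close>, so \<open>s = a r s\<close> modulo \<open>C\<close> for some \<open>r \<in> R\<close>. The
  chain condition on submodules of \<open>R\<close> over the centre works like an integral equation for \<open>r\<close> and replaces
  \<open>r\<close> by a central element.
\<close>

lemma central_inverse: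
  assumes a: "a \<in> center R" and as: "a \<odot>\<^bsub>M\<^esub> s \<notin> C"
  shows "\<exists>b\<in>center R. \<exists>c\<in>C. s = b \<odot>\<^bsub>M\<^esub> (a \<odot>\<^bsub>M\<^esub> s) \<oplus>\<^bsub>M\<^esub> c"
proof -
  interpret Z: left_module "center_ring R" M by (rule left_module_center)
  have aR: "a \<in> carrier R" and ai: "a [^]\<^bsub>R\<^esub> i \<in> center R" "a [^]\<^bsub>R\<^esub> i \<in> carrier R" for i :: nat
    using centerD(1)[OF a] R.center_pow[OF a] by auto
  define N where "N = (\<lambda>y. a \<odot>\<^bsub>M\<^esub> y) ` ((\<lambda>r. r \<odot>\<^bsub>M\<^esub> s) ` carrier R)"
  have N: "submodule N R M"
    unfolding N_def by (intro submodule_central_image submodule_orbit a s_mem)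
  have "a \<odot>\<^bsub>M\<^esub> (\<one>\<^bsub>R\<^esub> \<odot>\<^bsub>M\<^esub> s) \<in> N" unfolding N_def by blast
  then have "a \<odot>\<^bsub>M\<^esub> s \<in> N <+>\<^bsub>M\<^esub> C"
    using set_add_upper(1)[OF N C_submodule] s_mem by auto
  then have "s \<in> N <+>\<^bsub>M\<^esub> C"
    using as maximal[of "N <+>\<^bsub>M\<^esub> C"] N C_submodule submodule_set_add set_add_upper(2) by metis
  then obtain r c where r: "r \<in> carrier R" and c: "c \<in> C" and s: "s = a \<odot>\<^bsub>M\<^esub> (r \<odot>\<^bsub>M\<^esub> s) \<oplus>\<^bsub>M\<^esub> c"
    by (auto simp: N_def mem_set_add)
  note cM = CD(2)[OF c]
  have iterate: "\<exists>c'\<in>C. s = (a [^]\<^bsub>R\<^esub> n) \<odot>\<^bsub>M\<^esub> ((r [^]\<^bsub>R\<^esub> n) \<odot>\<^bsub>M\<^esub> s) \<oplus>\<^bsub>M\<^esub> c'" for n :: nat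
  proof (induction n)
    case 0
    show ?case using s_mem CD(3) by (intro bexI[of _ "\<zero>\<^bsub>M\<^esub>"]) auto
  next
    case (Suc n)
    then obtain c' where c': "c' \<in> C" and s': "s = (a [^]\<^bsub>R\<^esub> n) \<odot>\<^bsub>M\<^esub> ((r [^]\<^bsub>R\<^esub> n) \<odot>\<^bsub>M\<^esub> s) \<oplus>\<^bsub>M\<^esub> c'"
      by blast
    define t where "t = (r [^]\<^bsub>R\<^esub> n) \<odot>\<^bsub>M\<^esub> s"
    have t: "t \<in> carrier M" using r s_mem by (simp add: t_def)
    note c'M = CD(2)[OF c']
    have "r \<odot>\<^bsub>M\<^esub> s = r \<odot>\<^bsub>M\<^esub> ((a [^]\<^bsub>R\<^esub> n) \<odot>\<^bsub>M\<^esub> t \<oplus>\<^bsub>M\<^esub> c')"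
      using s' by (simp add: t_def)
    also have "\<dots> = (a [^]\<^bsub>R\<^esub> n) \<odot>\<^bsub>M\<^esub> (r \<odot>\<^bsub>M\<^esub> t) \<oplus>\<^bsub>M\<^esub> r \<odot>\<^bsub>M\<^esub> c'"
      using r t c'M ai by (simp add: smult_r_distr smult_center_commute)
    finally have "a \<odot>\<^bsub>M\<^esub> (r \<odot>\<^bsub>M\<^esub> s) =
        (a [^]\<^bsub>R\<^esub> Suc n) \<odot>\<^bsub>M\<^esub> (r \<odot>\<^bsub>M\<^esub> t) \<oplus>\<^bsub>M\<^esub> a \<odot>\<^bsub>M\<^esub> (r \<odot>\<^bsub>M\<^esub> c')"
      using r t c'M ai(2) aR by (simp add: smult_r_distr smult_pow_mult)
    moreover have "r \<odot>\<^bsub>M\<^esub> t = (r [^]\<^bsub>R\<^esub> Suc n) \<odot>\<^bsub>M\<^esub> s"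
      using r s_mem by (simp add: smult_pow_mult t_def)
    ultimately have "a \<odot>\<^bsub>M\<^esub> (r \<odot>\<^bsub>M\<^esub> s) \<oplus>\<^bsub>M\<^esub> c = (a [^]\<^bsub>R\<^esub> Suc n) \<odot>\<^bsub>M\<^esub> ((r [^]\<^bsub>R\<^esub> Suc n) \<odot>\<^bsub>M\<^esub> s) \<oplus>\<^bsub>M\<^esub>
        (a \<odot>\<^bsub>M\<^esub> (r \<odot>\<^bsub>M\<^esub> c') \<oplus>\<^bsub>M\<^esub> c)"
      using r aR s_mem cM c'M ai(2) by (simp add: M.a_assoc)
    then show ?case
      using s CD(4)[OF CD(5)[OF aR CD(5)[OF r c']] c] by metis
  qed
  define K where "K = (\<lambda>z. z \<odot>\<^bsub>M\<^esub> s) ` center R <+>\<^bsub>M\<^esub> C"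
  have orbit: "submodule ((\<lambda>z. z \<odot>\<^bsub>M\<^esub> s) ` center R) (center_ring R) M"
    using Z.submodule_orbit[OF s_mem] by simp
  have K: "submodule K (center_ring R) M"
    unfolding K_def by (intro Z.submodule_set_add orbit submodule_center[OF C_submodule])
  note KD = submoduleD[OF K, simplified]
  have CK: "C \<subseteq> K"
    unfolding K_def by (rule Z.set_add_upper(2)[OF orbit submodule_center[OF C_submodule]])
  \<comment> \<open>Since \<open>r\<^sup>n\<^sup>+\<^sup>1\<close> lies in \<open>L (n + 1) = L n\<close>, the element \<open>a\<^sup>n r\<^sup>n\<^sup>+\<^sup>1 s\<close> is a central multiple of \<open>s\<close> modulo \<open>C\<close>; applying \<open>a\<close> turns it into \<open>s\<close>.\<close>
  define L where "L n = {x \<in> carrier R. (a [^]\<^bsub>R\<^esub> n) \<odot>\<^bsub>M\<^esub> (x \<odot>\<^bsub>M\<^esub> s) \<in> K}" for n :: nat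
  have "\<exists>n. \<forall>m\<ge>n. L m = L n"
  proof (rule noetherian_over_centerD[OF noetherian])
    fix i z x assume z: "z \<in> center R" and x: "x \<in> L i"
    have "(a [^]\<^bsub>R\<^esub> i) \<odot>\<^bsub>M\<^esub> ((z \<otimes>\<^bsub>R\<^esub> x) \<odot>\<^bsub>M\<^esub> s) = z \<odot>\<^bsub>M\<^esub> ((a [^]\<^bsub>R\<^esub> i) \<odot>\<^bsub>M\<^esub> (x \<odot>\<^bsub>M\<^esub> s))"
      using x s_mem z centerD(1)[OF z] ai by (simp add: L_def smult_assoc smult_center_commute)
    then show "z \<otimes>\<^bsub>R\<^esub> x \<in> L i"
      using x KD(5)[OF z] centerD(1)[OF z] by (simp add: L_def)
  next
    show "L i \<subseteq> L (Suc i)" for i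
      using s_mem KD(5)[OF a] aR by (auto simp: L_def smult_pow_mult)
  qed (use s_mem ai(2) KD(3,4) in \<open>auto simp: L_def smult_l_distr smult_r_distr\<close>)
  then obtain n where n: "L (Suc n) = L n" by (meson le_SucI order_refl)
  define t where "t = (r [^]\<^bsub>R\<^esub> Suc n) \<odot>\<^bsub>M\<^esub> s"
  have rR: "r [^]\<^bsub>R\<^esub> Suc n \<in> carrier R" and t: "t \<in> carrier M" using r s_mem by (simp_all add: t_def)
  obtain c1 where c1: "c1 \<in> C" and s1: "s = (a [^]\<^bsub>R\<^esub> Suc n) \<odot>\<^bsub>M\<^esub> t \<oplus>\<^bsub>M\<^esub> c1"
    using iterate[of "Suc n"] unfolding t_def by blast
  have "s = \<one>\<^bsub>R\<^esub> \<odot>\<^bsub>M\<^esub> s" using s_mem by simp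
  then have "s \<in> (\<lambda>z. z \<odot>\<^bsub>M\<^esub> s) ` center R" using subringE(3)[OF R.subring_center] by blast
  then have "s \<in> K"
    using Z.set_add_upper(1)[OF orbit submodule_center[OF C_submodule]] by (auto simp: K_def)
  then have "(a [^]\<^bsub>R\<^esub> Suc n) \<odot>\<^bsub>M\<^esub> t \<oplus>\<^bsub>M\<^esub> c1 \<in> K" using s1 by simp
  then have "(a [^]\<^bsub>R\<^esub> Suc n) \<odot>\<^bsub>M\<^esub> t \<in> K"
  proof (rule Z.submodule_add_cancel[OF K])
    show "c1 \<in> K" using c1 CK by blast
    show "(a [^]\<^bsub>R\<^esub> Suc n) \<odot>\<^bsub>M\<^esub> t \<in> carrier M" using ai(2)[of "Suc n"] t by (rule smult_closed)
  qed
  then have "r [^]\<^bsub>R\<^esub> Suc n \<in> L n"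
    unfolding n[symmetric] using rR by (simp add: L_def t_def)
  then have "(a [^]\<^bsub>R\<^esub> n) \<odot>\<^bsub>M\<^esub> t \<in> K" by (simp add: L_def t_def)
  then obtain b c2 where b: "b \<in> center R" and c2: "c2 \<in> C"
    and bs: "(a [^]\<^bsub>R\<^esub> n) \<odot>\<^bsub>M\<^esub> t = b \<odot>\<^bsub>M\<^esub> s \<oplus>\<^bsub>M\<^esub> c2"
    by (auto simp: K_def mem_set_add)
  have bR: "b \<in> carrier R" using centerD(1)[OF b] .
  have "(a [^]\<^bsub>R\<^esub> Suc n) \<odot>\<^bsub>M\<^esub> t = a \<odot>\<^bsub>M\<^esub> (b \<odot>\<^bsub>M\<^esub> s \<oplus>\<^bsub>M\<^esub> c2)"
    using smult_pow_Suc(1)[OF aR t] bs by simp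
  also have "\<dots> = b \<odot>\<^bsub>M\<^esub> (a \<odot>\<^bsub>M\<^esub> s) \<oplus>\<^bsub>M\<^esub> a \<odot>\<^bsub>M\<^esub> c2"
    using aR bR s_mem CD(2)[OF c2] smult_center_commute[OF a bR s_mem] by (simp add: smult_r_distr)
  finally have "s = b \<odot>\<^bsub>M\<^esub> (a \<odot>\<^bsub>M\<^esub> s) \<oplus>\<^bsub>M\<^esub> a \<odot>\<^bsub>M\<^esub> c2 \<oplus>\<^bsub>M\<^esub> c1" using s1 by simp
  then have "s = b \<odot>\<^bsub>M\<^esub> (a \<odot>\<^bsub>M\<^esub> s) \<oplus>\<^bsub>M\<^esub> (a \<odot>\<^bsub>M\<^esub> c2 \<oplus>\<^bsub>M\<^esub> c1)"
    using aR bR s_mem CD(2)[OF c2] CD(2)[OF c1] by (simp add: M.a_assoc)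
  then show ?thesis
    using b CD(4)[OF CD(5)[OF aR c2] c1] by blast
qed

text \<open>
  By \<open>central_inverse\<close> the centre acts on \<open>D / C\<close> through a field. A submodule \<open>Q\<close> over the
  centre that is maximal among those that avoid \<open>s\<close> is therefore a hyperplane. The elements that all of \<open>R\<close> takes into
  \<open>Q\<close> form an \<open>R\<close>-submodule that avoids \<open>s\<close>, so this submodule is \<open>C\<close>. By \<open>finite_test\<close> finitely many
  elements of \<open>R\<close> suffice to cut it out, which makes \<open>C\<close> a finite intersection of spaces of
  codimension at most one.
\<close>

lemma dcc_between_annihilated:
  assumes D: "submodule D R M" "C \<subseteq> D" "s \<in> D"
    and ann: "\<And>a e. a \<in> center R \<Longrightarrow> a \<odot>\<^bsub>M\<^esub> s \<in> C \<Longrightarrow> e \<in> D \<Longrightarrow> a \<odot>\<^bsub>M\<^esub> e \<in> C"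
  shows "dcc_between R M C D"
proof -
  interpret Z: left_module "center_ring R" M by (rule left_module_center)
  note DD = submoduleD[OF D(1)]
  note DZ = submodule_center[OF D(1)]
  obtain Q where Q: "submodule Q (center_ring R) M" "C \<subseteq> Q" "Q \<subseteq> D" "s \<notin> Q"
    and Qmax: "\<And>N. submodule N (center_ring R) M \<Longrightarrow> Q \<subseteq> N \<Longrightarrow> N \<subseteq> D \<Longrightarrow> s \<notin> N \<Longrightarrow> N = Q"
    using Z.exists_maximal_avoiding[OF submodule_center[OF C_submodule] D(2) s_notin] by auto
  note QD = submoduleD[OF Q(1), simplified]
  have hyperplane: "N = Q \<or> N = D"
    if N: "submodule N (center_ring R) M" "Q \<subseteq> N" "N \<subseteq> D" for N
  proof (cases "N = Q")
    case False
    then have sN: "s \<in> N" using Qmax N by blast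
    note ND = submoduleD[OF N(1), simplified]
    have "e \<in> N" if e: "e \<in> D" for e
    proof (cases "e \<in> Q")
      case True
      then show ?thesis using N(2) by blast
    next
      case False
      have eM: "e \<in> carrier M" using e DD(2) by blast
      define B where "B = (\<lambda>z. z \<odot>\<^bsub>M\<^esub> e) ` center R"
      have B: "submodule B (center_ring R) M"
        using Z.submodule_orbit[OF eM] by (simp add: B_def)
      have "B \<subseteq> D" using DD(5) e centerD(1)[of _ R] by (auto simp: B_def)
      then have QB: "Q <+>\<^bsub>M\<^esub> B \<subseteq> D" by (intro Z.set_add_least[OF DZ] Q(3))
      have "\<one>\<^bsub>R\<^esub> \<odot>\<^bsub>M\<^esub> e \<in> B" using subringE(3)[OF R.subring_center] by (auto simp: B_def)
      then have "e \<in> Q <+>\<^bsub>M\<^esub> B" using Z.set_add_upper(2)[OF Q(1) B] eM by auto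
      then have "Q <+>\<^bsub>M\<^esub> B \<noteq> Q" using False by blast
      then have "s \<in> Q <+>\<^bsub>M\<^esub> B"
        using Qmax[OF Z.submodule_set_add[OF Q(1) B] Z.set_add_upper(1)[OF Q(1) B] QB] by blast
      then obtain q a where q: "q \<in> Q" and a: "a \<in> center R" and s_eq: "s = q \<oplus>\<^bsub>M\<^esub> a \<odot>\<^bsub>M\<^esub> e"
        by (auto simp: B_def mem_set_add)
      note aR = centerD(1)[OF a]
      have aeM: "a \<odot>\<^bsub>M\<^esub> e \<in> carrier M" using aR eM by simp
      have ae: "a \<odot>\<^bsub>M\<^esub> e = s \<ominus>\<^bsub>M\<^esub> q"
        using eq_add_iff_diff_eq[OF s_mem QD(2)[OF q] aeM] s_eq by simp
      have "a \<odot>\<^bsub>M\<^esub> s \<notin> C"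
      proof
        assume "a \<odot>\<^bsub>M\<^esub> s \<in> C"
        then have "a \<odot>\<^bsub>M\<^esub> e \<in> Q" using ann[OF a _ e] Q(2) by blast
        then have "s \<in> Q" unfolding s_eq using q QD(4) by blast
        then show False using Q(4) by blast
      qed
      then obtain b c where b: "b \<in> center R" and c: "c \<in> C" and bas: "s = b \<odot>\<^bsub>M\<^esub> (a \<odot>\<^bsub>M\<^esub> s) \<oplus>\<^bsub>M\<^esub> c"
        using central_inverse[OF a] by blast
      note bR = centerD(1)[OF b]
      \<comment> \<open>As \<open>u\<close> kills \<open>s\<close> modulo \<open>C\<close>, it takes \<open>D\<close> into \<open>C\<close>; so \<open>b\<close> inverts \<open>a\<close> on all of \<open>D / C\<close>.\<close>
      define u where "u = \<one>\<^bsub>R\<^esub> \<ominus>\<^bsub>R\<^esub> b \<otimes>\<^bsub>R\<^esub> a"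
      have u: "u \<in> center R"
        unfolding u_def a_minus_def
        using subringE(3,5,6,7)[OF R.subring_center] a b by simp
      have u_eq: "u \<odot>\<^bsub>M\<^esub> x = x \<ominus>\<^bsub>M\<^esub> b \<odot>\<^bsub>M\<^esub> (a \<odot>\<^bsub>M\<^esub> x)" if x: "x \<in> carrier M" for x
      proof -
        have "b \<odot>\<^bsub>M\<^esub> (a \<odot>\<^bsub>M\<^esub> x) \<oplus>\<^bsub>M\<^esub> u \<odot>\<^bsub>M\<^esub> x = (b \<otimes>\<^bsub>R\<^esub> a \<oplus>\<^bsub>R\<^esub> u) \<odot>\<^bsub>M\<^esub> x"
          using x aR bR centerD(1)[OF u] by (simp add: smult_l_distr smult_assoc)
        also have "b \<otimes>\<^bsub>R\<^esub> a \<oplus>\<^bsub>R\<^esub> u = \<one>\<^bsub>R\<^esub>"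
          using aR bR by (simp add: u_def a_minus_def R.a_comm[of "\<one>\<^bsub>R\<^esub>"] R.r_neg2)
        finally have "x = b \<odot>\<^bsub>M\<^esub> (a \<odot>\<^bsub>M\<^esub> x) \<oplus>\<^bsub>M\<^esub> u \<odot>\<^bsub>M\<^esub> x" using x by simp
        then show ?thesis
          using eq_add_iff_diff_eq[of x "b \<odot>\<^bsub>M\<^esub> (a \<odot>\<^bsub>M\<^esub> x)" "u \<odot>\<^bsub>M\<^esub> x"] x aR bR centerD(1)[OF u] by simp
      qed
      have "u \<odot>\<^bsub>M\<^esub> s = c"
        unfolding u_eq[OF s_mem]
        using eq_add_iff_diff_eq[of s "b \<odot>\<^bsub>M\<^esub> (a \<odot>\<^bsub>M\<^esub> s)" c] bas s_mem aR bR CD(2)[OF c] by simp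
      then have "u \<odot>\<^bsub>M\<^esub> e \<in> N" using ann[OF u _ e] c Q(2) N(2) by auto
      moreover have "b \<odot>\<^bsub>M\<^esub> (a \<odot>\<^bsub>M\<^esub> e) \<in> N"
        unfolding ae using ND(5)[OF b ND(7)[OF sN]] q N(2) by blast
      moreover have "e = b \<odot>\<^bsub>M\<^esub> (a \<odot>\<^bsub>M\<^esub> e) \<oplus>\<^bsub>M\<^esub> u \<odot>\<^bsub>M\<^esub> e"
        using eq_add_iff_diff_eq[of e "b \<odot>\<^bsub>M\<^esub> (a \<odot>\<^bsub>M\<^esub> e)" "u \<odot>\<^bsub>M\<^esub> e"] u_eq[OF eM] eM aR bR centerD(1)[OF u] by simp
      ultimately show ?thesis using ND(4) by metis
    qed
    then show ?thesis using N(3) by blast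
  qed simp
  define V where "V F = {e \<in> D. \<forall>r\<in>F. r \<odot>\<^bsub>M\<^esub> e \<in> Q}" for F
  have V_sub: "submodule (V F) (center_ring R) M" if "F \<subseteq> carrier R" for F
    unfolding V_def using that centerD(2)[of _ R]
    by (intro submodule_vimages R.subring_center Q(1) DZ) (metis subsetD)+
  have single: "dcc_between (center_ring R) M (V {r}) D" if r: "r \<in> carrier R" for r
  proof (rule Z.dcc_between_no_intermediate)
    fix N assume N: "submodule N (center_ring R) M" "V {r} \<subseteq> N" "N \<subseteq> D"
    note ND = submoduleD[OF N(1), simplified]
    define rN where "rN = (\<lambda>x. r \<odot>\<^bsub>M\<^esub> x) ` N"
    have rN: "submodule rN (center_ring R) M"
      unfolding rN_def
      using r N(1) centerD(2)[of _ R r] by (intro submodule_image_of_commuting R.subring_center) metis+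
    have "rN \<subseteq> D" using N(3) DD(5)[OF r] by (auto simp: rN_def)
    then have "Q <+>\<^bsub>M\<^esub> rN = Q \<or> Q <+>\<^bsub>M\<^esub> rN = D"
      by (intro hyperplane Z.submodule_set_add Z.set_add_upper Z.set_add_least[OF DZ] Q rN)
    then show "N = V {r} \<or> N = D"
    proof
      assume "Q <+>\<^bsub>M\<^esub> rN = Q"
      then have "rN \<subseteq> Q" using Z.set_add_upper(2)[OF Q(1) rN] by blast
      then show ?thesis using N(2,3) by (auto simp: rN_def V_def)
    next
      assume eq: "Q <+>\<^bsub>M\<^esub> rN = D"
      have "d \<in> N" if d: "d \<in> D" for d
      proof -
        have "r \<odot>\<^bsub>M\<^esub> d \<in> Q <+>\<^bsub>M\<^esub> rN" unfolding eq using DD(5)[OF r d] .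
        then obtain q x where q: "q \<in> Q" and x: "x \<in> N" and rd: "r \<odot>\<^bsub>M\<^esub> d = q \<oplus>\<^bsub>M\<^esub> r \<odot>\<^bsub>M\<^esub> x"
          by (auto simp: rN_def mem_set_add)
        have dx: "d \<in> carrier M" "x \<in> carrier M" "x \<in> D" using d x DD(2) N(3) by auto
        have "r \<odot>\<^bsub>M\<^esub> d = r \<odot>\<^bsub>M\<^esub> x \<oplus>\<^bsub>M\<^esub> q"
          using rd r dx QD(2)[OF q] by (simp add: M.a_comm)
        then have "r \<odot>\<^bsub>M\<^esub> (d \<ominus>\<^bsub>M\<^esub> x) = q"
          using eq_add_iff_diff_eq[of "r \<odot>\<^bsub>M\<^esub> d" "r \<odot>\<^bsub>M\<^esub> x" q] r dx QD(2)[OF q] by (simp add: smult_r_minus)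
        then have "d \<ominus>\<^bsub>M\<^esub> x \<in> N"
          using N(2) q DD(7)[OF d dx(3)] by (auto simp: V_def)
        moreover have "d = x \<oplus>\<^bsub>M\<^esub> (d \<ominus>\<^bsub>M\<^esub> x)" using eq_add_iff_diff_eq[of d x] dx by simp
        ultimately show ?thesis using ND(4)[OF x] by metis
      qed
      then show ?thesis using N(3) by blast
    qed
  qed
  obtain F where F: "F \<subseteq> carrier R" "finite F" and
    test: "\<And>e. e \<in> D \<Longrightarrow> \<forall>r\<in>F. r \<odot>\<^bsub>M\<^esub> e \<in> Q \<Longrightarrow> \<forall>r\<in>carrier R. r \<odot>\<^bsub>M\<^esub> e \<in> Q"
    using finite_test[OF noetherian Q(1) DD(1) order_refl] by metis
  have "dcc_between (center_ring R) M (V F) D"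
    using F(2,1)
  proof (induction F rule: finite_induct)
    case empty
    show ?case by (rule Z.dcc_between_no_intermediate) (auto simp: V_def)
  next
    case (insert r F)
    have "dcc_between (center_ring R) M (V {r} \<inter> V F) D"
    proof (rule Z.dcc_between_Int)
      show "submodule (V {r}) (center_ring R) M" "submodule (V F) (center_ring R) M"
        using insert.prems by (simp_all add: V_sub)
      show "dcc_between (center_ring R) M (V {r}) D" using insert.prems by (simp add: single)
      show "dcc_between (center_ring R) M (V F) D" using insert by simp
    qed (auto simp: V_def DZ)
    moreover have "V {r} \<inter> V F = V (insert r F)" by (auto simp: V_def)
    ultimately show ?case by simp
  qed
  moreover have "V F = C"
  proof -
    have all: "V F = V (carrier R)" using test F(1) by (auto simp: V_def)
    have "V (carrier R) = C"
    proof (rule maximal)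
      show "C \<subseteq> V (carrier R)" using D(2) CD(5) Q(2) by (auto simp: V_def)
      have "s \<in> Q" if "s \<in> V (carrier R)"
        using that s_mem R.one_closed by (auto simp: V_def dest: bspec[of _ _ "\<one>\<^bsub>R\<^esub>"])
      then show "s \<notin> V (carrier R)" using Q(4) by blast
      show "submodule (V (carrier R)) R M"
      proof (rule submoduleI)
        fix a x assume a: "a \<in> carrier R" and x: "x \<in> V (carrier R)"
        have "r \<odot>\<^bsub>M\<^esub> (a \<odot>\<^bsub>M\<^esub> x) \<in> Q" if r: "r \<in> carrier R" for r
        proof -
          have "x \<in> carrier M" "(r \<otimes>\<^bsub>R\<^esub> a) \<odot>\<^bsub>M\<^esub> x \<in> Q" using x r a DD(2) by (auto simp: V_def)
          then show ?thesis using r a by (simp add: smult_assoc)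
        qed
        then show "a \<odot>\<^bsub>M\<^esub> x \<in> V (carrier R)" using x DD(5)[OF a] by (auto simp: V_def)
      qed (use submoduleD[OF V_sub[OF order_refl]] in auto)
    qed
    with all show ?thesis by simp
  qed
  ultimately have "dcc_between (center_ring R) M C D" by simp
  then show ?thesis by (rule dcc_between_center)
qed

text \<open>
  The central elements that kill \<open>s\<close> modulo \<open>C\<close> are locally nilpotent by \<open>central_torsion\<close>, and
  finitely many of them cut out the part of \<open>M / C\<close> on which all of them vanish. That part is artinian by
  \<open>dcc_between_annihilated\<close>.
\<close>

theorem dcc_between_maximal_avoiding: "dcc_between R M C (carrier M)"
proof -
  define m where "m = {a \<in> center R. a \<odot>\<^bsub>M\<^esub> s \<in> C}"
  have "m \<subseteq> carrier R" using centerD(1)[of _ R] by (auto simp: m_def)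
  then obtain F where F: "F \<subseteq> m" "finite F" and
    test: "\<And>e. e \<in> carrier M \<Longrightarrow> \<forall>a\<in>F. a \<odot>\<^bsub>M\<^esub> e \<in> C \<Longrightarrow> \<forall>a\<in>m. a \<odot>\<^bsub>M\<^esub> e \<in> C"
    using finite_test[OF noetherian submodule_center[OF C_submodule] order_refl, of m] by metis
  have F_center: "F \<subseteq> center R" using F(1) by (auto simp: m_def)
  show ?thesis
  proof (rule dcc_between_torsion[OF F(2) F_center C_submodule])
    show "\<exists>n :: nat. (a [^]\<^bsub>R\<^esub> n) \<odot>\<^bsub>M\<^esub> e \<in> C" if "a \<in> F" "e \<in> carrier M" for a e
      using that F(1) by (intro central_torsion) (auto simp: m_def)
    show "dcc_between R M C {e \<in> carrier M. \<forall>a\<in>F. a \<odot>\<^bsub>M\<^esub> e \<in> C}"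
    proof (rule dcc_between_annihilated)
      show "submodule {e \<in> carrier M. \<forall>a\<in>F. a \<odot>\<^bsub>M\<^esub> e \<in> C} R M"
        by (intro submodule_central_vimages F_center C_submodule submodule_carrier)
      show "C \<subseteq> {e \<in> carrier M. \<forall>a\<in>F. a \<odot>\<^bsub>M\<^esub> e \<in> C}"
        using CD(2,5) F_center centerD(1)[of _ R] by blast
      show "s \<in> {e \<in> carrier M. \<forall>a\<in>F. a \<odot>\<^bsub>M\<^esub> e \<in> C}"
        using s_mem F(1) by (auto simp: m_def)
    qed (use test in \<open>auto simp: m_def\<close>)
  qed
qed

end


section \<open>Essential extensions of artinian modules\<close>

text \<open>
  The submodules \<open>C\<close> of \<open>E\<close> for which \<open>E / C\<close> is artinian are closed under finite intersections, and
  for every nonzero element some of them avoids it. As \<open>M\<close> is artinian, one of them has minimal trace on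
  \<open>M\<close>, which must then be zero.
\<close>

theorem essential_extension_artinian:
  assumes noeth: "noetherian_over_center R" and art: "artinian_module R M" and ess: "essential_mono R M j E"
  shows "artinian_module R E"
proof -
  have M: "left_module R M" and E: "left_module R E" and j: "j \<in> left_module_hom R M E"
    and inj: "inj_on j (carrier M)"
    and essential: "\<And>N. submodule N R E \<Longrightarrow> N \<inter> j ` carrier M = {\<zero>\<^bsub>E\<^esub>} \<Longrightarrow> N = {\<zero>\<^bsub>E\<^esub>}"
    using ess unfolding essential_mono_def by blast+
  interpret M: left_module R M by fact
  interpret E: left_module R E by fact
  note jD = left_module_homD[OF j]
  have j0: "j \<zero>\<^bsub>M\<^esub> = \<zero>\<^bsub>E\<^esub>" by (rule left_module_hom_zero[OF M E j])
  define trace where "trace C = {x \<in> carrier M. j x \<in> C}" for C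
  have trace_sub: "submodule (trace C) R M" if "submodule C R E" for C
    by (rule M.submoduleI) (use submoduleD[OF that] jD j0 in \<open>auto simp: trace_def\<close>)
  define P where "P N \<longleftrightarrow> (\<exists>C. submodule C R E \<and> dcc_between R E C (carrier E) \<and> N = trace C)" for N
  have "dcc_between R E (carrier E) (carrier E)"
    by (rule E.dcc_between_no_intermediate) auto
  then have "P (trace (carrier E))" using E.submodule_carrier by (auto simp: P_def)
  then have "\<exists>N. P N \<and> (\<forall>N'. P N' \<and> N' \<subseteq> N \<longrightarrow> N' = N)"
  proof (rule chain_condition_minimal[OF subset_order, rotated])
    fix W :: "nat \<Rightarrow> _ set" assume W: "\<And>i. P (W i)" "\<And>i. W (Suc i) \<subseteq> W i"
    then have "submodule (W i) R M" for i using trace_sub unfolding P_def by metis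
    then show "\<exists>n. \<forall>m\<ge>n. W m = W n" using art W(2) unfolding artinian_module_def by blast
  qed
  then obtain C where C: "submodule C R E" "dcc_between R E C (carrier E)"
    and min: "\<And>N'. P N' \<Longrightarrow> N' \<subseteq> trace C \<Longrightarrow> N' = trace C"
    unfolding P_def by auto
  note CD = submoduleD[OF C(1)]
  have "x = \<zero>\<^bsub>M\<^esub>" if x: "x \<in> trace C" for x
  proof (rule ccontr)
    assume "x \<noteq> \<zero>\<^bsub>M\<^esub>"
    have xM: "x \<in> carrier M" using x by (simp add: trace_def)
    then have "j x \<notin> {\<zero>\<^bsub>E\<^esub>}"
      using \<open>x \<noteq> \<zero>\<^bsub>M\<^esub>\<close> inj j0 by (metis M.M.zero_closed inj_onD singletonD)
    moreover have zero: "submodule {\<zero>\<^bsub>E\<^esub>} R E" by (rule E.submoduleI) auto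
    ultimately obtain C' where C': "submodule C' R E" "j x \<notin> C'"
      and C'max: "\<And>N. submodule N R E \<Longrightarrow> C' \<subseteq> N \<Longrightarrow> N \<subseteq> carrier E \<Longrightarrow> j x \<notin> N \<Longrightarrow> N = C'"
      using E.exists_maximal_avoiding[of "{\<zero>\<^bsub>E\<^esub>}" "carrier E" "j x"] by auto
    interpret maximal_avoiding R E C' "j x"
    proof (intro maximal_avoiding.intro maximal_avoiding_axioms.intro E noeth C' jD(1)[OF xM])
      show "N = C'" if "submodule N R E" "C' \<subseteq> N" "j x \<notin> N" for N
        by (rule C'max[OF that(1,2) submoduleD(1)[OF that(1)] that(3)])
    qed
    have "dcc_between R E (C \<inter> C') (carrier E)"
      using C C' dcc_between_maximal_avoiding submoduleD(1)
      by (intro E.dcc_between_Int E.submodule_carrier) auto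
    then have "P (trace (C \<inter> C'))" using C(1) C'(1) E.submodule_Int by (auto simp: P_def)
    then have "trace (C \<inter> C') = trace C" by (rule min) (auto simp: trace_def)
    then show False using x C'(2) by (auto simp: trace_def)
  qed
  then have "C \<inter> j ` carrier M \<subseteq> {\<zero>\<^bsub>E\<^esub>}"
    using j0 by (auto simp: trace_def)
  moreover have "\<zero>\<^bsub>E\<^esub> \<in> j ` carrier M"
    using j0 M.M.zero_closed by (metis imageI)
  ultimately have "C \<inter> j ` carrier M = {\<zero>\<^bsub>E\<^esub>}" using CD(3) by blast
  then have "C = {\<zero>\<^bsub>E\<^esub>}" using essential C(1) by blast
  then have dcc: "dcc_between R E {\<zero>\<^bsub>E\<^esub>} (carrier E)" using C(2) by simp
  have "\<exists>n. \<forall>m\<ge>n. N m = N n" if N: "\<And>i. submodule (N i) R E" "\<And>i. N (Suc i) \<subseteq> N i" for N :: "nat \<Rightarrow> _ set"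
    by (rule dcc_betweenD[OF dcc]) (use N submoduleD(1,3)[OF N(1)] in auto)
  then show ?thesis using E unfolding artinian_module_def by blast
qed


section \<open>Commutators in characteristic p\<close>

definition commutator :: "'r::ring_1 \<Rightarrow> 'r \<Rightarrow> 'r"
  where "commutator x y = x * y - y * x"

text \<open>
  Left multiplication by \<open>x\<close> is the sum of \<open>commutator x\<close> and right multiplication by \<open>x\<close>. These two
  commute, so this is the binomial theorem.
\<close>

lemma power_mult_eq_commutators:
  fixes x y :: "'r::ring_1"
  shows "x ^ n * y = (\<Sum>k\<le>n. of_nat (n choose k) * (commutator x ^^ k) y * x ^ (n - k))"
proof (induction n)
  case 0
  show ?case by simp
next
  case (Suc n)
  define a where "a k = (commutator x ^^ k) y" for k
  have a_Suc: "x * a k = a (Suc k) + a k * x" for k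
    by (simp add: a_def commutator_def)
  have nat_comm: "x * of_nat m = of_nat m * x" for m
    by (simp add: mult_of_nat_commute)
  have "x ^ Suc n * y = x * (\<Sum>k\<le>n. of_nat (n choose k) * a k * x ^ (n - k))"
    using Suc.IH by (simp add: mult.assoc a_def)
  also have "\<dots> = (\<Sum>k\<le>n. of_nat (n choose k) * (x * a k) * x ^ (n - k))"
    unfolding sum_distrib_left by (intro sum.cong) (simp_all add: mult.assoc[symmetric] nat_comm)
  also have "\<dots> = (\<Sum>k\<le>n. of_nat (n choose k) * a (Suc k) * x ^ (n - k)) +
      (\<Sum>k\<le>n. of_nat (n choose k) * a k * x ^ (Suc n - k))"
    unfolding sum.distrib[symmetric] a_Suc
    by (intro sum.cong) (simp_all add: algebra_simps Suc_diff_le power_Suc2[symmetric] power_commutes)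
  also have "(\<Sum>k\<le>n. of_nat (n choose k) * a k * x ^ (Suc n - k)) =
      (\<Sum>k\<le>Suc n. of_nat (n choose k) * a k * x ^ (Suc n - k))"
    by (simp add: binomial_eq_0)
  also have "\<dots> = a 0 * x ^ Suc n + (\<Sum>k\<le>n. of_nat (n choose Suc k) * a (Suc k) * x ^ (n - k))"
    by (subst sum.atMost_Suc_shift) simp
  also have "(\<Sum>k\<le>n. of_nat (n choose k) * a (Suc k) * x ^ (n - k)) + \<dots> =
      a 0 * x ^ Suc n + (\<Sum>k\<le>n. of_nat (Suc n choose Suc k) * a (Suc k) * x ^ (n - k))"
    by (simp add: sum.distrib[symmetric] distrib_right)
  also have "\<dots> = (\<Sum>k\<le>Suc n. of_nat (Suc n choose k) * a k * x ^ (Suc n - k))"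
    by (subst sum.atMost_Suc_shift) (simp del: binomial_Suc_Suc)
  finally show ?case by (simp add: a_def)
qed

lemma commutator_funpow_prime:
  fixes x y :: "'r::ring_1"
  assumes p: "Factorial_Ring.prime p" and char: "of_nat p = (0 :: 'r)"
  shows "(commutator x ^^ p) y = commutator (x ^ p) y"
proof -
  have p0: "p > 0" using p prime_gt_0_nat by blast
  have "x ^ p * y = (\<Sum>k\<le>p. of_nat (p choose k) * (commutator x ^^ k) y * x ^ (p - k))"
    by (rule power_mult_eq_commutators)
  also have "\<dots> = (\<Sum>k\<in>{0, p}. of_nat (p choose k) * (commutator x ^^ k) y * x ^ (p - k))"
  proof (rule sum.mono_neutral_right)
    show "\<forall>k\<in>{..p} - {0, p}. of_nat (p choose k) * (commutator x ^^ k) y * x ^ (p - k) = 0"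
    proof
      fix k assume "k \<in> {..p} - {0, p}"
      then have "p dvd p choose k" by (intro dvd_choose_prime p) auto
      then obtain m where "p choose k = p * m" by (rule dvdE)
      then show "of_nat (p choose k) * (commutator x ^^ k) y * x ^ (p - k) = 0"
        by (simp add: char)
    qed
  qed auto
  also have "\<dots> = y * x ^ p + (commutator x ^^ p) y"
    using p0 by simp
  finally show ?thesis by (simp add: commutator_def)
qed

lemma commutator_funpow_prime_power:
  fixes x :: "'r::ring_1"
  assumes "Factorial_Ring.prime p" "of_nat p = (0 :: 'r)"
  shows "commutator x ^^ (p ^ i) = commutator (x ^ (p ^ i))"
proof (induction i)
  case (Suc i)
  have "commutator x ^^ (p ^ Suc i) = (commutator x ^^ (p ^ i)) ^^ p"
    by (simp add: funpow_mult mult.commute)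
  also have "\<dots> = commutator ((x ^ (p ^ i)) ^ p)"
    using commutator_funpow_prime[OF assms] by (auto simp: Suc.IH)
  finally show ?case by (simp add: power_mult[symmetric] mult.commute)
qed simp


section \<open>Linear dependence\<close>

text \<open>
  Fewer equations \<open>J\<close> than unknowns \<open>T\<close>: Gaussian elimination uses up one unknown per equation.
\<close>

lemma homogeneous_system_solution:
  fixes v :: "'i \<Rightarrow> 'j \<Rightarrow> 'k::field"
  assumes "finite J" "finite T" "card J < card T"
  shows "\<exists>c. (\<exists>i\<in>T. c i \<noteq> 0) \<and> (\<forall>j\<in>J. (\<Sum>i\<in>T. c i * v i j) = 0)"
  using assms
proof (induction J arbitrary: T v rule: finite_induct)
  case empty
  then have "T \<noteq> {}" by auto
  then obtain i where "i \<in> T" by blast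
  then show ?case by (intro exI[of _ "\<lambda>_. 1"]) auto
next
  case (insert j J)
  show ?case
  proof (cases "\<forall>i\<in>T. v i j = 0")
    case True
    have "card J < card T" using insert.prems insert.hyps by simp
    then obtain c where c: "\<exists>i\<in>T. c i \<noteq> 0" "\<forall>j\<in>J. (\<Sum>i\<in>T. c i * v i j) = 0"
      using insert.IH[OF insert.prems(1), of v] by blast
    moreover have "(\<Sum>i\<in>T. c i * v i j) = 0" using True by (simp add: sum.neutral)
    ultimately show ?thesis by (intro exI[of _ c]) auto
  next
    case False
    then obtain t where t: "t \<in> T" "v t j \<noteq> 0" by blast
    define T' where "T' = T - {t}"
    have T: "T = insert t T'" "t \<notin> T'" "finite T'" using t(1) insert.prems(1) by (auto simp: T'_def)
    define w where "w i l = v i l - v i j / v t j * v t l" for i l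
    have "card J < card T'" using insert.prems(2) insert.hyps T by simp
    then obtain c where c: "\<exists>i\<in>T'. c i \<noteq> 0" "\<forall>l\<in>J. (\<Sum>i\<in>T'. c i * w i l) = 0"
      using insert.IH[OF T(3), of w] by blast
    define d where "d i = (if i = t then - (\<Sum>i\<in>T'. c i * v i j) / v t j else c i)" for i
    have sum_d: "(\<Sum>i\<in>T. d i * v i l) = (\<Sum>i\<in>T'. c i * w i l)" for l
    proof -
      have "(\<Sum>i\<in>T. d i * v i l) = d t * v t l + (\<Sum>i\<in>T'. d i * v i l)"
        using T by simp
      also have "(\<Sum>i\<in>T'. d i * v i l) = (\<Sum>i\<in>T'. c i * v i l)"
        using T(2) by (intro sum.cong) (auto simp: d_def)
      also have "d t * v t l = - (\<Sum>i\<in>T'. c i * v i j / v t j * v t l)"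
        by (simp add: d_def sum_divide_distrib sum_distrib_right)
      also have "- (\<Sum>i\<in>T'. c i * v i j / v t j * v t l) + (\<Sum>i\<in>T'. c i * v i l) = (\<Sum>i\<in>T'. c i * w i l)"
        by (simp add: w_def sum_subtractf[symmetric] algebra_simps)
      finally show ?thesis .
    qed
    have "w i j = 0" for i using t(2) by (simp add: w_def)
    then have "\<forall>l\<in>insert j J. (\<Sum>i\<in>T. d i * v i l) = 0" using c(2) by (simp add: sum_d)
    moreover have "\<exists>i\<in>T. d i \<noteq> 0" using c(1) T(1,2) by (auto simp: d_def)
    ultimately show ?thesis by blast
  qed
qed


section \<open>Hilbert's basis theorem modulo an ideal\<close>

text \<open>
  Calculations in a quotient ring are carried out in the ring itself modulo an ideal \<open>I\<close>, where
  the arithmetic of the type class applies.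
\<close>

locale two_sided_ideal =
  fixes I :: "'r::ring_1 set"
  assumes zero_mem: "0 \<in> I"
    and add_mem: "x \<in> I \<Longrightarrow> y \<in> I \<Longrightarrow> x + y \<in> I"
    and mult_left_mem: "x \<in> I \<Longrightarrow> r * x \<in> I"
    and mult_right_mem: "x \<in> I \<Longrightarrow> x * r \<in> I"
begin

lemma uminus_mem: "x \<in> I \<Longrightarrow> - x \<in> I"
  using mult_left_mem[of x "- 1"] by simp

lemma diff_mem: "x \<in> I \<Longrightarrow> y \<in> I \<Longrightarrow> x - y \<in> I"
  using add_mem[of x "- y"] uminus_mem by simp

lemma sum_mem: "(\<And>i. i \<in> A \<Longrightarrow> f i \<in> I) \<Longrightarrow> sum f A \<in> I"
  by (induction A rule: infinite_finite_induct) (auto simp: zero_mem add_mem)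

text \<open>
  These sets are the preimages of the subgroups of the quotient by \<open>I\<close> that are closed under left
  multiplication by \<open>W\<close>, that is, of its submodules over the subring generated by \<open>W\<close>.
\<close>

definition stable :: "'r set \<Rightarrow> 'r set \<Rightarrow> bool"
  where "stable W N \<longleftrightarrow> I \<subseteq> N \<and> (\<forall>x\<in>N. \<forall>y\<in>N. x - y \<in> N) \<and> (\<forall>w\<in>W. \<forall>x\<in>N. w * x \<in> N)"

lemma stableD:
  assumes "stable W N"
  shows "x \<in> I \<Longrightarrow> x \<in> N" "0 \<in> N" "x \<in> N \<Longrightarrow> y \<in> N \<Longrightarrow> x - y \<in> N" "x \<in> N \<Longrightarrow> y \<in> N \<Longrightarrow> x + y \<in> N"
    "w \<in> W \<Longrightarrow> x \<in> N \<Longrightarrow> w * x \<in> N"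
proof -
  show I: "x \<in> I \<Longrightarrow> x \<in> N" for x using assms by (auto simp: stable_def)
  show 0: "0 \<in> N" using I zero_mem by blast
  show diff: "x \<in> N \<Longrightarrow> y \<in> N \<Longrightarrow> x - y \<in> N" for x y using assms by (auto simp: stable_def)
  show "x \<in> N \<Longrightarrow> y \<in> N \<Longrightarrow> x + y \<in> N" using diff[of x "0 - y"] diff[OF 0] by simp
  show "w \<in> W \<Longrightarrow> x \<in> N \<Longrightarrow> w * x \<in> N" using assms by (auto simp: stable_def)
qed

lemma stable_sum: "stable W N \<Longrightarrow> (\<And>i. i \<in> A \<Longrightarrow> f i \<in> N) \<Longrightarrow> sum f A \<in> N"
  by (induction A rule: infinite_finite_induct) (auto simp: stableD)

lemma stable_Int: "stable W N \<Longrightarrow> stable W N' \<Longrightarrow> stable W (N \<inter> N')"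
  by (auto simp: stable_def)

definition acc_below :: "'r set \<Rightarrow> 'r set \<Rightarrow> bool"
  where "acc_below W H \<longleftrightarrow>
    (\<forall>N :: nat \<Rightarrow> 'r set. (\<forall>i. stable W (N i) \<and> N i \<subseteq> H \<and> N i \<subseteq> N (Suc i)) \<longrightarrow>
      (\<exists>n. \<forall>m\<ge>n. N m = N n))"

lemma acc_belowD:
  assumes "acc_below W H" "\<And>i. stable W (N i)" "\<And>i. N i \<subseteq> H" "\<And>i. N i \<subseteq> N (Suc i)"
  shows "\<exists>n. \<forall>m\<ge>n. N m = N n"
  using assms unfolding acc_below_def by meson

text \<open>
  A chain that leaves \<open>H\<close> contains from some point on an element \<open>h + c v\<close> with \<open>c \<noteq> 0\<close>, and
  subtracting multiples of it moves every later element into \<open>H\<close>.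
\<close>

lemma acc_below_add_vector:
  assumes K: "\<And>c. c \<in> K \<Longrightarrow> c \<noteq> 0 \<Longrightarrow> \<exists>d\<in>K. d * c = 1"
    and H: "stable K H" "acc_below K H"
  shows "acc_below K {h + c * v | h c. h \<in> H \<and> c \<in> K}"
  unfolding acc_below_def
proof (intro allI impI)
  fix N :: "nat \<Rightarrow> 'r set"
  assume "\<forall>i. stable K (N i) \<and> N i \<subseteq> {h + c * v | h c. h \<in> H \<and> c \<in> K} \<and> N i \<subseteq> N (Suc i)"
  then have N: "\<And>i. stable K (N i)" "\<And>i. N i \<subseteq> {h + c * v | h c. h \<in> H \<and> c \<in> K}" "\<And>i. N i \<subseteq> N (Suc i)"
    by blast+
  have mono: "N i \<subseteq> N j" if "i \<le> j" for i j using N(3) that by (rule lift_Suc_mono_le)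
  show "\<exists>n. \<forall>m\<ge>n. N m = N n"
  proof (cases "\<forall>i. N i \<subseteq> H")
    case True
    then show ?thesis using acc_belowD[OF H(2), of N] N(1,3) by blast
  next
    case False
    then obtain l n0 where n0: "n0 \<in> N l" "n0 \<notin> H" by blast
    then obtain h0 c0 where h0: "n0 = h0 + c0 * v" "h0 \<in> H" "c0 \<in> K" using N(2) by blast
    then have "c0 \<noteq> 0" using n0(2) by auto
    then obtain d where d: "d \<in> K" "d * c0 = 1" using K h0(3) by blast
    have "\<exists>n. \<forall>m\<ge>n. N m \<inter> H = N n \<inter> H"
      by (rule acc_belowD[OF H(2)]) (use N(1,3) H(1) stable_Int in blast)+
    then obtain n where n: "\<And>m. m \<ge> n \<Longrightarrow> N m \<inter> H = N n \<inter> H" by blast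
    define t where "t = max n l"
    have "N m \<subseteq> N t" if m: "m \<ge> t" for m
    proof
      fix x assume x: "x \<in> N m"
      then obtain h c where hc: "x = h + c * v" "h \<in> H" "c \<in> K" using N(2) by blast
      have n0t: "n0 \<in> N t" using n0(1) mono[of l t] by (auto simp: t_def)
      have t: "c * (d * n0) \<in> N t" using n0t d(1) hc(3) stableD(5)[OF N(1)] by blast
      have "c * (d * n0) = c * (d * h0) + c * v"
        using d(2) by (simp add: h0(1) distrib_left mult.assoc[symmetric])
      then have "x - c * (d * n0) = h - c * (d * h0)" by (simp add: hc(1))
      then have "x - c * (d * n0) \<in> H"
        using hc(2,3) h0(2) d(1) stableD(3,5)[OF H(1)] by metis
      moreover have "x - c * (d * n0) \<in> N m"
        using x t mono[OF m] stableD(3)[OF N(1)] by blast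
      ultimately have "x - c * (d * n0) \<in> N t" using n[of m] n[of t] m by (auto simp: t_def)
      then have "x - c * (d * n0) + c * (d * n0) \<in> N t" using t stableD(4)[OF N(1)] by blast
      then show "x \<in> N t" by simp
    qed
    then show ?thesis using mono by blast
  qed
qed

lemma exists_acc_span:
  assumes K: "\<And>c. c \<in> K \<Longrightarrow> c \<noteq> 0 \<Longrightarrow> \<exists>d\<in>K. d * c = 1" "0 \<in> K" "1 \<in> K"
      "\<And>c d. c \<in> K \<Longrightarrow> d \<in> K \<Longrightarrow> c - d \<in> K" "\<And>c d. c \<in> K \<Longrightarrow> d \<in> K \<Longrightarrow> c * d \<in> K"
    and "finite V"
  shows "\<exists>H. V \<subseteq> H \<and> stable K H \<and> acc_below K H"
  using \<open>finite V\<close>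
proof (induction V rule: finite_induct)
  case empty
  have "stable K I" by (auto simp: stable_def diff_mem mult_left_mem)
  moreover have "acc_below K I"
    unfolding acc_below_def
  proof (intro allI impI)
    fix N :: "nat \<Rightarrow> 'r set"
    assume "\<forall>i. stable K (N i) \<and> N i \<subseteq> I \<and> N i \<subseteq> N (Suc i)"
    then have "N i = I" for i by (simp add: stable_def subset_antisym)
    then show "\<exists>n. \<forall>m\<ge>n. N m = N n" by simp
  qed
  ultimately show ?case by blast
next
  case (insert v V)
  then obtain H where H: "V \<subseteq> H" "stable K H" "acc_below K H" by blast
  define G where "G = {h + c * v | h c. h \<in> H \<and> c \<in> K}"
  have GI: "h + c * v \<in> G" if "h \<in> H" "c \<in> K" for h c using that by (auto simp: G_def)
  have HG: "H \<subseteq> G" using GI[OF _ K(2)] by auto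
  have "stable K G"
    unfolding stable_def
  proof (intro conjI ballI)
    show "I \<subseteq> G" using HG stableD(1)[OF H(2)] by blast
    fix x assume "x \<in> G"
    then obtain h c where x: "x = h + c * v" "h \<in> H" "c \<in> K" by (auto simp: G_def)
    { fix y assume "y \<in> G"
      then obtain h' c' where y: "y = h' + c' * v" "h' \<in> H" "c' \<in> K" by (auto simp: G_def)
      have "x - y = (h - h') + (c - c') * v" by (simp add: x y algebra_simps)
      then show "x - y \<in> G" using GI x y K(4) stableD(3)[OF H(2)] by metis }
    fix w assume w: "w \<in> K"
    have "w * x = w * h + (w * c) * v" by (simp add: x algebra_simps)
    then show "w * x \<in> G" using GI x w K(5) stableD(5)[OF H(2)] by metis
  qed
  moreover have "acc_below K G" unfolding G_def by (rule acc_below_add_vector[OF K(1) H(2,3)])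
  moreover have "insert v V \<subseteq> G" using HG H(1) GI[OF stableD(2)[OF H(2)] K(3)] by auto
  ultimately show ?case by blast
qed

text \<open>
  Modulo \<open>I\<close>, the polynomials in \<open>z\<close> of degree below \<open>i\<close> with coefficients in \<open>H\<close>.
\<close>

primrec poly_span :: "'r \<Rightarrow> 'r set \<Rightarrow> nat \<Rightarrow> 'r set" where
  "poly_span z H 0 = I"
| "poly_span z H (Suc i) = {x. \<exists>h\<in>H. x - z ^ i * h \<in> poly_span z H i}"

lemma power_commute_mod:
  assumes "z * w - w * z \<in> I"
  shows "z ^ i * w - w * z ^ i \<in> I"
proof (induction i)
  case (Suc i)
  have "z ^ Suc i * w - w * z ^ Suc i = z * (z ^ i * w - w * z ^ i) + (z * w - w * z) * z ^ i"
    by (simp add: algebra_simps)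
  then show ?case using Suc.IH assms add_mem mult_left_mem mult_right_mem by simp
qed (simp add: zero_mem)

lemma stable_poly_span:
  assumes H: "stable W H" and comm: "\<And>w. w \<in> W \<Longrightarrow> z * w - w * z \<in> I"
  shows "stable W (poly_span z H i)"
proof (induction i)
  case 0
  show ?case by (auto simp: stable_def diff_mem mult_left_mem)
next
  case (Suc i)
  note IH = stableD[OF Suc.IH]
  show ?case
    unfolding stable_def
  proof (intro conjI ballI)
    show "I \<subseteq> poly_span z H (Suc i)" using IH(1) stableD(2)[OF H] by (auto intro!: bexI[of _ 0])
    fix x assume "x \<in> poly_span z H (Suc i)"
    then obtain h where h: "h \<in> H" "x - z ^ i * h \<in> poly_span z H i" by auto
    { fix y assume "y \<in> poly_span z H (Suc i)"
      then obtain h' where h': "h' \<in> H" "y - z ^ i * h' \<in> poly_span z H i" by auto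
      have "x - y - z ^ i * (h - h') = (x - z ^ i * h) - (y - z ^ i * h')" by (simp add: algebra_simps)
      then have "x - y - z ^ i * (h - h') \<in> poly_span z H i" using h h' IH(3) by (simp only:)
      then show "x - y \<in> poly_span z H (Suc i)" using h h' stableD(3)[OF H] by auto }
    fix w assume w: "w \<in> W"
    have "w * x - z ^ i * (w * h) = w * (x - z ^ i * h) - (z ^ i * w - w * z ^ i) * h"
      by (simp add: algebra_simps)
    then have "w * x - z ^ i * (w * h) \<in> poly_span z H i"
      using IH(3)[OF IH(5)[OF w h(2)] IH(1)[OF mult_right_mem[OF power_commute_mod[OF comm[OF w]]]]] by simp
    then show "w * x \<in> poly_span z H (Suc i)" using h(1) w stableD(5)[OF H] by auto
  qed
qed

lemma poly_span_Suc:
  assumes "0 \<in> H"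
  shows "poly_span z H i \<subseteq> poly_span z H (Suc i)" "x \<in> poly_span z H i \<Longrightarrow> z * x \<in> poly_span z H (Suc i)"
proof -
  show sub: "poly_span z H i \<subseteq> poly_span z H (Suc i)" for i using assms by (auto intro: bexI[of _ 0])
  show "x \<in> poly_span z H i \<Longrightarrow> z * x \<in> poly_span z H (Suc i)"
  proof (induction i arbitrary: x)
    case 0
    then show ?case using sub[of 0] mult_left_mem by auto
  next
    case (Suc i)
    then obtain h where h: "h \<in> H" "x - z ^ i * h \<in> poly_span z H i" by auto
    then have "z * (x - z ^ i * h) \<in> poly_span z H (Suc i)" by (intro Suc.IH)
    moreover have "z * (x - z ^ i * h) = z * x - z ^ Suc i * h" by (simp add: algebra_simps)
    ultimately have "z * x - z ^ Suc i * h \<in> poly_span z H (Suc i)" by simp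
    then show ?case using h(1) by (simp del: power_Suc) blast
  qed
qed

lemma stable_Union_poly_span:
  assumes H: "stable W H" and comm: "\<And>w. w \<in> W \<Longrightarrow> z * w - w * z \<in> I"
  shows "stable (insert z W) (\<Union>i. poly_span z H i)" "H \<subseteq> (\<Union>i. poly_span z H i)"
proof -
  note S = stable_poly_span[OF H comm] and H0 = stableD(2)[OF H]
  have mono: "poly_span z H i \<subseteq> poly_span z H j" if "i \<le> j" for i j
    using poly_span_Suc(1)[OF H0] that by (rule lift_Suc_mono_le)
  show "stable (insert z W) (\<Union>i. poly_span z H i)"
    unfolding stable_def
  proof (intro conjI ballI)
    show "I \<subseteq> (\<Union>i. poly_span z H i)" using poly_span.simps(1) by blast
    fix x assume "x \<in> (\<Union>i. poly_span z H i)"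
    then obtain i where i: "x \<in> poly_span z H i" by blast
    { fix y assume "y \<in> (\<Union>i. poly_span z H i)"
      then obtain j where j: "y \<in> poly_span z H j" by blast
      have "x - y \<in> poly_span z H (max i j)"
        using i j mono[of i "max i j"] mono[of j "max i j"] by (intro stableD(3)[OF S]) auto
      then show "x - y \<in> (\<Union>i. poly_span z H i)" by blast }
    fix w assume "w \<in> insert z W"
    then show "w * x \<in> (\<Union>i. poly_span z H i)"
      using poly_span_Suc(2)[OF H0 i] stableD(5)[OF S _ i] by blast
  qed
  have "h \<in> poly_span z H 1" if "h \<in> H" for h
    using that zero_mem by (auto intro!: bexI[of _ h])
  then show "H \<subseteq> (\<Union>i. poly_span z H i)" by blast
qed

text \<open>
  Hilbert's basis theorem. The leading coefficients of the elements of \<open>N j\<close> that have degree at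
  most \<open>i\<close> form a subset \<open>T j i\<close> of \<open>H\<close>, which grows with \<open>j\<close> and, on multiplying by \<open>z\<close>, with \<open>i\<close>. When all
  of them have become stationary, so has \<open>N j\<close>, by induction on the degree.
\<close>

lemma acc_below_Union_poly_span:
  assumes H: "stable W H" "acc_below W H" and comm: "\<And>w. w \<in> W \<Longrightarrow> z * w - w * z \<in> I"
  shows "acc_below (insert z W) (\<Union>i. poly_span z H i)"
  unfolding acc_below_def
proof (intro allI impI)
  fix N :: "nat \<Rightarrow> 'r set"
  assume "\<forall>i. stable (insert z W) (N i) \<and> N i \<subseteq> (\<Union>i. poly_span z H i) \<and> N i \<subseteq> N (Suc i)"
  then have N: "\<And>i. stable (insert z W) (N i)" "\<And>i. N i \<subseteq> (\<Union>i. poly_span z H i)" "\<And>i. N i \<subseteq> N (Suc i)"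
    by blast+
  note ND = stableD[OF N(1)] and HD = stableD[OF H(1)]
  have "stable W (poly_span z H i)" for i by (rule stable_poly_span[OF H(1) comm])
  note S = stableD[OF this]
  define T where "T j i = {h \<in> H. \<exists>y\<in>N j. y - z ^ i * h \<in> poly_span z H i}" for j i
  have "\<exists>s. \<forall>j\<ge>s. \<forall>i. T j i = T s i"
  proof (rule double_chain_stabilises[OF superset_order, where P = "\<lambda>N. stable W N \<and> N \<subseteq> H"])
    show "stable W (T j i) \<and> T j i \<subseteq> H" for j i
      unfolding stable_def
    proof (intro conjI ballI)
      show "I \<subseteq> T j i"
      proof
        fix h assume h: "h \<in> I"
        then have "0 - z ^ i * h \<in> poly_span z H i" by (intro S(1) diff_mem zero_mem mult_left_mem)
        then show "h \<in> T j i" unfolding T_def using HD(1)[OF h] ND(2)[of j] by blast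
      qed
      fix h assume "h \<in> T j i"
      then obtain y where y: "h \<in> H" "y \<in> N j" "y - z ^ i * h \<in> poly_span z H i" by (auto simp: T_def)
      { fix h' assume "h' \<in> T j i"
        then obtain y' where y': "h' \<in> H" "y' \<in> N j" "y' - z ^ i * h' \<in> poly_span z H i" by (auto simp: T_def)
        have "y - y' - z ^ i * (h - h') = (y - z ^ i * h) - (y' - z ^ i * h')" by (simp add: algebra_simps)
        then have "y - y' - z ^ i * (h - h') \<in> poly_span z H i" using y y' S(3) by (simp only:)
        then show "h - h' \<in> T j i" using y y' HD(3) ND(3) by (auto simp: T_def) }
      fix w assume w: "w \<in> W"
      have "w * y - z ^ i * (w * h) = w * (y - z ^ i * h) - (z ^ i * w - w * z ^ i) * h"
        by (simp add: algebra_simps)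
      then have "w * y - z ^ i * (w * h) \<in> poly_span z H i"
        using S(3)[OF S(5)[OF w y(3)] S(1)[OF mult_right_mem[OF power_commute_mod[OF comm[OF w]]]]] by simp
      then show "w * h \<in> T j i" using y w HD(5) ND(5) by (auto simp: T_def)
    qed (auto simp: T_def)
    show "T j i \<subseteq> T (Suc j) i" for j i using N(3)[of j] by (auto simp: T_def)
    show "T j i \<subseteq> T j (Suc i)" for j i
    proof
      fix h assume "h \<in> T j i"
      then obtain y where y: "h \<in> H" "y \<in> N j" "y - z ^ i * h \<in> poly_span z H i" by (auto simp: T_def)
      have "z * (y - z ^ i * h) \<in> poly_span z H (Suc i)" using poly_span_Suc(2)[OF HD(2) y(3)] .
      moreover have "z * (y - z ^ i * h) = z * y - z ^ Suc i * h" by (simp add: algebra_simps)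
      ultimately have "z * y - z ^ Suc i * h \<in> poly_span z H (Suc i)" by (simp only:)
      moreover have "z * y \<in> N j" using ND(5)[of z] y(2) by blast
      ultimately show "h \<in> T j (Suc i)" using y(1) unfolding T_def by blast
    qed
    show "\<exists>n. \<forall>m\<ge>n. Y m = Y n"
      if "\<And>i. stable W (Y i) \<and> Y i \<subseteq> H" "\<And>i. Y i \<subseteq> Y (Suc i)" for Y :: "nat \<Rightarrow> 'r set"
      using acc_belowD[OF H(2), of Y] that by blast
  qed
  then obtain s where s: "\<And>j i. j \<ge> s \<Longrightarrow> T j i = T s i" by blast
  have "N j = N s" if j: "j \<ge> s" for j
  proof
    show sub: "N s \<subseteq> N j" using N(3) j by (rule lift_Suc_mono_le)
    have "x \<in> N s" if "x \<in> N j" "x \<in> poly_span z H i" for x i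
      using that
    proof (induction i arbitrary: x)
      case 0
      then show ?case using ND(1) by simp
    next
      case (Suc i)
      then obtain h where h: "h \<in> H" "x - z ^ i * h \<in> poly_span z H i" by auto
      then have "h \<in> T j i" using Suc.prems(1) by (auto simp: T_def)
      then have "h \<in> T s i" using s[OF j] by blast
      then obtain y where y: "y \<in> N s" "y - z ^ i * h \<in> poly_span z H i" by (auto simp: T_def)
      have "x - y = (x - z ^ i * h) - (y - z ^ i * h)" by simp
      then have "x - y \<in> poly_span z H i" using h(2) y(2) S(3) by metis
      moreover have "x - y \<in> N j" using Suc.prems(1) y(1) sub ND(3) by blast
      ultimately have "x - y \<in> N s" by (intro Suc.IH)
      then have "x - y + y \<in> N s" using y(1) ND(4) by blast
      then show ?case by simp
    qed
    then show "N j \<subseteq> N s" using N(2) by blast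
  qed
  then show "\<exists>n. \<forall>m\<ge>n. N m = N n" by blast
qed

lemma exists_acc_extension:
  assumes "finite Z" and central: "\<And>z f. z \<in> Z \<Longrightarrow> z * f - f * z \<in> I" and "stable W H" "acc_below W H"
  shows "\<exists>G. H \<subseteq> G \<and> stable (Z \<union> W) G \<and> acc_below (Z \<union> W) G"
  using assms(1,2)
proof (induction Z rule: finite_induct)
  case empty
  then show ?case using assms(3,4) by auto
next
  case (insert z Z)
  then obtain G where G: "H \<subseteq> G" "stable (Z \<union> W) G" "acc_below (Z \<union> W) G" by auto
  have comm: "z * w - w * z \<in> I" for w using insert.prems by simp
  show ?case
    using stable_Union_poly_span[OF G(2) comm] acc_below_Union_poly_span[OF G(2,3) comm] G(1)
    by (intro exI[of _ "\<Union>i. poly_span z G i"]) auto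
qed

end


section \<open>The free algebra\<close>

abbreviation free_mono :: "'a list \<Rightarrow> ('a, 'k::field) free_algebra"
  where "free_mono xs \<equiv> prod_list (map free_gen xs)"

lemma free_mono_eq_single: "free_mono xs = Poly_Mapping.single (Free_Word xs) (1 :: 'k::field)"
proof (induction xs)
  case Nil
  show ?case by (simp flip: single_one add: zero_free_word_def)
next
  case (Cons x xs)
  have "free_mono (x # xs) = Poly_Mapping.single (Free_Word [x]) (1 :: 'k) * Poly_Mapping.single (Free_Word xs) 1"
    by (simp add: Cons.IH) (simp add: free_gen_def)
  then show ?case by (simp add: mult_single plus_free_word_def)
qed

lemma free_const_mult_mono: "free_const c * free_mono xs = Poly_Mapping.single (Free_Word xs) c"
  unfolding free_mono_eq_single by (simp add: free_const_def mult_single)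

lemma free_algebra_induct [case_names const_mult add]:
  assumes "\<And>c xs. P (free_const c * free_mono xs)" and "\<And>f g. P f \<Longrightarrow> P g \<Longrightarrow> P (f + g)"
  shows "P f"
proof (induction f rule: update_induct)
  case const
  show ?case using assms(1)[of 0] by (simp add: free_const_def)
next
  case (update f w c)
  have "Poly_Mapping.update w c f = f + Poly_Mapping.single w c"
    using update.hyps(1)
    by (intro poly_mapping_eqI) (auto simp: lookup_update lookup_add lookup_single when_def in_keys_iff)
  moreover have "P (Poly_Mapping.single w c)"
    using assms(1)[of c "letters w"] by (simp add: free_const_mult_mono)
  ultimately show ?case using update.IH assms(2) by simp
qed

lemma free_const_simps:
  "free_const 0 = 0" "free_const 1 = 1"
  "free_const c * free_const d = free_const (c * d)" "free_const c - free_const d = free_const (c - d)"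
  by (simp_all add: free_const_def mult_single single_diff)

lemma free_const_commute: "free_const c * f = f * free_const c"
proof (induction f rule: free_algebra_induct)
  case (const_mult d xs)
  show ?case unfolding free_const_mult_mono by (simp add: free_const_def mult_single mult.commute)
qed (simp add: algebra_simps)

lemma of_nat_CHAR_free_algebra: "of_nat CHAR('k) = (0 :: ('a, 'k::field) free_algebra)"
  using single_of_nat[of "CHAR('k)", where 'a = "'a free_word" and 'b = 'k] by simp


section \<open>The enveloping algebra is a noetherian module over its centre\<close>

locale enveloping_ideal = lie_algebra scale bracket + two_sided_ideal I
  for scale :: "'k::field \<Rightarrow> 'a::ab_group_add \<Rightarrow> 'a" and bracket
    and I :: "('a, 'k) free_algebra set" +
  assumes relations: "uea_relations scale bracket \<subseteq> I"
begin

lemma gen_add: "free_gen (x + y) - (free_gen x + free_gen y) \<in> I"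
  and gen_scale: "free_gen (scale c x) - free_const c * free_gen x \<in> I"
  and gen_bracket: "commutator (free_gen x) (free_gen y) - free_gen (bracket x y) \<in> I"
  by (rule subsetD[OF relations], unfold uea_relations_def commutator_def, blast)+

lemma gen_zero: "free_gen 0 \<in> I"
  using uminus_mem[OF gen_add[of 0 0]] by simp

lemma gen_sum: "finite A \<Longrightarrow> free_gen (\<Sum>i\<in>A. scale (c i) (x i)) - (\<Sum>i\<in>A. free_const (c i) * free_gen (x i)) \<in> I"
proof (induction A rule: finite_induct)
  case empty
  then show ?case using gen_zero by simp
next
  case (insert i A)
  have "free_gen (scale (c i) (x i) + (\<Sum>i\<in>A. scale (c i) (x i))) -
      (free_const (c i) * free_gen (x i) + (\<Sum>i\<in>A. free_const (c i) * free_gen (x i))) =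
    (free_gen (scale (c i) (x i) + (\<Sum>i\<in>A. scale (c i) (x i))) -
      (free_gen (scale (c i) (x i)) + free_gen (\<Sum>i\<in>A. scale (c i) (x i)))) +
    ((free_gen (scale (c i) (x i)) - free_const (c i) * free_gen (x i)) +
     (free_gen (\<Sum>i\<in>A. scale (c i) (x i)) - (\<Sum>i\<in>A. free_const (c i) * free_gen (x i))))"
    by (simp add: algebra_simps)
  also have "\<dots> \<in> I"
    by (intro add_mem gen_add gen_scale insert.IH)
  finally show ?case using insert.hyps by simp
qed

lemma commutator_funpow_gen:
  "(commutator (free_gen x) ^^ n) (free_gen y) - free_gen ((bracket x ^^ n) y) \<in> I"
proof (induction n)
  case (Suc n)
  define f g :: "('a, 'k) free_algebra"
    where "f = (commutator (free_gen x) ^^ n) (free_gen y)" and "g = free_gen ((bracket x ^^ n) y)"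
  have "commutator (free_gen x) f - free_gen (bracket x ((bracket x ^^ n) y)) =
      free_gen x * (f - g) - (f - g) * free_gen x +
      (commutator (free_gen x) g - free_gen (bracket x ((bracket x ^^ n) y)))"
    by (simp add: commutator_def algebra_simps)
  also have "\<dots> \<in> I"
    unfolding g_def
    by (intro add_mem diff_mem mult_left_mem mult_right_mem gen_bracket Suc.IH[folded f_def])
  finally show ?case by (simp add: f_def)
qed (simp add: zero_mem)

lemma central_mod:
  assumes "\<And>y. commutator z (free_gen y) \<in> I"
  shows "commutator z f \<in> I"
proof (induction f rule: free_algebra_induct)
  case (const_mult c xs)
  have "commutator z (free_mono xs) \<in> I"
  proof (induction xs)
    case Nil
    show ?case by (simp add: commutator_def zero_mem)
  next
    case (Cons x xs)
    have "commutator z (free_mono (x # xs)) =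
        commutator z (free_gen x) * free_mono xs + free_gen x * commutator z (free_mono xs)"
      by (simp add: commutator_def algebra_simps)
    then show ?case using Cons assms add_mem mult_left_mem mult_right_mem by simp
  qed
  moreover have "commutator z (free_const c * free_mono xs) = free_const c * commutator z (free_mono xs)"
    by (simp add: commutator_def right_diff_distrib mult.assoc[symmetric] free_const_commute[of c z])
  ultimately show ?case using mult_left_mem by simp
next
  case (add f g)
  have "commutator z (f + g) = commutator z f + commutator z g"
    by (simp add: commutator_def algebra_simps)
  then show ?case using add add_mem by simp
qed

text \<open>
  The value at \<open>x\<close> of one of the linearised polynomials of positive characteristic, in which only
  \<open>p\<close>-power exponents occur.
\<close>

definition p_polynomial :: "(nat \<Rightarrow> 'k) \<Rightarrow> nat \<Rightarrow> 'a \<Rightarrow> ('a, 'k) free_algebra"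
  where "p_polynomial c m x = (\<Sum>i\<le>m. free_const (c i) * free_gen x ^ (CHAR('k) ^ i))"

text \<open>
  In characteristic \<open>p\<close> the commutator with \<open>x^(p^i)\<close> is the iterated commutator with \<open>x\<close>, which acts on
  the Lie algebra as the iterated bracket.
\<close>

lemma p_polynomial_central:
  assumes p: "Factorial_Ring.prime CHAR('k)"
    and zero: "\<And>y. (\<Sum>i\<le>m. scale (c i) ((bracket x ^^ (CHAR('k) ^ i)) y)) = 0"
  shows "commutator (p_polynomial c m x) f \<in> I"
proof (rule central_mod)
  fix y
  let ?p = "CHAR('k)"
  define a where "a i = (commutator (free_gen x) ^^ (?p ^ i)) (free_gen y :: ('a, 'k) free_algebra)" for i
  define g :: "nat \<Rightarrow> ('a, 'k) free_algebra" where "g i = free_gen ((bracket x ^^ (?p ^ i)) y)" for i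
  have a: "a i = commutator (free_gen x ^ (?p ^ i)) (free_gen y)" for i
    unfolding a_def by (simp add: commutator_funpow_prime_power[OF p of_nat_CHAR_free_algebra])
  have "commutator (p_polynomial c m x) (free_gen y) = (\<Sum>i\<le>m. free_const (c i) * a i)"
    unfolding p_polynomial_def a commutator_def sum_distrib_left sum_distrib_right sum_subtractf[symmetric]
    by (intro sum.cong refl)
       (simp add: right_diff_distrib mult.assoc[symmetric] free_const_commute[of _ "free_gen y"])
  also have "\<dots> = (\<Sum>i\<le>m. free_const (c i) * (a i - g i)) +
      (free_gen 0 - (free_gen (\<Sum>i\<le>m. scale (c i) ((bracket x ^^ (?p ^ i)) y)) - (\<Sum>i\<le>m. free_const (c i) * g i)))"
    by (simp add: zero right_diff_distrib sum_subtractf)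
  also have "\<dots> \<in> I"
    unfolding a_def g_def
    by (intro add_mem diff_mem sum_mem mult_left_mem commutator_funpow_gen gen_zero gen_sum) simp
  finally show "commutator (p_polynomial c m x) (free_gen y) \<in> I" .
qed

abbreviation constants :: "('a, 'k) free_algebra set"
  where "constants \<equiv> range free_const"

text \<open>
  Exchanging two neighbouring letters changes a word by a word with one letter less, in which
  their bracket is a letter. This is why \<open>short\<close> speaks of words in arbitrary elements of the Lie
  algebra.
\<close>

lemma swap_mem:
  assumes G: "stable W G" and short: "\<And>xs. length xs < d \<Longrightarrow> free_mono xs \<in> G"
    and "length (u @ x # v) \<le> d"
  shows "free_mono (u @ x # v) - free_mono (x # u @ v) \<in> G"
  using assms(3)
proof (induction u arbitrary: v rule: rev_induct)
  case Nil
  show ?case using stableD(2)[OF G] by simp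
next
  case (snoc a u)
  have "commutator (free_gen a) (free_gen x) - free_gen (bracket a x) \<in> I" by (rule gen_bracket)
  then have "free_mono u * (commutator (free_gen a) (free_gen x) - free_gen (bracket a x)) * free_mono v \<in> G"
    by (intro stableD(1)[OF G] mult_left_mem mult_right_mem)
  moreover have "free_mono (u @ bracket a x # v) \<in> G"
    using snoc.prems by (intro short) simp
  ultimately have "free_mono u * (commutator (free_gen a) (free_gen x) - free_gen (bracket a x)) * free_mono v +
      free_mono (u @ bracket a x # v) \<in> G"
    by (rule stableD(4)[OF G])
  moreover have "free_mono (u @ x # a # v) - free_mono (x # u @ a # v) \<in> G"
    using snoc.prems by (intro snoc.IH) simp
  ultimately have "(free_mono u * (commutator (free_gen a) (free_gen x) - free_gen (bracket a x)) * free_mono v +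
      free_mono (u @ bracket a x # v)) + (free_mono (u @ x # a # v) - free_mono (x # u @ a # v)) \<in> G"
    by (rule stableD(4)[OF G])
  then show ?case by (simp add: commutator_def algebra_simps)
qed

lemma gather_mem:
  assumes G: "stable W G" and short: "\<And>xs. length xs < d \<Longrightarrow> free_mono xs \<in> G"
    and xs: "length xs \<le> d" and "q \<le> count_list xs b"
  shows "\<exists>ys. length ys + q = length xs \<and> count_list ys b + q = count_list xs b \<and>
    free_mono xs - free_mono (replicate q b @ ys) \<in> G"
  using assms(4)
proof (induction q)
  case 0
  show ?case using stableD(2)[OF G] by (intro exI[of _ xs]) simp
next
  case (Suc q)
  then obtain ys where ys: "length ys + q = length xs" "count_list ys b + q = count_list xs b"
    "free_mono xs - free_mono (replicate q b @ ys) \<in> G" by auto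
  then have "count_list ys b \<noteq> 0" using Suc.prems by simp
  then have "b \<in> set ys" by (metis count_list_0_iff)
  then obtain u v where uv: "ys = u @ b # v" by (auto dest: split_list)
  have "free_mono ((replicate q b @ u) @ b # v) - free_mono (b # (replicate q b @ u) @ v) \<in> G"
    using ys(1) xs by (intro swap_mem[OF G short]) (auto simp: uv)
  then have "(free_mono xs - free_mono (replicate q b @ ys)) +
      (free_mono (replicate q b @ ys) - free_mono (replicate (Suc q) b @ u @ v)) \<in> G"
    using ys(3) by (intro stableD(4)[OF G]) (simp_all add: uv)
  then show ?case using ys(1,2) by (intro exI[of _ "u @ v"]) (simp add: uv)
qed

text \<open>
  A word is linear in each of its letters, so these can be replaced by basis letters one at a time.
\<close>

lemma letters_in_span:
  assumes G: "stable W G" "constants \<subseteq> W"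
    and B: "\<And>xs. set xs \<subseteq> B \<Longrightarrow> length xs = d \<Longrightarrow> free_mono xs \<in> G" and span: "\<And>x. x \<in> span B"
    and "set ys \<subseteq> B" "length ys + length xs = d"
  shows "free_mono (ys @ xs) \<in> G"
  using assms(5,6)
proof (induction xs arbitrary: ys)
  case Nil
  then show ?case using B by simp
next
  case (Cons x xs)
  note GD = stableD[OF G(1)]
  show ?case
    using span[of x]
  proof (induction x rule: span_induct_alt)
    case base
    have "free_mono ys * free_gen 0 * free_mono xs \<in> I"
      by (intro mult_right_mem mult_left_mem gen_zero)
    then show ?case using GD(1) by (simp add: mult.assoc)
  next
    case (step c b y)
    have "free_mono ((ys @ [b]) @ xs) \<in> G"
      using Cons.prems step(1) by (intro Cons.IH) auto
    then have b: "free_const c * free_mono (ys @ b # xs) \<in> G"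
      using GD(5)[of "free_const c"] G(2) by auto
    define r where "r = (free_gen (scale c b + y) - (free_gen (scale c b) + free_gen y)) +
      (free_gen (scale c b) - free_const c * free_gen b)"
    have "r \<in> I" unfolding r_def by (intro add_mem gen_add gen_scale)
    then have "free_mono ys * r * free_mono xs \<in> G"
      by (intro GD(1) mult_right_mem mult_left_mem)
    then have "free_mono ys * r * free_mono xs + (free_const c * free_mono (ys @ b # xs) + free_mono (ys @ y # xs)) \<in> G"
      by (intro GD(4) b step(2))
    moreover have "free_mono ys * r * free_mono xs = free_mono ys * free_gen (scale c b + y) * free_mono xs
        - free_mono ys * free_gen y * free_mono xs - free_mono ys * (free_const c * free_gen b) * free_mono xs"
      by (simp add: r_def algebra_simps)
    moreover have "free_mono ys * (free_const c * free_gen b) * free_mono xs = free_const c * free_mono (ys @ b # xs)"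
      using free_const_commute[of c "free_mono ys"] by (simp add: mult.assoc[symmetric])
    ultimately show ?case by (simp add: mult.assoc)
  qed
qed

text \<open>
  Induction on the length of words. Words in arbitrary letters reduce to words in basis letters. In a
  long word some basis letter \<open>b\<close> occurs at least \<open>p^(m b)\<close> times. Moving these occurrences to the front and
  replacing their product by the \<open>p\<close>-polynomial of \<open>b\<close> changes the word only by shorter ones, and the
  \<open>p\<close>-polynomial, which belongs to \<open>W\<close>, multiplies a shorter word.
\<close>

lemma p_polynomials_generate:
  assumes char: "CHAR('k) > 0" and B: "finite B" "\<And>x. x \<in> span B" and monic: "\<And>b. b \<in> B \<Longrightarrow> c b (m b) = 1"
    and G: "stable W G" "constants \<subseteq> W" "(\<lambda>b. p_polynomial (c b) (m b) b) ` B \<subseteq> W"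
    and short: "\<And>xs. set xs \<subseteq> B \<Longrightarrow> length xs \<le> (\<Sum>b\<in>B. CHAR('k) ^ m b) \<Longrightarrow> free_mono xs \<in> G"
  shows "G = UNIV"
proof -
  note GD = stableD[OF G(1)]
  let ?p = "CHAR('k)"
  have mono: "free_mono xs \<in> G" for xs
  proof (induction "length xs" arbitrary: xs rule: less_induct)
    case less
    define d where "d = length xs"
    have IH: "free_mono ys \<in> G" if "length ys < d" for ys
      using less that by (simp add: d_def)
    have "free_mono ys \<in> G" if ys: "set ys \<subseteq> B" "length ys = d" for ys
    proof (cases "d \<le> (\<Sum>b\<in>B. ?p ^ m b)")
      case True
      then show ?thesis using short ys by simp
    next
      case False
      have "\<exists>b\<in>B. count_list ys b \<ge> ?p ^ m b"
      proof (rule ccontr)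
        assume "\<not> ?thesis"
        then have "(\<Sum>b\<in>B. count_list ys b) \<le> (\<Sum>b\<in>B. ?p ^ m b)"
          by (intro sum_mono) (meson nat_le_linear)
        then show False using False sum_count_set[OF ys(1) B(1)] ys(2) by simp
      qed
      then obtain b where b: "b \<in> B" "?p ^ m b \<le> count_list ys b" by blast
      define q where "q = ?p ^ m b"
      have q: "q > 0" using char by (simp add: q_def)
      obtain zs where zs: "length zs + q = length ys" "free_mono ys - free_mono (replicate q b @ zs) \<in> G"
        using gather_mem[OF G(1), of d ys q b] IH ys b(2) by (auto simp: q_def)
      have power_mono: "free_gen b ^ k * free_mono zs = free_mono (replicate k b @ zs)" for k
        by (simp add: prod_list_replicate)
      have "free_mono zs \<in> G" using zs(1) ys(2) q by (intro IH) simp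
      then have top: "p_polynomial (c b) (m b) b * free_mono zs \<in> G"
        using G(3) b(1) by (intro GD(5)) auto
      have "free_const (c b i) * free_mono (replicate (?p ^ i) b @ zs) \<in> G" if "i < m b" for i
      proof -
        have "1 < ?p" using char CHAR_not_1' by (metis One_nat_def Suc_lessI)
        then have "?p ^ i < q" using that by (simp add: q_def)
        then have "free_mono (replicate (?p ^ i) b @ zs) \<in> G" using zs(1) ys(2) by (intro IH) simp
        then show ?thesis using G(2) by (intro GD(5)) auto
      qed
      then have lower: "(\<Sum>i<m b. free_const (c b i) * free_mono (replicate (?p ^ i) b @ zs)) \<in> G"
        by (intro stable_sum[OF G(1)]) simp
      have "p_polynomial (c b) (m b) b * free_mono zs =
          (\<Sum>i<m b. free_const (c b i) * free_mono (replicate (?p ^ i) b @ zs)) + free_mono (replicate q b @ zs)"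
        unfolding p_polynomial_def power_mono[symmetric] lessThan_Suc_atMost[symmetric]
        by (simp add: monic[OF b(1)] free_const_simps q_def distrib_right sum_distrib_right mult.assoc)
      then have "free_mono (replicate q b @ zs) \<in> G"
        using GD(3)[OF top lower] by simp
      then have "(free_mono ys - free_mono (replicate q b @ zs)) + free_mono (replicate q b @ zs) \<in> G"
        using zs(2) by (intro GD(4))
      then show ?thesis by simp
    qed
    then show ?case
      using letters_in_span[OF G(1,2), of B d "[]" xs] B(2) by (simp add: d_def)
  qed
  have "f \<in> G" for f
  proof (induction f rule: free_algebra_induct)
    case (const_mult c xs)
    then show ?case using mono G(2) by (intro GD(5)) auto
  qed (rule GD(4))
  then show ?thesis by blast
qed

text \<open>
  In coordinates an endomorphism of an \<open>n\<close>-dimensional space has \<open>n\<^sup>2\<close> entries, so any \<open>n\<^sup>2 + 1\<close> of the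
  iterates of \<open>bracket x\<close> are linearly dependent. Dividing by the last nonzero coefficient makes the
  relation monic.
\<close>

lemma exists_p_polynomial:
  fixes q :: "nat \<Rightarrow> nat"
  assumes "finite_dimensional_vector_space scale Basis"
  shows "\<exists>c m. c m = 1 \<and> (\<forall>y. (\<Sum>i\<le>m. scale (c i) ((bracket x ^^ q i) y)) = 0)"
proof -
  interpret fd: finite_dimensional_vector_space scale Basis by fact
  note fin = fd.finite_Basis and indep = fd.independent_Basis and UNIV = fd.span_Basis
  define n where "n = card (Basis \<times> Basis)"
  define v where "v i = (\<lambda>(y, b). representation Basis ((bracket x ^^ q i) y) b)" for i
  have "card (Basis \<times> Basis) < card {..n}" by (simp add: n_def)
  then obtain c where c: "\<exists>i\<in>{..n}. c i \<noteq> 0" "\<forall>l\<in>Basis \<times> Basis. (\<Sum>i\<in>{..n}. c i * v i l) = 0"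
    using homogeneous_system_solution[of "Basis \<times> Basis" "{..n}" v] fin by blast
  define m where "m = Max {i. i \<le> n \<and> c i \<noteq> 0}"
  have "m \<in> {i. i \<le> n \<and> c i \<noteq> 0}" unfolding m_def using c(1) by (intro Max_in) auto
  then have m: "m \<le> n" "c m \<noteq> 0" by auto
  have above: "c i = 0" if "m < i" "i \<le> n" for i
  proof (rule ccontr)
    assume "c i \<noteq> 0"
    then have "i \<le> m" unfolding m_def using that by (intro Max_ge) auto
    then show False using that by simp
  qed
  define S where "S y = (\<Sum>i\<le>n. scale (c i) ((bracket x ^^ q i) y))" for y
  have pow_add: "(bracket x ^^ k) (y + z) = (bracket x ^^ k) y + (bracket x ^^ k) z" for k y z
    by (induction k) (auto simp: bracket_add_right)
  have pow_scale: "(bracket x ^^ k) (scale r y) = scale r ((bracket x ^^ k) y)" for k r y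
    by (induction k) (auto simp: bracket_scale_right)
  have S_add: "S (y + z) = S y + S z" for y z
    by (simp add: S_def pow_add scale_right_distrib sum.distrib)
  have S_scale: "S (scale r y) = scale r (S y)" for r y
    by (simp add: S_def pow_scale scale_sum_right mult.commute)
  have in_span: "z \<in> span Basis" for z using UNIV by simp
  have S_Basis: "S y = 0" if y: "y \<in> Basis" for y
  proof -
    have "representation Basis (S y) b = 0" for b
    proof (cases "b \<in> Basis")
      case True
      have "representation Basis (S y) b = (\<Sum>i\<le>n. c i * v i (y, b))"
        unfolding S_def v_def
        by (simp add: representation_sum[OF indep] representation_scale[OF indep] in_span)
      then show ?thesis using c(2) y True by simp
    next
      case False
      then show ?thesis using representation_ne_zero by blast
    qed
    then show ?thesis
      using sum_nonzero_representation_eq[OF indep in_span, of "S y"] by simp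
  qed
  have S_zero: "S y = 0" for y
    using in_span[of y]
  proof (induction y rule: span_induct_alt)
    case base
    show ?case using S_scale[of 0 0] by simp
  next
    case (step r b z)
    then show ?case by (simp add: S_add S_scale S_Basis)
  qed
  have "(\<Sum>i\<le>m. scale (c i / c m) ((bracket x ^^ q i) y)) = 0" for y
  proof -
    have "S y = (\<Sum>i\<le>m. scale (c i) ((bracket x ^^ q i) y))"
      unfolding S_def using m(1) above by (intro sum.mono_neutral_right) auto
    then have "scale (1 / c m) (\<Sum>i\<le>m. scale (c i) ((bracket x ^^ q i) y)) = 0"
      using S_zero by simp
    then show ?thesis by (simp add: scale_sum_right)
  qed
  then show ?thesis using m(2) by (intro exI[of _ "\<lambda>i. c i / c m"] exI[of _ m]) simp
qed

text \<open>
  The set \<open>W\<close> consists of the constants and one \<open>p\<close>-polynomial for each basis element. The span of the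
  finitely many short words satisfies the chain condition over the constants, and adjoining the
  \<open>p\<close>-polynomials one by one extends it to the whole algebra.
\<close>

theorem exists_central_set_acc:
  assumes fd: "\<exists>Basis. finite_dimensional_vector_space scale Basis" and p: "Factorial_Ring.prime CHAR('k)"
  shows "\<exists>W. (\<forall>w\<in>W. \<forall>f. commutator w f \<in> I) \<and> acc_below W UNIV"
proof -
  obtain B where B: "finite_dimensional_vector_space scale B" using fd by blast
  interpret fd: finite_dimensional_vector_space scale B by fact
  obtain c m where cm: "\<And>x. c x (m x) = 1"
    "\<And>x y. (\<Sum>i\<le>m x. scale (c x i) ((bracket x ^^ (CHAR('k) ^ i)) y)) = 0"
    using exists_p_polynomial[OF B, where q = "\<lambda>i. CHAR('k) ^ i"] by metis
  define Z where "Z = (\<lambda>b. p_polynomial (c b) (m b) b) ` B"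
  have Z: "commutator z f \<in> I" if "z \<in> Z" for z f
    using that p_polynomial_central[OF p cm(2)] by (auto simp: Z_def)
  have finite_Z: "finite Z" using fd.finite_Basis by (simp add: Z_def)
  define V :: "('a, 'k) free_algebra set" where
    "V = free_mono ` {xs. set xs \<subseteq> B \<and> length xs \<le> (\<Sum>b\<in>B. CHAR('k) ^ m b)}"
  have finite_V: "finite V"
    unfolding V_def using finite_lists_length_le[OF fd.finite_Basis] by simp
  obtain H where H: "V \<subseteq> H" "stable constants H" "acc_below constants H"
  proof -
    have "\<exists>H. V \<subseteq> H \<and> stable constants H \<and> acc_below constants H"
    proof (rule exists_acc_span[OF _ _ _ _ _ finite_V])
      show "\<exists>d\<in>constants. d * k = 1" if k: "k \<in> constants" "k \<noteq> 0" for k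
      proof -
        obtain r where r: "k = free_const r" using k(1) by blast
        then have "r \<noteq> 0" using k(2) by (auto simp: free_const_simps)
        then have "free_const (inverse r) * k = 1" by (simp add: r free_const_simps)
        then show ?thesis by blast
      qed
      show "0 \<in> constants" "1 \<in> constants" by (metis free_const_simps(1,2) rangeI)+
    qed (auto simp: free_const_simps)
    then show ?thesis using that by blast
  qed
  obtain G where G: "H \<subseteq> G" "stable (Z \<union> constants) G" "acc_below (Z \<union> constants) G"
    using exists_acc_extension[OF finite_Z _ H(2,3)] Z by (auto simp: commutator_def)
  have "G = UNIV"
  proof (rule p_polynomials_generate[where c = c and m = m and B = B and W = "Z \<union> constants"])
    show "finite B" by (rule fd.finite_Basis)
    show "c b (m b) = 1" for b by (rule cm(1))
    show "stable (Z \<union> constants) G" by (rule G(2))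
    show "CHAR('k) > 0" using p prime_gt_0_nat by blast
    show "x \<in> span B" for x using fd.span_Basis by simp
  qed (use G(1) H(1) in \<open>auto simp: Z_def V_def\<close>)
  moreover have "commutator w f \<in> I" if "w \<in> Z \<union> constants" for w f
    using that Z by (auto simp: commutator_def free_const_commute[of _ f] zero_mem)
  ultimately show ?thesis using G(3) by blast
qed

end


text \<open>
  Submodules of the enveloping algebra over its centre correspond to their preimages in the free
  algebra, which are stable under every element that is central modulo the defining ideal.
\<close>

lemma noetherian_over_center_universal_enveloping_algebra:
  fixes scale :: "'k::field \<Rightarrow> 'a::ab_group_add \<Rightarrow> 'a"
  assumes lie: "lie_algebra scale bracket" and fd: "\<exists>Basis. finite_dimensional_vector_space scale Basis"
    and p: "Factorial_Ring.prime CHAR('k)"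
  shows "noetherian_over_center (universal_enveloping_algebra scale bracket)"
proof -
  define F :: "('a, 'k) free_algebra ring" where "F = ring_of_type_algebra"
  define I where "I = genideal F (uea_relations scale bracket)"
  interpret F: ring F unfolding F_def by (rule ring_ring_of_type_algebra)
  have F_simps: "carrier F = UNIV" "\<zero>\<^bsub>F\<^esub> = 0" "x \<oplus>\<^bsub>F\<^esub> y = x + y" "x \<otimes>\<^bsub>F\<^esub> y = x * y" for x y
    by (simp_all add: F_def ring_of_type_algebra_def)
  interpret I: ideal I F
    unfolding I_def by (rule F.genideal_ideal) (simp add: F_simps)
  interpret I: enveloping_ideal scale bracket I
  proof (intro enveloping_ideal.intro lie two_sided_ideal.intro enveloping_ideal_axioms.intro)
    show "0 \<in> I" using I.zero_closed by (simp add: F_simps)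
    show "x \<in> I \<Longrightarrow> y \<in> I \<Longrightarrow> x + y \<in> I" for x y using I.a_closed[of x y] by (simp add: F_simps)
    show "x \<in> I \<Longrightarrow> r * x \<in> I" for x r using I.I_l_closed[of x r] by (simp add: F_simps)
    show "x \<in> I \<Longrightarrow> x * r \<in> I" for x r using I.I_r_closed[of x r] by (simp add: F_simps)
    show "uea_relations scale bracket \<subseteq> I"
      unfolding I_def by (rule F.genideal_self) (simp add: F_simps)
  qed
  define U where "U = universal_enveloping_algebra scale bracket"
  have U: "U = F Quot I" by (simp add: U_def universal_enveloping_algebra_def F_def I_def)
  interpret U: ring U unfolding U_def by (rule ring_universal_enveloping_algebra)
  define \<pi> where "\<pi> f = I +>\<^bsub>F\<^esub> f" for f
  have hom: "\<pi> \<in> ring_hom F U"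
    unfolding U \<pi>_def by (rule I.rcos_ring_hom)
  have carrier_U: "carrier U = range \<pi>"
    by (auto simp: U \<pi>_def FactRing_def A_RCOSETS_def' F_simps)
  have pi_add: "\<pi> (f + g) = \<pi> f \<oplus>\<^bsub>U\<^esub> \<pi> g" and pi_mult: "\<pi> (f * g) = \<pi> f \<otimes>\<^bsub>U\<^esub> \<pi> g" for f g
    using ring_hom_add[OF hom, of f g] ring_hom_mult[OF hom, of f g] by (simp_all add: F_simps)
  have pi_zero: "\<pi> f = \<zero>\<^bsub>U\<^esub>" if "f \<in> I" for f
    using I.a_rcos_const[OF that] by (simp add: U \<pi>_def FactRing_def)
  have pi_cong: "\<pi> f = \<pi> g" if "f - g \<in> I" for f g
    using pi_add[of "f - g" g] pi_zero[OF that] carrier_U by simp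
  obtain W where W: "\<And>w f. w \<in> W \<Longrightarrow> commutator w f \<in> I" "I.acc_below W UNIV"
    using I.exists_central_set_acc[OF fd p] by blast
  have pi_center: "\<pi> w \<in> center U" if "w \<in> W" for w
  proof -
    have "\<pi> f \<otimes>\<^bsub>U\<^esub> \<pi> w = \<pi> w \<otimes>\<^bsub>U\<^esub> \<pi> f" for f
      using pi_cong[OF W(1)[OF that, of f, unfolded commutator_def]] by (simp add: pi_mult)
    then show ?thesis by (auto simp: center_def carrier_U)
  qed
  have minus_one_center: "\<pi> (- 1) \<in> center U"
    by (auto simp: center_def carrier_U pi_mult[symmetric])
  have "\<exists>n. \<forall>m\<ge>n. N m = N n"
    if N: "\<And>i. submodule (N i) (center_ring U) (regular_module U)" "\<And>i. N i \<subseteq> N (Suc i)"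
    for N :: "nat \<Rightarrow> ('a, 'k) free_algebra set set"
  proof -
    note ND = submoduleD[OF N(1), simplified]
    have ND_diff: "f - g \<in> \<pi> -` N i" if "f \<in> \<pi> -` N i" "g \<in> \<pi> -` N i" for f g i
    proof -
      have "\<pi> (- 1) \<odot>\<^bsub>regular_module U\<^esub> \<pi> g \<in> N i"
        using that(2) by (intro ND(5) minus_one_center) simp
      then have "\<pi> (- 1 * g) \<in> N i"
        unfolding pi_mult by (simp add: regular_module_def)
      then have "\<pi> f \<oplus>\<^bsub>regular_module U\<^esub> \<pi> (- 1 * g) \<in> N i"
        using that(1) by (intro ND(4)) simp_all
      then have "\<pi> (f + - 1 * g) \<in> N i"
        unfolding pi_add by (simp add: regular_module_def)
      then show ?thesis by simp
    qed
    have "I.stable W (\<pi> -` N i)" for i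
      unfolding I.stable_def
    proof (intro conjI ballI)
      show "I \<subseteq> \<pi> -` N i" using pi_zero ND(3)[of i] by (auto simp: regular_module_def)
      show "f - g \<in> \<pi> -` N i" if "f \<in> \<pi> -` N i" "g \<in> \<pi> -` N i" for f g
        using ND_diff that .
      show "w * f \<in> \<pi> -` N i" if "w \<in> W" "f \<in> \<pi> -` N i" for w f
        using ND(5)[OF pi_center[OF that(1)], of "\<pi> f" i] that(2) by (simp add: pi_mult regular_module_def)
    qed
    then have "\<exists>n. \<forall>m\<ge>n. \<pi> -` N m = \<pi> -` N n"
      by (rule I.acc_belowD[OF W(2)]) (use N(2) in auto)
    moreover have "N i = \<pi> ` (\<pi> -` N i)" for i
      using ND(1)[of i] by (auto simp: regular_module_def carrier_U)
    ultimately show ?thesis by metis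
  qed
  then show ?thesis
    unfolding noetherian_over_center_def U_def[symmetric] using U.ring_axioms by blast
qed

theorem theorem2p4:
  fixes scale :: "'k::field \<Rightarrow> 'a::ab_group_add \<Rightarrow> 'a"
    and bracket :: "'a \<Rightarrow> 'a \<Rightarrow> 'a"
    and M :: "(('a, 'k) free_algebra set, 'm) module"
    and E :: "(('a, 'k) free_algebra set, 'e) module"
    and j :: "'m \<Rightarrow> 'e"
  assumes "lie_algebra scale bracket"
    and "\<exists>Basis. finite_dimensional_vector_space scale Basis"
    and "prime CHAR('k)"
    and "artinian_module (universal_enveloping_algebra scale bracket) M"
    and "injective_hull (universal_enveloping_algebra scale bracket) M j E"
  shows "artinian_module (universal_enveloping_algebra scale bracket) E"
  using noetherian_over_center_universal_enveloping_algebra[OF assms(1-3)] assms(4,5)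
  unfolding injective_hull_def by (blast intro: essential_extension_artinian)

end
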